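(* Let $a,b$ be odd nonzero integers, let $p$ be an odd prime with $p\neq 7$, and let $m$ be an integer with $0<m<p-1$. Consider the superelliptic curves $C_{1}:\ y^{p}=x^{m}(x+a)$ and $C_{2}:\ y^{p}=x^{m}(x+b)$. Then there exists a rational function $D\in\mathbb{Q}(u,v,w,t)$ such that the Jacobians of the $p$-twists $$D\,y^{p}=x^{m}(x+a),\qquad D\,y^{p}=x^{m}(x+b)$$ of $C_1$ and $C_2$ by $D$ both have positive rank over $\mathbb{Q}(u,v,w,t)$.
   Context: $u,v,w,t$ are independent indeterminates. Jacobians are those of the smooth projective models over $\mathbb{Q}(u,v,w,t)$; "positive rank" means the group of $\mathbb{Q}(u,v,w,t)$-rational points of the Jacobian contains a point of infinite order. *)

theory Defs
  imports
    "HOL-Computational_Algebra.Computational_Algebra"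
    "HOL-Algebra.Algebraic_Closure_Type"
    "HOL-Algebra.Free_Abelian_Groups"
begin

text \<open>
  The field \<open>\<rat>(u,v,w,t)\<close> as the iterated rational function field \<open>\<rat>(u)(v)(w)(t)\<close>.
\<close>

type_synonym Quvwt = "rat poly fract poly fract poly fract poly fract"

text \<open>
  For a field \<open>k\<close> of characteristic 0, all curves \<open>D y\<^sup>n = f(x)\<close> over \<open>k\<close> are treated inside one
  algebraically closed field, an algebraic closure of \<open>K(x)\<close>, where \<open>K\<close> is an algebraic
  closure of \<open>k\<close>.
\<close>

type_synonym 'k ambient = "'k alg_closure poly fract alg_closure"

definition const_emb :: "'k::field alg_closure \<Rightarrow> 'k ambient" where
  "const_emb c = to_ac (to_fract [:c:])"

definition base_emb :: "'k::field \<Rightarrow> 'k ambient" where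
  "base_emb c = const_emb (to_ac c)"

definition coord_x :: "'k::field ambient" where
  "coord_x = to_ac (to_fract [:0, 1:])"

text \<open>
  A coordinate function \<open>y\<close> on the curve \<open>D y\<^sup>n = f(x)\<close>. Two choices differ by an \<open>n\<close>-th root of
  unity, and when the curve is geometrically irreducible they give \<open>k\<close>-isomorphic data \<open>(x, y)\<close>.
\<close>

definition coord_y :: "'k::field \<Rightarrow> nat \<Rightarrow> 'k poly \<Rightarrow> 'k ambient" where
  "coord_y D n f = (SOME y. base_emb D * y ^ n = poly (map_poly base_emb f) coord_x)"

text \<open>The function field \<open>K(x,y) = K(x)[y]\<close> of the curve over the algebraic closure \<open>K\<close> of \<open>k\<close>.\<close>

definition function_field :: "'k::field ambient \<Rightarrow> 'k ambient set" where
  "function_field y = range (\<lambda>q :: 'k alg_closure poly fract poly. poly (map_poly to_ac q) y)"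

text \<open>
  The points of the smooth projective model over \<open>K\<close> are the discrete valuation rings of \<open>K(x,y)\<close>
  containing \<open>K\<close>. As \<open>K\<close> is algebraically closed, they all have degree 1.
\<close>

definition ring_units :: "'f::field set \<Rightarrow> 'f set" where
  "ring_units R = {u \<in> R. u \<noteq> 0 \<and> inverse u \<in> R}"

definition uniformizer :: "'f::field set \<Rightarrow> 'f set \<Rightarrow> 'f \<Rightarrow> bool" where
  "uniformizer F R s \<longleftrightarrow> s \<in> R \<and> s \<noteq> 0 \<and> inverse s \<notin> R \<and>
     (\<forall>g\<in>F - {0}. \<exists>n::int. \<exists>u\<in>ring_units R. g = s powi n * u)"

definition curve_points :: "'k::field ambient \<Rightarrow> 'k ambient set set" where
  "curve_points y = {R. range const_emb \<subseteq> R \<and> R \<subseteq> function_field y \<and>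
     (\<forall>g\<in>R. \<forall>h\<in>R. g - h \<in> R \<and> g * h \<in> R) \<and>
     (\<exists>s. uniformizer (function_field y) R s)}"

definition ord_at :: "'k::field ambient \<Rightarrow> 'k ambient set \<Rightarrow> 'k ambient \<Rightarrow> int" where
  "ord_at y R g = (THE n. \<exists>s. uniformizer (function_field y) R s \<and>
     (\<exists>u\<in>ring_units R. g = s powi n * u))"

definition divisor_degree :: "('p \<Rightarrow>\<^sub>0 int) \<Rightarrow> int" where
  "divisor_degree d = (\<Sum>P\<in>Poly_Mapping.keys d. Poly_Mapping.lookup d P)"

definition Div0 :: "'k::field ambient \<Rightarrow> ('k ambient set \<Rightarrow>\<^sub>0 int) monoid" where
  "Div0 y = free_Abelian_group (curve_points y)
     \<lparr>carrier := {d \<in> carrier (free_Abelian_group (curve_points y)). divisor_degree d = 0}\<rparr>"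

text \<open>That the divisor of a function is finitely supported of degree 0 is a theorem, so that restricting
  to \<open>Div0\<close> below excludes no function.\<close>

definition Princ :: "'k::field ambient \<Rightarrow> ('k ambient set \<Rightarrow>\<^sub>0 int) set" where
  "Princ y = {d \<in> carrier (Div0 y). \<exists>g\<in>function_field y - {0}.
     \<forall>R\<in>curve_points y. Poly_Mapping.lookup d R = ord_at y R g}"

definition Pic0 :: "'k::field ambient \<Rightarrow> ('k ambient set \<Rightarrow>\<^sub>0 int) set monoid" where
  "Pic0 y = Div0 y Mod Princ y"

definition field_automorphism :: "('f::field \<Rightarrow> 'f) \<Rightarrow> bool" where
  "field_automorphism \<sigma> \<longleftrightarrow> bij \<sigma> \<and> \<sigma> 1 = 1 \<and>
     (\<forall>g h. \<sigma> (g + h) = \<sigma> g + \<sigma> h) \<and> (\<forall>g h. \<sigma> (g * h) = \<sigma> g * \<sigma> h)"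

definition Galois_group :: "('k::field alg_closure \<Rightarrow> 'k alg_closure) set" where
  "Galois_group = {\<sigma>. field_automorphism \<sigma> \<and> (\<forall>c. \<sigma> (to_ac c) = to_ac c)}"

text \<open>
  An element \<open>\<sigma>\<close> of \<open>Gal(K/k)\<close> acts on \<open>K(x,y)\<close> through the coefficients, fixing \<open>x\<close> and \<open>y\<close>.
  The set below consists of the extensions of these actions to the ambient field; an extension
  exists for every \<open>\<sigma>\<close> when the curve is geometrically irreducible, and its restriction to
  \<open>K(x,y)\<close> depends only on \<open>\<sigma>\<close>.
\<close>

definition Galois_lifts :: "'k::field ambient \<Rightarrow> ('k ambient \<Rightarrow> 'k ambient) set" where
  "Galois_lifts y = {\<tau>. field_automorphism \<tau> \<and> \<tau> coord_x = coord_x \<and> \<tau> y = y \<and>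
     (\<exists>\<sigma>\<in>Galois_group. \<forall>c. \<tau> (const_emb c) = const_emb (\<sigma> c))}"

definition divisor_conj ::
  "('k::field ambient \<Rightarrow> 'k ambient) \<Rightarrow> ('k ambient set \<Rightarrow>\<^sub>0 int) \<Rightarrow> ('k ambient set \<Rightarrow>\<^sub>0 int)" where
  "divisor_conj \<tau> = frag_extend (\<lambda>R. frag_of (\<tau> ` R))"

text \<open>
  The group \<open>J(k) = J(K)\<^bsup>Gal(K/k)\<^esup>\<close> of \<open>k\<close>-rational points of the Jacobian \<open>J\<close>, where
  \<open>J(K) = Pic\<^sup>0\<close> of the curve over \<open>K\<close>.
\<close>

definition Jacobian_points :: "'k::field ambient \<Rightarrow> ('k ambient set \<Rightarrow>\<^sub>0 int) set monoid" where
  "Jacobian_points y = Pic0 y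
     \<lparr>carrier := {c \<in> carrier (Pic0 y). \<forall>\<tau>\<in>Galois_lifts y. divisor_conj \<tau> ` c = c}\<rparr>"

definition positive_rank :: "('a, 'b) monoid_scheme \<Rightarrow> bool" where
  "positive_rank G \<longleftrightarrow> (\<exists>c\<in>carrier G. \<forall>n::nat. n > 0 \<longrightarrow> c [^]\<^bsub>G\<^esub> n \<noteq> \<one>\<^bsub>G\<^esub>)"

definition superelliptic_Jacobian ::
  "'k::field \<Rightarrow> nat \<Rightarrow> 'k poly \<Rightarrow> ('k ambient set \<Rightarrow>\<^sub>0 int) set monoid" where
  "superelliptic_Jacobian D n f = Jacobian_points (coord_y D n f)"

lemma base_emb_eq_0_iff: "base_emb c = 0 \<longleftrightarrow> c = 0"
  by (simp add: base_emb_def const_emb_def)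

lemma coord_y_equation:
  assumes "D \<noteq> 0" and "n > 0"
  shows "base_emb D * coord_y D n f ^ n = poly (map_poly base_emb f) coord_x"
proof -
  obtain y where "y ^ n = poly (map_poly base_emb f) coord_x / base_emb D"
    using nth_root_exists[OF assms(2)] by blast
  hence "base_emb D * y ^ n = poly (map_poly base_emb f) coord_x"
    using assms(1) by (simp add: base_emb_eq_0_iff field_simps)
  thus ?thesis
    unfolding coord_y_def by (rule someI)
qed

end

theory Submission
  imports Defs
begin

text \<open>
  Put \<open>s = 2\<^sup>p\<close> and \<open>X = (s\<^sup>m b t\<^sup>p - a) / (1 - s\<^bsup>m+1\<^esup> t\<^sup>p)\<close>. Then \<open>X + a = t\<^sup>p s\<^sup>m (s X + b)\<close>, so for
  \<open>D = X\<^sup>m (X + a)\<close> the two twists contain the points \<open>(X, 1)\<close> and \<open>(s X, 1/t)\<close>, whose \<open>x\<close>-coordinates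
  are transcendental over \<open>\<rat>\<close>: since \<open>b \<noteq> s a\<close>, they have a pole at \<open>t = 2\<^bsup>-(m+1)\<^esup>\<close>. Such a point \<open>P\<close> gives a class of infinite order, namely that of
  \<open>|B| P - \<Sum>\<^sub>Q\<^sub>\<in>\<^sub>B Q\<close>, where \<open>B\<close> is the fibre of the \<open>x\<close>-coordinate through \<open>P\<close>.
  Indeed, over the algebraic closure \<open>K\<close> the curve is defined over \<open>\<rat>\<close>, and there is a derivation of
  \<open>K\<close> that does not annihilate \<open>X\<close>; let it act on functions through their coefficients. If a positive
  multiple of the divisor above were the divisor of \<open>g\<close>, then the logarithmic derivative \<open>h\<close> of \<open>g\<close>
  would have only simple poles, all of them in \<open>B\<close>. The trace of \<open>h y\<close> to \<open>K(x)\<close> would then have a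
  simple pole at \<open>X\<close> as its only pole but zeros at \<open>0\<close> and \<open>-a\<close>, which is impossible.
\<close>

text \<open>The factor \<open>y\<close> under the trace is the crux. The trace of \<open>h\<close>
  alone is the logarithmic derivative of the norm of \<open>g\<close>, which sees only the image of
  the divisor on the x-line, and that image is zero. The weight \<open>y\<close> separates the
  points of the fibre: their y-coordinates sum to zero, so the residue at X is, up to a nonzero
  factor, |B| times the y-coordinate of P. The price is the pole of \<open>y\<close> at infinity, of
  order m + 1 in a parameter whose p-th power is 1/x; as m + 1 < p it is too weak to give a pole in
  x. One simple pole then faces two zeros. At the ramified points nothing has to be known about the
  order of \<open>g\<close>, because the derivation annihilates the local parameter. The twist comes
  from eliminating D between points with x-coordinates X and s X: (X + a) / (s^m (s X + b)) must be
  a p-th power. Setting it equal to t^p is linear in X and can be solved for any s. With s = 2^p the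
  pole of X is rational, and the parity of b excludes b = s a, where X would be the constant
  -a.\<close>

instance fract :: ("{idom,ring_char_0}") field_char_0
proof
  show "inj (of_nat :: nat \<Rightarrow> 'a fract)"
    by (auto simp: inj_def of_nat_fract eq_fract)
qed

section \<open>Evaluation of polynomials along a ring homomorphism\<close>

locale ring_morphism =
  fixes f :: "'a::comm_ring_1 \<Rightarrow> 'b::comm_ring_1"
  assumes hom_one: "f 1 = 1"
    and hom_add: "f (a + b) = f a + f b"
    and hom_mult: "f (a * b) = f a * f b"
begin

lemma hom_zero: "f 0 = 0"
  using hom_add[of 0 0] by simp

lemma hom_minus: "f (- a) = - f a"
  using hom_add[of a "- a"] by (simp add: hom_zero eq_neg_iff_add_eq_0 add.commute)

lemma hom_diff: "f (a - b) = f a - f b"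
  using hom_add[of a "- b"] by (simp add: hom_minus)

lemma hom_power: "f (a ^ n) = f a ^ n"
  by (induction n) (simp_all add: hom_one hom_mult)

lemma hom_sum: "f (\<Sum>i\<in>I. g i) = (\<Sum>i\<in>I. f (g i))"
  by (induction I rule: infinite_finite_induct) (simp_all add: hom_zero hom_add)

lemma hom_of_nat: "f (of_nat n) = of_nat n"
  by (induction n) (simp_all add: hom_zero hom_add hom_one)

lemma hom_of_int: "f (of_int n) = of_int n"
  by (cases n rule: int_diff_cases) (simp add: hom_of_nat hom_diff)

lemma map_poly_morphism: "ring_morphism (map_poly f)"
proof
  show "map_poly f 1 = 1"
    by (simp add: hom_one)
  show "map_poly f (p + q) = map_poly f p + map_poly f q" for p q
    by (intro poly_eqI) (simp add: coeff_map_poly hom_zero hom_add)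
  show "map_poly f (p * q) = map_poly f p * map_poly f q" for p q
    by (intro poly_eqI) (simp add: coeff_map_poly hom_zero hom_mult hom_sum coeff_mult)
qed

end

definition eval1 :: "('a::comm_ring_1 \<Rightarrow> 'b::comm_ring_1) \<Rightarrow> 'b \<Rightarrow> 'a poly \<Rightarrow> 'b" where
  "eval1 f x q = poly (map_poly f q) x"

text \<open>The inner variable of \<open>'a poly poly\<close> goes to \<open>x\<close>, the outer
  one to \<open>y\<close>. Keeping \<open>y\<close> outermost turns reduction modulo the equation of
  the curve into division with remainder in one variable.\<close>

definition eval2 :: "('a::comm_ring_1 \<Rightarrow> 'b::comm_ring_1) \<Rightarrow> 'b \<Rightarrow> 'b \<Rightarrow> 'a poly poly \<Rightarrow> 'b" where
  "eval2 f x y = eval1 (eval1 f x) y"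

context ring_morphism
begin

lemma eval1_morphism: "ring_morphism (eval1 f x)"
proof -
  interpret m: ring_morphism "map_poly f" by (rule map_poly_morphism)
  show ?thesis
    by standard (simp_all add: eval1_def m.hom_one m.hom_add m.hom_mult)
qed

lemma eval1_pCons: "eval1 f x (pCons c q) = f c + x * eval1 f x q"
  by (simp add: eval1_def map_poly_pCons hom_zero)

lemma eval1_0: "eval1 f x 0 = 0"
  by (simp add: eval1_def)

lemma eval1_const: "eval1 f x [:c:] = f c"
  by (simp add: eval1_pCons eval1_0)

lemma eval1_X: "eval1 f x [:0, 1:] = x"
  by (simp add: eval1_pCons eval1_0 hom_zero hom_one)

lemma eval1_sum:
  assumes "degree q < n"
  shows "eval1 f x q = (\<Sum>i<n. f (coeff q i) * x ^ i)"
proof -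
  have "poly (map_poly f q) x = (\<Sum>i<n. coeff (map_poly f q) i * x ^ i)"
    unfolding poly_altdef
  proof (rule sum.mono_neutral_left)
    show "{..degree (map_poly f q)} \<subseteq> {..<n}"
      using assms degree_le[of "degree q" "map_poly f q"]
      by (auto simp: coeff_map_poly coeff_eq_0 hom_zero)
  qed (auto simp: coeff_eq_0)
  then show ?thesis
    by (simp add: eval1_def coeff_map_poly hom_zero)
qed

lemma eval1_smult: "eval1 f x (smult c q) = f c * eval1 f x q"
proof -
  interpret e: ring_morphism "eval1 f x" by (rule eval1_morphism)
  have "smult c q = [:c:] * q" by simp
  then show ?thesis by (simp only: e.hom_mult eval1_const)
qed

lemma eval2_morphism: "ring_morphism (eval2 f x y)"
  unfolding eval2_def by (intro ring_morphism.eval1_morphism eval1_morphism)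

lemma eval2_const: "eval2 f x y [:q:] = eval1 f x q"
  unfolding eval2_def by (intro ring_morphism.eval1_const eval1_morphism)

lemma eval2_Y: "eval2 f x y [:0, 1:] = y"
  unfolding eval2_def by (intro ring_morphism.eval1_X eval1_morphism)

lemma eval2_sum:
  "degree A < n \<Longrightarrow> eval2 f x y A = (\<Sum>i<n. eval1 f x (coeff A i) * y ^ i)"
  unfolding eval2_def by (intro ring_morphism.eval1_sum eval1_morphism)

lemma eval2_smult: "eval2 f x y (smult c A) = eval1 f x c * eval2 f x y A"
  unfolding eval2_def by (intro ring_morphism.eval1_smult eval1_morphism)

end

section \<open>Derivations\<close>

locale derivation =
  fixes d :: "'a::field \<Rightarrow> 'a"
  assumes d_add: "d (a + b) = d a + d b"
    and d_mult: "d (a * b) = a * d b + d a * b"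
begin

lemma d_zero: "d 0 = 0"
  using d_add[of 0 0] add_left_cancel[of "d 0" "d 0" 0] by simp

lemma d_one: "d 1 = 0"
  using d_mult[of 1 1] add_left_cancel[of "d 1" "d 1" 0] by simp

lemma d_minus: "d (- a) = - d a"
  using d_add[of a "- a"] by (simp add: d_zero eq_neg_iff_add_eq_0 add.commute)

lemma d_of_nat: "d (of_nat n) = 0"
  by (induction n) (simp_all add: d_zero d_add d_one)

lemma d_of_int: "d (of_int n) = 0"
  using d_add[of "of_int n" "of_nat (nat (- n))"] d_of_nat[of "nat n"] d_of_nat[of "nat (- n)"]
  by (cases "n \<ge> 0") (simp_all add: d_minus d_zero)

lemma d_power: "d (a ^ Suc n) = of_nat (Suc n) * a ^ n * d a"
  by (induction n) (simp_all add: d_mult algebra_simps)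

lemma d_inverse: "d (inverse a) = - d a * inverse a * inverse a"
proof (cases "a = 0")
  case False
  then have "a * d (inverse a) = - d a * inverse a"
    using d_mult[of a "inverse a"] by (simp add: d_one eq_neg_iff_add_eq_0)
  then have "d (inverse a) = inverse a * (- d a * inverse a)"
    using False by (metis left_inverse mult.assoc mult_1)
  then show ?thesis
    by (simp add: mult_ac)
qed (simp add: d_zero)

end

text \<open>
  A derivation on a subring \<open>L\<close> of a field is a subring of the dual numbers that is the graph of a
  function on \<open>L\<close>; the second conjunct below says that it is a graph.
\<close>

definition derivation_graph :: "('a::field \<times> 'a) set \<Rightarrow> bool" where
  "derivation_graph S \<longleftrightarrow> (1, 0) \<in> S \<and> (\<forall>c. (0, c) \<in> S \<longrightarrow> c = 0) \<and>
     (\<forall>a a' b b'. (a, a') \<in> S \<longrightarrow> (b, b') \<in> S \<longrightarrow>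
        (a - b, a' - b') \<in> S \<and> (a * b, a * b' + a' * b) \<in> S)"

context
  fixes S :: "('a::field_char_0 \<times> 'a) set"
  assumes S: "derivation_graph S"
begin

lemma graph_one: "(1, 0) \<in> S"
  and graph_zero_imp: "(0, c) \<in> S \<Longrightarrow> c = 0"
  and graph_diff: "(a, a') \<in> S \<Longrightarrow> (b, b') \<in> S \<Longrightarrow> (a - b, a' - b') \<in> S"
  and graph_mult: "(a, a') \<in> S \<Longrightarrow> (b, b') \<in> S \<Longrightarrow> (a * b, a * b' + a' * b) \<in> S"
  using S unfolding derivation_graph_def by blast+

lemma graph_zero: "(0, 0) \<in> S"
  using graph_diff[OF graph_one graph_one] by simp

lemma graph_add: "(a, a') \<in> S \<Longrightarrow> (b, b') \<in> S \<Longrightarrow> (a + b, a' + b') \<in> S"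
  using graph_diff[of a a' "0 - b" "0 - b'"] graph_diff[OF graph_zero, of b b'] by simp

lemma graph_unique: "(a, b) \<in> S \<Longrightarrow> (a, c) \<in> S \<Longrightarrow> b = c"
  using graph_diff[of a b a c] graph_zero_imp[of "b - c"] by simp

lemma graph_of_nat: "(of_nat n, 0) \<in> S"
  by (induction n) (use graph_zero graph_add[OF graph_one] in \<open>force+\<close>)

lemma graph_sum:
  "(\<And>i. i \<in> I \<Longrightarrow> (g i, h i) \<in> S) \<Longrightarrow> (\<Sum>i\<in>I. g i, \<Sum>i\<in>I. h i) \<in> S"
  by (induction I rule: infinite_finite_induct) (auto simp: graph_zero intro!: graph_add)

text \<open>Coefficientwise differentiation of polynomials, as a relation because \<open>S\<close>
  is only a graph.\<close>

definition graph_poly :: "'a poly \<Rightarrow> 'a poly \<Rightarrow> bool" where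
  "graph_poly q q' \<longleftrightarrow> (\<forall>i. (coeff q i, coeff q' i) \<in> S)"

lemma graph_poly_diff: "graph_poly q q' \<Longrightarrow> graph_poly r r' \<Longrightarrow> graph_poly (q - r) (q' - r')"
  by (simp add: graph_poly_def graph_diff)

lemma graph_poly_mult:
  assumes "graph_poly q q'" "graph_poly r r'"
  shows "graph_poly (q * r) (q * r' + q' * r)"
  using assms unfolding graph_poly_def coeff_mult coeff_add sum.distrib[symmetric]
  by (auto intro!: graph_sum graph_mult)

lemma graph_poly_monom: "(c, c') \<in> S \<Longrightarrow> graph_poly (monom c n) (monom c' n)"
  by (simp add: graph_poly_def graph_zero)

lemma graph_poly_pderiv: "graph_poly q q' \<Longrightarrow> graph_poly (pderiv q) (pderiv q')"
  unfolding graph_poly_def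
proof
  fix i
  assume "\<forall>i. (coeff q i, coeff q' i) \<in> S"
  then have "(coeff q (Suc i), coeff q' (Suc i)) \<in> S" by blast
  from graph_mult[OF graph_of_nat this, of "Suc i"]
  show "(coeff (pderiv q) i, coeff (pderiv q') i) \<in> S"
    by (simp add: coeff_pderiv del: of_nat_Suc)
qed

lemma graph_poly_0_imp: "graph_poly 0 q' \<Longrightarrow> q' = 0"
  using graph_zero_imp by (auto simp: graph_poly_def poly_eq_iff)

text \<open>The chain rule: the derivative of the value of \<open>q\<close> at \<open>x\<close> when
  the coefficients have the derivatives \<open>q'\<close> and \<open>x\<close> has the derivative
  \<open>b\<close>.\<close>

definition ext_deriv :: "'a \<Rightarrow> 'a \<Rightarrow> 'a poly \<Rightarrow> 'a poly \<Rightarrow> 'a" where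
  "ext_deriv x b q q' = poly q' x + poly (pderiv q) x * b"

lemma ext_deriv_diff: "ext_deriv x b (q - r) (q' - r') = ext_deriv x b q q' - ext_deriv x b r r'"
  by (simp add: ext_deriv_def pderiv_diff algebra_simps)

lemma ext_deriv_mult:
  "ext_deriv x b (q * r) (q * r' + q' * r) =
     poly q x * ext_deriv x b r r' + ext_deriv x b q q' * poly r x"
  by (simp add: ext_deriv_def pderiv_mult algebra_simps)

text \<open>
  For algebraic \<open>x\<close> the value \<open>b\<close> of the derivation at \<open>x\<close> is forced by a polynomial of minimal
  degree vanishing at \<open>x\<close>; for transcendental \<open>x\<close> any value works.
\<close>

lemma ext_deriv_well_defined:
  "\<exists>b. \<forall>q q'. graph_poly q q' \<longrightarrow> poly q x = 0 \<longrightarrow> ext_deriv x b q q' = 0"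
proof (cases "\<exists>q q'. graph_poly q q' \<and> q \<noteq> 0 \<and> poly q x = 0")
  case False
  then have "ext_deriv x 0 q q' = 0" if "graph_poly q q'" "poly q x = 0" for q q'
    using graph_poly_0_imp[of q'] that by (auto simp: ext_deriv_def)
  then show ?thesis by blast
next
  case True
  define P where "P = (\<lambda>q. (\<exists>q'. graph_poly q q') \<and> q \<noteq> 0 \<and> poly q x = 0)"
  define f where "f = arg_min degree P"
  obtain q0 where "P q0"
    using True by (auto simp: P_def)
  from arg_min_nat_lemma[of P, OF this, of degree]
  have "P f" and min: "P q \<Longrightarrow> degree f \<le> degree q" for q
    by (simp_all add: f_def)
  then obtain f' where f: "graph_poly f f'" "f \<noteq> 0" "poly f x = 0"
    by (auto simp: P_def)
  have "degree f > 0"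
  proof (rule ccontr)
    assume "\<not> degree f > 0"
    then obtain c where "f = [:c:]" by (metis degree_eq_zeroE gr0I)
    with f show False by simp
  qed
  \<comment> \<open>In characteristic 0 the formal derivative is nonzero, and its coefficients are
    still in the domain of \<open>S\<close>; so the minimality of \<open>f\<close> makes
    \<open>x\<close> a simple root of \<open>f\<close>.\<close>
  then have "\<not> P (pderiv f)"
    using min[of "pderiv f"] by (auto simp: degree_pderiv)
  moreover have "pderiv f \<noteq> 0"
    using \<open>degree f > 0\<close> by (simp add: pderiv_eq_0_iff)
  ultimately have f0: "poly (pderiv f) x \<noteq> 0"
    using graph_poly_pderiv[OF f(1)] by (auto simp: P_def)
  define b where "b = - poly f' x / poly (pderiv f) x"
  have bf: "ext_deriv x b f f' = 0"
    using f0 by (simp add: ext_deriv_def b_def)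
  have "ext_deriv x b q q' = 0" if "graph_poly q q'" "poly q x = 0" for q q'
    using that
  proof (induction "degree q" arbitrary: q q' rule: less_induct)
    case less
    show ?case
    proof (cases "q = 0")
      case True
      then show ?thesis
        using less.prems graph_poly_0_imp[of q'] by (auto simp: ext_deriv_def)
    next
      case False
      then have le: "degree f \<le> degree q"
        using min less.prems by (auto simp: P_def)
      \<comment> \<open>\<open>S\<close> lives on a ring, so \<open>f\<close> cannot be made monic.
        One step of pseudo-division is done instead, with the derivatives carried along by the
        product rule; the factor \<open>lead_coeff f\<close> is cancelled at the end.\<close>
      define l u where "l = monom (lead_coeff f) 0"
        and "u = monom (lead_coeff q) (degree q - degree f)"
      define l' u' where "l' = monom (coeff f' (degree f)) 0"
        and "u' = monom (coeff q' (degree q)) (degree q - degree f)"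
      define r where "r = l * q - u * f"
      define r' where "r' = (l * q' + l' * q) - (u * f' + u' * f)"
      have lu: "graph_poly l l'" "graph_poly u u'"
        using f(1) less.prems(1) unfolding l_def l'_def u_def u'_def
        by (simp_all add: graph_poly_def graph_zero)
      have r: "graph_poly r r'" "poly r x = 0"
        unfolding r_def r'_def
        by (intro graph_poly_diff graph_poly_mult lu f less.prems)
          (simp add: f less.prems)
      have dr: "degree r < degree q \<or> r = 0"
      proof (cases "r = 0")
        case False
        have "degree r \<le> degree q"
          unfolding r_def
        proof (rule degree_diff_le)
          show "degree (l * q) \<le> degree q"
            using degree_mult_le[of l q] by (simp add: l_def monom_0)
          show "degree (u * f) \<le> degree q"
            using degree_mult_le[of u f] le degree_monom_le[of "lead_coeff q" "degree q - degree f"]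
            unfolding u_def by linarith
        qed
        moreover have "coeff r (degree q) = 0"
          using le by (simp add: r_def l_def u_def coeff_monom_mult monom_0)
        ultimately show ?thesis
          using False eq_zero_or_degree_less by blast
      qed simp
      have "ext_deriv x b r r' = 0"
      proof (cases "r = 0")
        case True
        then show ?thesis using r graph_poly_0_imp[of r'] by (auto simp: ext_deriv_def)
      next
        case False
        then have "degree r < degree q" using dr by blast
        from less.hyps[OF this r] show ?thesis .
      qed
      then have "poly l x * ext_deriv x b q q' = 0"
        by (simp add: r_def r'_def ext_deriv_diff ext_deriv_mult less.prems f bf)
      then show ?thesis
        using f by (simp add: l_def poly_monom)
    qed
  qed
  then show ?thesis by blast
qed

text \<open>\<open>T\<close> is the subring of the dual numbers generated by \<open>S\<close> and
  \<open>(x, b)\<close>. For it to be a graph again, a polynomial vanishing at \<open>x\<close> must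
  have derivative 0 there, and \<open>b\<close> is chosen for that.\<close>

lemma derivation_graph_extend_one:
  "\<exists>T. derivation_graph T \<and> S \<subseteq> T \<and> (\<exists>b. (x, b) \<in> T)"
proof -
  obtain b where b: "graph_poly q q' \<Longrightarrow> poly q x = 0 \<Longrightarrow> ext_deriv x b q q' = 0" for q q'
    using ext_deriv_well_defined by blast
  define T where "T = {(poly q x, ext_deriv x b q q') |q q'. graph_poly q q'}"
  have T: "(poly q x, ext_deriv x b q q') \<in> T" if "graph_poly q q'" for q q'
    using that by (auto simp: T_def)
  have "derivation_graph T"
    unfolding derivation_graph_def
  proof (intro conjI allI impI)
    have "graph_poly 1 0"
      by (auto simp: graph_poly_def graph_one graph_zero)
    from T[OF this] show "(1, 0) \<in> T" by (simp add: ext_deriv_def)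
    show "c = 0" if "(0, c) \<in> T" for c
      using that b by (auto simp: T_def)
  next
    fix a a' c c' assume "(a, a') \<in> T" "(c, c') \<in> T"
    then obtain q q' r r' where *: "graph_poly q q'" "graph_poly r r'"
      "a = poly q x" "a' = ext_deriv x b q q'" "c = poly r x" "c' = ext_deriv x b r r'"
      by (auto simp: T_def)
    show "(a - c, a' - c') \<in> T"
      using T[OF graph_poly_diff[OF *(1,2)]] * by (simp add: ext_deriv_diff)
    show "(a * c, a * c' + a' * c) \<in> T"
      using T[OF graph_poly_mult[OF *(1,2)]] * by (simp add: ext_deriv_mult)
  qed
  moreover have "S \<subseteq> T"
  proof clarify
    fix a a' assume "(a, a') \<in> S"
    from T[OF graph_poly_monom[OF this, of 0]] show "(a, a') \<in> T"
      by (simp add: ext_deriv_def poly_monom pderiv_monom)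
  qed
  moreover have "(x, b) \<in> T"
    using T[of "monom 1 1" "monom 0 1"] graph_poly_monom[OF graph_one, of 1]
    by (simp add: ext_deriv_def poly_monom pderiv_monom)
  ultimately show ?thesis by blast
qed

end

text \<open>Zorn's lemma: a graph that is maximal under inclusion is total, since a missing element
  could be adjoined.\<close>

theorem derivation_extend:
  fixes S :: "('a::field_char_0 \<times> 'a) set"
  assumes "derivation_graph S"
  shows "\<exists>d. derivation d \<and> (\<forall>(a, b)\<in>S. d a = b)"
proof -
  define \<F> where "\<F> = {T. derivation_graph T \<and> S \<subseteq> T}"
  have "\<exists>M\<in>\<F>. \<forall>T\<in>\<F>. M \<subseteq> T \<longrightarrow> T = M"
  proof (rule subset_Zorn_nonempty)
    show "\<F> \<noteq> {}" using assms by (auto simp: \<F>_def)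
    fix C assume C: "C \<noteq> {}" "subset.chain \<F> C"
    have g: "derivation_graph T" "S \<subseteq> T" if "T \<in> C" for T
      using C(2) that by (auto simp: subset_chain_def \<F>_def)
    have "derivation_graph (\<Union>C)"
      unfolding derivation_graph_def
    proof (intro conjI allI impI)
      show "(1, 0) \<in> \<Union>C" using C(1) graph_one[OF g(1)] by blast
      show "c = 0" if "(0, c) \<in> \<Union>C" for c
        using that graph_zero_imp[OF g(1)] by blast
    next
      fix a a' b b' assume "(a, a') \<in> \<Union>C" "(b, b') \<in> \<Union>C"
      then obtain T U where "T \<in> C" "U \<in> C" "(a, a') \<in> T" "(b, b') \<in> U" by blast
      then obtain V where V: "V \<in> C" "(a, a') \<in> V" "(b, b') \<in> V"
        using C(2) unfolding subset_chain_def by blast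
      show "(a - b, a' - b') \<in> \<Union>C" "(a * b, a * b' + a' * b) \<in> \<Union>C"
        using graph_diff[OF g(1)[OF V(1)] V(2,3)] graph_mult[OF g(1)[OF V(1)] V(2,3)] V(1) by blast+
    qed
    moreover have "S \<subseteq> \<Union>C"
      using C(1) g(2) by blast
    ultimately show "\<Union>C \<in> \<F>"
      by (simp add: \<F>_def)
  qed
  then obtain M where M_in: "M \<in> \<F>" and M_max: "\<forall>T\<in>\<F>. M \<subseteq> T \<longrightarrow> T = M"
    by (rule bexE)
  have M: "derivation_graph M" "S \<subseteq> M"
    using M_in by (simp_all add: \<F>_def)
  have max: "T = M" if "derivation_graph T" "M \<subseteq> T" for T
    using M_max that M(2) by (auto simp: \<F>_def)
  have total: "\<exists>b. (a, b) \<in> M" for a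
  proof -
    obtain T b where T: "derivation_graph T" "M \<subseteq> T" "(a, b) \<in> T"
      using derivation_graph_extend_one[OF M(1), of a] by blast
    with max[OF T(1,2)] show ?thesis by blast
  qed
  define d where "d = (\<lambda>a. THE b. (a, b) \<in> M)"
  have d_eq: "d a = b" if "(a, b) \<in> M" for a b
    unfolding d_def using that graph_unique[OF M(1)] by blast
  have d: "(a, d a) \<in> M" for a
    using total d_eq by blast
  have "derivation d"
  proof
    show "d (a + b) = d a + d b" for a b
      by (intro d_eq graph_add[OF M(1)] d)
    show "d (a * b) = a * d b + d a * b" for a b
      by (intro d_eq graph_mult[OF M(1)] d)
  qed
  then show ?thesis
    using d_eq M(2) by blast
qed

unbundle fps_syntax

section \<open>Laurent series\<close>

text \<open>Unlike a bound on \<open>fls_subdegree\<close>, whose value at 0 is 0 by convention,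
  this holds of the zero series for every \<open>n\<close>, so sums and products need no case
  distinction.\<close>

definition fls_ge :: "int \<Rightarrow> 'a::zero fls \<Rightarrow> bool" where
  "fls_ge n f \<longleftrightarrow> (\<forall>k<n. f $$ k = 0)"

lemma fls_ge_subdegree: "fls_ge (fls_subdegree f) f"
  by (simp add: fls_ge_def)

lemma fls_ge_mono: "fls_ge n f \<Longrightarrow> m \<le> n \<Longrightarrow> fls_ge m f"
  by (simp add: fls_ge_def)

lemma fls_ge_iff: "f \<noteq> 0 \<Longrightarrow> fls_ge n f \<longleftrightarrow> n \<le> fls_subdegree f"
  by (metis fls_ge_def fls_ge_mono fls_ge_subdegree fls_subdegree_geI)

lemma fls_ge_0_iff: "fls_ge 0 f \<longleftrightarrow> 0 \<le> fls_subdegree f"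
  by (cases "f = 0") (simp add: fls_ge_def, rule fls_ge_iff)

lemma fls_ge_0 [simp]: "fls_ge n 0"
  by (simp add: fls_ge_def)

lemma fls_ge_add: "fls_ge n f \<Longrightarrow> fls_ge n g \<Longrightarrow> fls_ge n (f + g)" for f g :: "'a::monoid_add fls"
  by (simp add: fls_ge_def)

lemma fls_ge_sum: "(\<And>i. i \<in> I \<Longrightarrow> fls_ge n (f i)) \<Longrightarrow> fls_ge n (\<Sum>i\<in>I. f i)"
  for f :: "_ \<Rightarrow> 'a::comm_monoid_add fls"
  by (induction I rule: infinite_finite_induct) (auto intro: fls_ge_add)

lemma fls_ge_const [simp]: "fls_ge 0 (fls_const c)"
  by (simp add: fls_ge_def)

text \<open>The bounds may be weaker than the subdegrees. A series and its image under a
  coefficientwise map, whose subdegree may be larger, can thus be expanded over the same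
  range.\<close>

lemma fls_times_nth_ge:
  fixes f g :: "'a::semiring_0 fls"
  assumes "fls_ge L f" "fls_ge M g"
  shows "(f * g) $$ n = (\<Sum>i=L..n - M. f $$ i * g $$ (n - i))"
proof -
  let ?df = "fls_subdegree f" and ?dg = "fls_subdegree g"
  have "(f * g) $$ n = (\<Sum>i=?df..n - ?dg. f $$ i * g $$ (n - i))"
    by (rule fls_times_nth(2))
  also have "\<dots> = (\<Sum>i\<in>{?df..n - ?dg} \<inter> {L..n - M}. f $$ i * g $$ (n - i))"
    using assms by (intro sum.mono_neutral_right) (auto simp: fls_ge_def not_le)
  also have "\<dots> = (\<Sum>i=L..n - M. f $$ i * g $$ (n - i))"
    by (intro sum.mono_neutral_left) (auto simp: not_le)
  finally show ?thesis .
qed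

lemma fls_ge_mult:
  fixes f g :: "'a::semiring_0 fls"
  assumes "fls_ge L f" "fls_ge M g"
  shows "fls_ge (L + M) (f * g)"
  unfolding fls_ge_def
  by (subst fls_times_nth_ge[OF assms]) auto

lemma fls_times_nth_lowest:
  fixes f g :: "'a::semiring_0 fls"
  assumes "fls_ge L f" "fls_ge M g"
  shows "(f * g) $$ (L + M) = f $$ L * g $$ M"
  by (subst fls_times_nth_ge[OF assms]) simp

lemma fls_ge_power:
  fixes f :: "'a::semiring_1 fls"
  assumes "fls_ge 0 f"
  shows "fls_ge 0 (f ^ k)" and "(f ^ k) $$ 0 = (f $$ 0) ^ k"
proof (induction k)
  case (Suc k)
  {
    case 1 then show ?case using Suc fls_ge_mult[of 0 f 0 "f ^ k"] assms by simp
  next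
    case 2 then show ?case using Suc fls_times_nth_lowest[of 0 f 0 "f ^ k"] assms by simp
  }
qed (simp_all add: fls_ge_def)

lemma fls_subdegree_shifted_unit:
  fixes g :: "'a::semiring_1 fls"
  assumes "fls_ge 0 g" "c \<noteq> 0" "n > 0"
  shows "fls_subdegree (fls_const c + fls_X ^ n * g) = 0"
proof (rule fls_subdegree_eqI)
  have "fls_ge (int n + 0) (fls_X ^ n * g)"
    by (rule fls_ge_mult) (use assms in \<open>auto simp: fls_ge_def\<close>)
  then show "(fls_const c + fls_X ^ n * g) $$ 0 \<noteq> 0"
    and "\<And>k. k < 0 \<Longrightarrow> (fls_const c + fls_X ^ n * g) $$ k = 0"
    using assms by (simp_all add: fls_ge_def)
qed

text \<open>At the least of the subdegrees exactly one summand has a nonzero coefficient.\<close>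

lemma sum_distinct_subdegrees_nonzero:
  fixes f :: "'i \<Rightarrow> 'a::comm_monoid_add fls"
  assumes "finite I" "I \<noteq> {}" "\<And>i. i \<in> I \<Longrightarrow> f i \<noteq> 0" "inj_on (\<lambda>i. fls_subdegree (f i)) I"
  shows "(\<Sum>i\<in>I. f i) \<noteq> 0"
proof -
  define n where "n = Min ((\<lambda>i. fls_subdegree (f i)) ` I)"
  have "n \<in> (\<lambda>i. fls_subdegree (f i)) ` I"
    unfolding n_def using assms by (intro Min_in) auto
  then obtain j where j: "j \<in> I" "n = fls_subdegree (f j)" by blast
  have "f i $$ n = 0" if "i \<in> I - {j}" for i
  proof -
    have "n \<le> fls_subdegree (f i)"
      unfolding n_def using assms that by (intro Min_le) auto
    moreover have "fls_subdegree (f i) \<noteq> n"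
      using assms(4) j that by (auto dest: inj_onD)
    ultimately show ?thesis by simp
  qed
  then have "(\<Sum>i\<in>I. f i $$ n) = (\<Sum>i\<in>{j}. f i $$ n)"
    using assms(1) j by (intro sum.mono_neutral_right) auto
  then have "(\<Sum>i\<in>I. f i) $$ n \<noteq> 0"
    using j assms(3) by (simp add: fls_nth_sum)
  then show ?thesis by auto
qed

subsection \<open>Coefficientwise maps\<close>

definition fls_map :: "('a::zero \<Rightarrow> 'b::zero) \<Rightarrow> 'a fls \<Rightarrow> 'b fls" where
  "fls_map d f = Abs_fls (\<lambda>n. d (f $$ n))"

lemma fls_map_nth: "d 0 = 0 \<Longrightarrow> fls_map d f $$ n = d (f $$ n)"
  unfolding fls_map_def
  by (rule nth_Abs_fls_lower_bound[of "fls_subdegree f"]) simp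

lemma fls_map_const: "d 0 = 0 \<Longrightarrow> fls_map d (fls_const c) = fls_const (d c)"
  by (intro fls_eqI) (simp add: fls_map_nth)

lemma fls_map_ge: "d 0 = 0 \<Longrightarrow> fls_ge n f \<Longrightarrow> fls_ge n (fls_map d f)"
  by (simp add: fls_ge_def fls_map_nth)

lemma (in ring_morphism) fls_map_morphism: "ring_morphism (fls_map f)"
proof
  show "fls_map f 1 = 1"
    using fls_map_const[of f 1, OF hom_zero] by (simp add: hom_one)
  show "fls_map f (a + b) = fls_map f a + fls_map f b" for a b
    by (intro fls_eqI) (simp add: fls_map_nth hom_zero hom_add)
  show "fls_map f (a * b) = fls_map f a * fls_map f b" for a b
  proof (intro fls_eqI)
    fix n
    note ab = fls_ge_subdegree[of a] fls_ge_subdegree[of b]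
    show "fls_map f (a * b) $$ n = (fls_map f a * fls_map f b) $$ n"
      using fls_times_nth_ge[OF ab, of n]
        fls_times_nth_ge[OF fls_map_ge[of f, OF hom_zero ab(1)] fls_map_ge[of f, OF hom_zero ab(2)], of n]
      by (simp add: fls_map_nth hom_zero hom_sum hom_mult)
  qed
qed

text \<open>
  If \<open>c = d \<gamma>\<close>, this derivation extends \<open>d\<close> and annihilates \<open>\<gamma> + t\<close>, where \<open>t\<close> is the variable
  \<open>fls_X\<close>.
\<close>

definition fls_twist :: "('a \<Rightarrow> 'a) \<Rightarrow> 'a \<Rightarrow> 'a::field fls \<Rightarrow> 'a fls" where
  "fls_twist d c f = fls_map d f - fls_const c * fls_deriv f"

context derivation
begin

lemma d_sum: "d (\<Sum>i\<in>I. g i) = (\<Sum>i\<in>I. d (g i))"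
  by (induction I rule: infinite_finite_induct) (simp_all add: d_zero d_add)

lemma fls_map_derivation: "derivation (fls_map d)"
proof
  show "fls_map d (a + b) = fls_map d a + fls_map d b" for a b
    by (intro fls_eqI) (simp add: fls_map_nth d_zero d_add)
  show "fls_map d (a * b) = a * fls_map d b + fls_map d a * b" for a b
  proof (intro fls_eqI)
    fix n
    note ab = fls_ge_subdegree[of a] fls_ge_subdegree[of b]
    show "fls_map d (a * b) $$ n = (a * fls_map d b + fls_map d a * b) $$ n"
      using fls_times_nth_ge[OF ab, of n]
        fls_times_nth_ge[OF ab(1) fls_map_ge[of d, OF d_zero ab(2)], of n]
        fls_times_nth_ge[OF fls_map_ge[of d, OF d_zero ab(1)] ab(2), of n]
      by (simp add: fls_map_nth d_zero d_sum d_mult sum.distrib)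
  qed
qed

lemma fls_twist_derivation: "derivation (fls_twist d c)"
proof -
  interpret m: derivation "fls_map d" by (rule fls_map_derivation)
  show ?thesis
    by standard (simp_all add: fls_twist_def m.d_add m.d_mult algebra_simps)
qed

lemma fls_twist_const: "fls_twist d c (fls_const a) = fls_const (d a)"
  by (simp add: fls_twist_def fls_map_const d_zero)

lemma fls_twist_X_power: "fls_twist d 0 (fls_X ^ n) = 0"
  by (intro fls_eqI) (simp add: fls_twist_def fls_map_nth d_zero d_one)

lemma fls_twist_X_inv_power: "fls_twist d 0 (fls_X_inv ^ n) = 0"
  by (intro fls_eqI) (simp add: fls_twist_def fls_map_nth d_zero d_one)

lemma fls_twist_X: "fls_twist d c fls_X = - fls_const c"
  by (intro fls_eqI) (simp add: fls_twist_def fls_map_nth d_zero d_one)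

text \<open>For \<open>f\<close> of subdegree \<open>n\<close> the coefficientwise part stays in
  degrees at least \<open>n\<close>, while the derivative in the variable reaches
  \<open>n - 1\<close> with \<open>n\<close> times the leading coefficient. Division by
  \<open>f\<close> leaves the residue \<open>- c * n\<close>: moving the centre turns the order into
  a residue.\<close>

lemma fls_twist_log_derivative:
  fixes f :: "'a fls" and c :: 'a
  assumes "f \<noteq> 0"
  defines "z \<equiv> fls_twist d c f / f"
  shows "fls_ge (- 1) z" and "z $$ (- 1) = - c * of_int (fls_subdegree f)"
proof -
  define n where "n = fls_subdegree f"
  have D: "fls_ge (n - 1) (fls_twist d c f)"
    and Dn: "fls_twist d c f $$ (n - 1) = - c * of_int n * f $$ n"
    by (simp_all add: fls_ge_def fls_twist_def fls_map_nth d_zero n_def)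
  have inv: "fls_ge (- n) (inverse f)"
    using fls_ge_subdegree[of "inverse f"] assms(1) by (simp add: n_def)
  have f: "fls_ge n f" by (simp add: n_def fls_ge_subdegree)
  have "f $$ n * inverse f $$ (- n) = 1"
    using fls_times_nth_lowest[OF f inv] assms(1) by simp
  moreover have z: "z = fls_twist d c f * inverse f"
    by (simp add: z_def field_simps)
  ultimately show "z $$ (- 1) = - c * of_int (fls_subdegree f)"
    using fls_times_nth_lowest[OF D inv] Dn by (simp add: n_def mult.assoc)
  show "fls_ge (- 1) z"
    using fls_ge_mult[OF D inv] z by simp
qed

text \<open>With \<open>c = 0\<close> the residue vanishes whatever the order of \<open>f\<close>.
  This is the case of the ramified places.\<close>

lemma fls_twist_0_log_derivative:
  assumes "f \<noteq> 0"
  shows "fls_ge 0 (fls_twist d 0 f / f)"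
  unfolding fls_ge_def
proof (intro allI impI)
  fix k :: int assume "k < 0"
  then show "(fls_twist d 0 f / f) $$ k = 0"
    using fls_twist_log_derivative[OF assms, of 0] by (cases "k = - 1") (auto simp: fls_ge_def)
qed

end

subsection \<open>Roots\<close>

text \<open>Splitting off a power of the variable leaves a power series with nonzero constant term.
  In characteristic 0 it has an n-th root once its constant term has one.\<close>

lemma fls_root_exists:
  fixes z :: "'a::{alg_closed_field,field_char_0} fls"
  assumes "z \<noteq> 0" "n > 0" "fls_subdegree z = int n * k"
  shows "\<exists>w. w ^ n = z \<and> fls_subdegree w = k"
proof -
  define a where "a = fls_base_factor_to_fps z"
  have z: "z = fls_X_intpow (int n * k) * fps_to_fls a"
    using fls_conv_base_factor_to_fps_shift_subdegree[of z] assms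
    by (simp add: a_def fls_X_intpow_times_conv_shift)
  have a0: "fps_nth a 0 \<noteq> 0"
    unfolding a_def using assms(1) by (rule fls_base_factor_to_fps_base)
  obtain c where c: "c ^ n = fps_nth a 0"
    using nth_root_exists[OF assms(2)] by blast
  obtain l where l: "n = Suc l" using assms(2) gr0_conv_Suc by blast
  define r where "r = fps_radical (\<lambda>_ _. c) n a"
  have r: "r ^ n = a"
    unfolding r_def l using power_radical[OF a0, of "\<lambda>_ _. c" l] c l by simp
  define w where "w = fls_X_intpow k * fps_to_fls r"
  have "w ^ n = (fls_X powi k) ^ n * fps_to_fls (r ^ n)"
    by (simp add: w_def power_mult_distrib fps_to_fls_power)
  also have "(fls_X powi k) ^ n = (fls_X powi (int n * k) :: 'a fls)"
    by (simp only: power_int_mult mult.commute[of "int n"] power_int_of_nat)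
  finally have w: "w ^ n = z"
    using r z by simp
  have "int n * fls_subdegree w = int n * k"
    using assms w fls_subdegree_pow[of w n] by simp
  then show ?thesis
    using w assms(2) by auto
qed

text \<open>The cofactor of \<open>v - w\<close> in \<open>v ^ n - w ^ n\<close> has constant term
  \<open>n\<close> times the power \<open>n - 1\<close> of \<open>v $$ 0\<close>, which is nonzero
  in characteristic 0.\<close>

lemma fls_root_unique:
  fixes v w :: "'a::field_char_0 fls"
  assumes "v ^ n = w ^ n" "n > 0" "fls_ge 0 v" "fls_ge 0 w" "v $$ 0 = w $$ 0" "v $$ 0 \<noteq> 0"
  shows "v = w"
proof -
  let ?s = "\<Sum>i<n. w ^ (n - Suc i) * v ^ i"
  have "?s $$ 0 = (\<Sum>i<n. (v $$ 0) ^ (n - 1))"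
    unfolding fls_nth_sum
  proof (intro sum.cong refl)
    fix i assume i: "i \<in> {..<n}"
    have "(w ^ (n - Suc i) * v ^ i) $$ 0 = (v $$ 0) ^ (n - Suc i) * (v $$ 0) ^ i"
      using fls_times_nth_lowest[of 0 "w ^ (n - Suc i)" 0 "v ^ i"] assms by (simp add: fls_ge_power)
    then show "(w ^ (n - Suc i) * v ^ i) $$ 0 = (v $$ 0) ^ (n - 1)"
      using i by (simp flip: power_add)
  qed
  then have "?s $$ 0 \<noteq> 0" using assms by simp
  then have "?s \<noteq> 0" by auto
  moreover have "(v - w) * ?s = 0"
    using power_diff_sumr2[of v n w] assms(1) by simp
  ultimately show ?thesis by simp
qed

subsection \<open>Evaluation of polynomials at Laurent series\<close>

lemma fls_const_morphism: "ring_morphism (fls_const :: 'a::comm_ring_1 \<Rightarrow> _)"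
  by standard (simp_all add: fls_plus_const)

interpretation fls_const: ring_morphism "fls_const :: 'a::comm_ring_1 \<Rightarrow> _"
  by (rule fls_const_morphism)

lemma fls_ge_eval1: "fls_ge 0 z \<Longrightarrow> fls_ge 0 (eval1 fls_const z q)"
proof (induction q)
  case (pCons c q)
  then have "fls_ge (0 + 0) (z * eval1 fls_const z q)"
    by (intro fls_ge_mult)
  then show ?case
    unfolding fls_const.eval1_pCons by (intro fls_ge_add) simp_all
qed (simp add: fls_const.eval1_0)

lemma eval1_nth_0: "fls_ge 0 z \<Longrightarrow> eval1 fls_const z q $$ 0 = poly q (z $$ 0)"
proof (induction q)
  case (pCons c q)
  then show ?case
    using fls_times_nth_lowest[of 0 z 0 "eval1 fls_const z q"]
    by (simp add: fls_const.eval1_pCons fls_ge_eval1)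
qed (simp add: fls_const.eval1_0)

text \<open>A factor \<open>x - \<gamma>\<close> becomes \<open>fls_X ^ n\<close>, and the cofactor
  without a root at \<open>\<gamma>\<close> becomes a unit. The exponent \<open>n\<close> will be
  the ramification index over \<open>\<gamma>\<close>.\<close>

lemma eval1_shift_subdegree:
  fixes q :: "'a::field poly" and n :: nat and \<gamma> :: 'a
  assumes "q \<noteq> 0" "n > 0"
  defines "z \<equiv> fls_const \<gamma> + fls_X ^ n"
  shows "eval1 fls_const z q \<noteq> 0"
    and "fls_subdegree (eval1 fls_const z q) = int n * int (Polynomial.order \<gamma> q)"
proof -
  interpret e: ring_morphism "eval1 fls_const z" by (rule fls_const.eval1_morphism)
  obtain r where r: "q = [:- \<gamma>, 1:] ^ Polynomial.order \<gamma> q * r" "\<not> [:- \<gamma>, 1:] dvd r"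
    using order_decomp[OF assms(1)] by blast
  have lin: "eval1 fls_const z [:- \<gamma>, 1:] = fls_X ^ n"
    by (simp add: fls_const.eval1_pCons fls_const.eval1_0 z_def)
  have z0: "fls_ge 0 z"
    using assms(2) by (auto simp: z_def fls_ge_def)
  have "r = [:poly r \<gamma>:] + [:- \<gamma>, 1:] * synthetic_div r \<gamma>"
    using synthetic_div_correct'[of \<gamma> r] by (simp only: add.commute)
  then have er: "eval1 fls_const z r = fls_const (poly r \<gamma>) + fls_X ^ n * eval1 fls_const z (synthetic_div r \<gamma>)"
    by (metis e.hom_add e.hom_mult lin fls_const.eval1_const)
  have "poly r \<gamma> \<noteq> 0"
    using r(2) by (simp add: poly_eq_0_iff_dvd)
  have sr: "fls_subdegree (eval1 fls_const z r) = 0"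
    unfolding er by (intro fls_subdegree_shifted_unit fls_ge_eval1 z0 assms) fact
  have er0: "eval1 fls_const z r \<noteq> 0"
  proof
    assume "eval1 fls_const z r = 0"
    moreover have "fls_ge (int n + 0) (fls_X ^ n * eval1 fls_const z (synthetic_div r \<gamma>))"
      by (intro fls_ge_mult fls_ge_eval1 z0) (simp add: fls_ge_def)
    then have "eval1 fls_const z r $$ 0 = poly r \<gamma>"
      unfolding er using assms(2) by (simp add: fls_ge_def)
    ultimately show False using \<open>poly r \<gamma> \<noteq> 0\<close> by simp
  qed
  have eq: "eval1 fls_const z q = (fls_X ^ n) ^ Polynomial.order \<gamma> q * eval1 fls_const z r"
    by (subst r(1)) (simp add: e.hom_mult e.hom_power lin)
  show "eval1 fls_const z q \<noteq> 0"
    using er0 by (simp add: eq)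
  show "fls_subdegree (eval1 fls_const z q) = int n * int (Polynomial.order \<gamma> q)"
    using er0 sr by (simp add: eq fls_subdegree_pow)
qed

text \<open>In Horner's scheme the part divisible by the variable has a pole as soon as it is
  nonzero, so an added constant cannot cancel it.\<close>

lemma eval1_infinity_subdegree:
  fixes q :: "'a::field poly"
  assumes "q \<noteq> 0" "n > 0"
  shows "eval1 fls_const (fls_X_inv ^ n) q \<noteq> 0 \<and>
    fls_subdegree (eval1 fls_const (fls_X_inv ^ n) q) = - int n * int (degree q)"
  using assms(1)
proof (induction q)
  case (pCons c q)
  let ?z = "fls_X_inv ^ n :: 'a fls"
  show ?case
  proof (cases "q = 0")
    case True
    then show ?thesis
      using pCons.prems by (simp add: fls_const.eval1_pCons fls_const.eval1_0)
  next
    case False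
    then have IH: "eval1 fls_const ?z q \<noteq> 0"
      "fls_subdegree (eval1 fls_const ?z q) = - int n * int (degree q)"
      using pCons.IH by auto
    have s: "fls_subdegree (?z * eval1 fls_const ?z q) = - int n * int (Suc (degree q))"
      using IH by (simp add: fls_subdegree_pow algebra_simps)
    then have neg: "fls_subdegree (?z * eval1 fls_const ?z q) < 0"
      using assms(2) by simp
    have "fls_subdegree (fls_const c + ?z * eval1 fls_const ?z q) =
        fls_subdegree (?z * eval1 fls_const ?z q)"
      using neg IH(1) by (intro fls_subdegree_add_eq2) auto
    then show ?thesis
      using s neg False by (auto simp: fls_const.eval1_pCons)
  qed
qed simp

text \<open>Common roots are split off one at a time. This serves as the count of zeros and poles of
  a rational function on the affine line.\<close>

lemma degree_le_if_orders_le: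
  fixes q r :: "'a::alg_closed_field poly"
  assumes "q \<noteq> 0" "r \<noteq> 0" "\<And>\<gamma>. Polynomial.order \<gamma> q \<le> Polynomial.order \<gamma> r"
  shows "degree q \<le> degree r"
  using assms
proof (induction "degree q" arbitrary: q r)
  case (Suc n)
  obtain \<gamma> where \<gamma>: "poly q \<gamma> = 0"
    using alg_closed_imp_poly_has_root[of q] Suc.hyps(2) by auto
  then have "poly r \<gamma> = 0"
    using Suc.prems by (metis le_zero_eq order_root)
  with \<gamma> obtain q1 r1 where qr: "q = [:- \<gamma>, 1:] * q1" "r = [:- \<gamma>, 1:] * r1"
    by (auto simp: poly_eq_0_iff_dvd dvd_def)
  then have nz: "q1 \<noteq> 0" "r1 \<noteq> 0" using Suc.prems by auto
  have "degree q1 \<le> degree r1"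
  proof (rule Suc.hyps(1))
    show "n = degree q1"
      using Suc.hyps(2) nz unfolding qr(1) by (subst (asm) degree_mult_eq) auto
    show "Polynomial.order \<delta> q1 \<le> Polynomial.order \<delta> r1" for \<delta>
    proof -
      have "Polynomial.order \<delta> q \<le> Polynomial.order \<delta> r" by (rule Suc.prems(3))
      moreover have "q \<noteq> 0" "r \<noteq> 0" by (fact Suc.prems)+
      ultimately show ?thesis
        using order_mult[of "[:- \<gamma>, 1:]" q1 \<delta>] order_mult[of "[:- \<gamma>, 1:]" r1 \<delta>]
        unfolding qr by linarith
    qed
  qed (fact nz)+
  then show ?case
    using nz unfolding qr by (subst (1 2) degree_mult_eq) auto
qed simp

section \<open>The function field\<close>

lemma add_frac_commuted:
  fixes u v b c :: "'a::field"
  shows "b \<noteq> 0 \<Longrightarrow> c \<noteq> 0 \<Longrightarrow> u / b + v / c = (c * u + b * v) / (b * c)"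
  by (simp add: field_simps)

lemma to_ac_morphism: "ring_morphism to_ac"
  by standard simp_all

interpretation to_ac: ring_morphism to_ac
  by (rule to_ac_morphism)

lemma const_emb_morphism: "ring_morphism (const_emb :: 'k::field alg_closure \<Rightarrow> _)"
proof
  show "const_emb (1 :: 'k alg_closure) = 1"
    by (simp add: const_emb_def flip: one_pCons)
  show "const_emb (a + b) = const_emb a + const_emb b" for a b :: "'k alg_closure"
    by (simp add: const_emb_def flip: to_ac_add to_fract_add)
  show "const_emb (a * b) = const_emb a * const_emb b" for a b :: "'k alg_closure"
    by (simp add: const_emb_def flip: to_ac_mult to_fract_mult)
qed

interpretation const_emb: ring_morphism const_emb
  by (rule const_emb_morphism)

abbreviation eval_x :: "'k::field alg_closure poly \<Rightarrow> 'k ambient" where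
  "eval_x \<equiv> eval1 const_emb coord_x"

abbreviation eval_xy :: "'k::field ambient \<Rightarrow> 'k alg_closure poly poly \<Rightarrow> 'k ambient" where
  "eval_xy \<equiv> eval2 const_emb coord_x"

lemma eval_x_eq: "eval_x q = to_ac (to_fract q)"
proof (induction q)
  case (pCons c q)
  have "pCons c q = [:c:] + [:0, 1:] * q" by simp
  then have "to_fract (pCons c q) = to_fract [:c:] + to_fract [:0, 1:] * to_fract q"
    by (metis to_fract_add to_fract_mult)
  then show ?case
    unfolding const_emb.eval1_pCons pCons.IH by (simp add: const_emb_def coord_x_def)
qed (simp add: const_emb.eval1_0)

lemma eval_x_eq_0_iff: "eval_x q = 0 \<longleftrightarrow> q = 0"
  by (simp add: eval_x_eq)

lemma function_field_eq: "function_field y = range (eval1 to_ac y)"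
  by (simp add: function_field_def eval1_def)

interpretation eval_x: ring_morphism eval_x
  by (rule const_emb.eval1_morphism)

interpretation eval_xy: ring_morphism "eval_xy y"
  by (rule const_emb.eval2_morphism)

context
  fixes y :: "'k::field ambient"
begin

interpretation e: ring_morphism "eval1 to_ac y"
  by (rule to_ac.eval1_morphism)

lemma ff_to_ac: "to_ac c \<in> function_field y"
  unfolding function_field_eq using to_ac.eval1_const[of y c] by (metis rangeI)

lemma ff_eval_x: "eval_x q \<in> function_field y"
  by (simp add: eval_x_eq ff_to_ac)

lemma ff_const: "const_emb c \<in> function_field y"
  by (simp add: const_emb_def ff_to_ac)

lemma ff_x: "coord_x \<in> function_field y"
  by (simp add: coord_x_def ff_to_ac)

lemma ff_y: "y \<in> function_field y"
  unfolding function_field_eq using to_ac.eval1_X[of y] by (metis rangeI)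

lemma ff_0: "0 \<in> function_field y"
  using ff_to_ac[of 0] by simp

lemma ff_1: "1 \<in> function_field y"
  using ff_to_ac[of 1] by simp

lemma ff_add: "g \<in> function_field y \<Longrightarrow> h \<in> function_field y \<Longrightarrow> g + h \<in> function_field y"
  unfolding function_field_eq by (auto simp flip: e.hom_add)

lemma ff_mult: "g \<in> function_field y \<Longrightarrow> h \<in> function_field y \<Longrightarrow> g * h \<in> function_field y"
  unfolding function_field_eq by (auto simp flip: e.hom_mult)

lemma ff_minus: "g \<in> function_field y \<Longrightarrow> - g \<in> function_field y"
  unfolding function_field_eq by (auto simp flip: e.hom_minus)

lemma ff_diff: "g \<in> function_field y \<Longrightarrow> h \<in> function_field y \<Longrightarrow> g - h \<in> function_field y"
  unfolding function_field_eq by (auto simp flip: e.hom_diff)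

lemma ff_eval1: "h \<in> function_field y \<Longrightarrow> eval1 to_ac h q \<in> function_field y"
  by (induction q) (simp_all add: to_ac.eval1_0 to_ac.eval1_pCons ff_0 ff_add ff_mult ff_to_ac)

text \<open>The ambient field is algebraic over K(x). A nonzero relation for \<open>h\<close>,
  stripped of factors \<open>h\<close> until its constant term is nonzero, can be solved for the
  inverse.\<close>

lemma ff_inverse:
  assumes h: "h \<in> function_field y"
  shows "inverse h \<in> function_field y"
proof (cases "h = 0")
  case False
  obtain q where "q \<noteq> 0" "poly (map_poly to_ac q) h = 0"
    by (rule alg_closure_algebraic)
  then have "q \<noteq> 0" "eval1 to_ac h q = 0" by (simp_all add: eval1_def)
  then show ?thesis
  proof (induction q)
    case (pCons c q)
    have eq: "to_ac c + h * eval1 to_ac h q = 0"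
      using pCons.prems by (simp add: to_ac.eval1_pCons)
    show ?case
    proof (cases "c = 0")
      case True
      then show ?thesis using pCons False eq by auto
    next
      case c: False
      have "h * eval1 to_ac h q = - to_ac c"
        using eq by (simp add: eq_neg_iff_add_eq_0 add.commute)
      then have "- to_ac (inverse c) * (h * eval1 to_ac h q) = 1"
        using c by simp
      then have "h * (- to_ac (inverse c) * eval1 to_ac h q) = 1"
        by (simp only: mult.left_commute)
      then have "inverse h = - to_ac (inverse c) * eval1 to_ac h q"
        by (rule inverse_unique)
      then show ?thesis
        by (metis ff_mult ff_minus ff_to_ac ff_eval1[OF h])
    qed
  qed simp
qed (simp add: ff_0)

lemma ff_divide: "g \<in> function_field y \<Longrightarrow> h \<in> function_field y \<Longrightarrow> g / h \<in> function_field y"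
  by (simp add: divide_inverse ff_mult ff_inverse)

lemma ff_power: "g \<in> function_field y \<Longrightarrow> g ^ n \<in> function_field y"
  by (induction n) (simp_all add: ff_1 ff_mult)

lemma ff_powi: "g \<in> function_field y \<Longrightarrow> g powi n \<in> function_field y"
  by (simp add: power_int_def ff_power ff_inverse)

text \<open>Denominators are cleared because the maps into Laurent series are defined and compared
  on fractions of polynomials.\<close>

lemma ff_repr:
  assumes "h \<in> function_field y"
  shows "\<exists>A b. b \<noteq> 0 \<and> h = eval_xy y A / eval_x b"
proof -
  have "\<exists>A b. b \<noteq> 0 \<and> eval1 to_ac y q = eval_xy y A / eval_x b" for q
  proof (induction q)
    case 0
    show ?case
      by (rule exI[of _ 0], rule exI[of _ 1]) (simp add: to_ac.eval1_0 eval_xy.hom_zero)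
  next
    case (pCons c q)
    then obtain A b where A: "b \<noteq> 0" "eval1 to_ac y q = eval_xy y A / eval_x b" by blast
    obtain u v where c: "c = Fract u v" "v \<noteq> 0" by (cases c)
    have "to_ac c = eval_x u / eval_x v"
      using c by (simp add: Fract_conv_to_fract eval_x_eq)
    moreover have "eval_x b \<noteq> 0" "eval_x v \<noteq> 0"
      using A c by (simp_all add: eval_x_eq_0_iff)
    ultimately have "eval1 to_ac y (pCons c q) =
        (eval_x b * eval_x u + eval_x v * (y * eval_xy y A)) / (eval_x v * eval_x b)"
      unfolding to_ac.eval1_pCons A(2) times_divide_eq_right
      by (simp only: add_frac_commuted not_False_eq_True)
    also have "\<dots> = eval_xy y ([:b * u:] + smult v ([:0, 1:] * A)) / eval_x (v * b)"
      by (simp only: eval_xy.hom_add eval_xy.hom_mult const_emb.eval2_const const_emb.eval2_Y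
          const_emb.eval2_smult eval_x.hom_mult)
    finally show ?case
      using A c by (metis no_zero_divisors)
  qed
  then show ?thesis
    using assms unfolding function_field_eq by auto
qed

lemma ff_eval_xy: "eval_xy y A \<in> function_field y"
proof -
  have "eval_xy y A = eval1 eval_x y A" by (simp add: eval2_def)
  also have "\<dots> \<in> function_field y"
    by (induction A)
      (simp_all add: eval_x.eval1_0 eval_x.eval1_pCons ff_0 ff_add ff_mult ff_eval_x ff_y)
  finally show ?thesis .
qed

text \<open>Lets identities between homomorphisms or derivations be checked on constants and the two
  coordinate functions.\<close>

lemma ff_induct [consumes 1, case_names const x y add mult inverse]:
  assumes "h \<in> function_field y"
    and const: "\<And>c. P (const_emb c)" and x: "P coord_x" and y: "P y"
    and add: "\<And>g h. g \<in> function_field y \<Longrightarrow> h \<in> function_field y \<Longrightarrow> P g \<Longrightarrow> P h \<Longrightarrow> P (g + h)"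
    and mult: "\<And>g h. g \<in> function_field y \<Longrightarrow> h \<in> function_field y \<Longrightarrow> P g \<Longrightarrow> P h \<Longrightarrow> P (g * h)"
    and inverse: "\<And>g. g \<in> function_field y \<Longrightarrow> g \<noteq> 0 \<Longrightarrow> P g \<Longrightarrow> P (inverse g)"
  shows "P h"
proof -
  have P0: "P 0" using const[of 0] by (simp add: const_emb.hom_zero)
  have ex: "P (eval_x q)" for q
    by (induction q)
      (auto simp: const_emb.eval1_0 const_emb.eval1_pCons P0 x ff_x ff_eval_x ff_const const
        ff_mult intro!: add mult)
  have exy: "P (eval_xy y A)" for A
  proof -
    have "P (eval1 eval_x y A)"
    proof (induction A)
      case (pCons q A)
      have "eval1 eval_x y A \<in> function_field y"
        using ff_eval_xy[of A] by (simp add: eval2_def)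
      then show ?case
        using pCons by (auto simp: eval_x.eval1_pCons ff_y ff_eval_x ff_mult y ex intro!: add mult)
    qed (simp add: eval_x.eval1_0 P0)
    then show ?thesis by (simp add: eval2_def)
  qed
  obtain A b where Ab: "b \<noteq> 0" "h = eval_xy y A / eval_x b"
    using ff_repr[OF assms(1)] by blast
  have "P (eval_xy y A * inverse (eval_x b))"
    using Ab(1) by (intro mult inverse ff_inverse ff_eval_xy ff_eval_x ex exy)
      (simp add: eval_x_eq_0_iff)
  then show ?thesis using Ab by (simp add: divide_inverse)
qed

end

text \<open>\<open>e\<close> will be the inverse of the twisting factor. The orders
  \<open>m\<close>, 1 and \<open>- (m + 1)\<close> of \<open>F0\<close> at 0, \<open>- a\<close> and
  infinity are prime to \<open>p\<close>, so the x-coordinate is totally ramified exactly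
  there.\<close>

locale superelliptic =
  fixes y :: "'k::field_char_0 ambient" and p m :: nat and e a :: "'k alg_closure"
    and F0 :: "'k alg_closure poly"
  defines "F0 \<equiv> smult e (monom 1 m * [:a, 1:])"
  assumes p: "prime p" and m: "0 < m" "m + 1 < p"
    and e: "e \<noteq> 0" and a: "a \<noteq> 0"
    and y_eq: "y ^ p = eval_x F0"
begin

abbreviation "FF \<equiv> function_field y"

lemma p_gt_0: "p > 0" using m by simp

lemma monom_eq_power: "monom 1 m = ([:- 0, 1:] :: 'k alg_closure poly) ^ m"
  by (metis minus_zero monom_altdef smult_1_left)

lemma factors_nonzero: "monom 1 m * [:a, 1:] \<noteq> 0"
  unfolding mult_eq_0_iff by simp

lemma F0_nonzero: "F0 \<noteq> 0"
  unfolding F0_def smult_eq_0_iff using e factors_nonzero by blast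

lemma degree_F0: "degree F0 = m + 1"
proof -
  have "degree (monom 1 m * [:a, 1:]) = degree (monom (1 :: 'k alg_closure) m) + degree [:a, 1:]"
    by (rule degree_mult_eq) simp_all
  then show ?thesis
    using e by (simp only: F0_def degree_smult_eq degree_monom_eq[OF one_neq_zero]) simp
qed

lemma poly_F0: "poly F0 \<gamma> = e * \<gamma> ^ m * (\<gamma> + a)"
  by (simp add: F0_def poly_monom algebra_simps)

lemma order_F0: "Polynomial.order \<gamma> F0 = Polynomial.order \<gamma> ([:- 0, 1:] ^ m) + Polynomial.order \<gamma> [:- (- a), 1:]"
proof -
  have "Polynomial.order \<gamma> F0 = Polynomial.order \<gamma> (monom 1 m * [:a, 1:])"
    unfolding F0_def using e by (rule order_smult)
  then show ?thesis
    using order_mult[OF factors_nonzero] by (simp only: monom_eq_power minus_minus)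
qed

lemma order_0_F0: "Polynomial.order 0 F0 = m"
  unfolding order_F0 using a order_power_n_n[of 0 m] by (simp add: order_0I)

lemma order_minus_a_F0: "Polynomial.order (- a) F0 = 1"
  unfolding order_F0 using a order_power_n_n[of "- a" 1] by (simp add: order_0I)

lemma y_nonzero: "y \<noteq> 0"
  using y_eq F0_nonzero p_gt_0 by (auto simp: eval_x_eq_0_iff power_0_left)

text \<open>An embedding of the function field into the Laurent series field, given by the images of the
  coordinate functions.\<close>

definition place :: "'k alg_closure fls \<Rightarrow> 'k alg_closure fls \<Rightarrow> bool" where
  "place xh yh \<longleftrightarrow> (\<forall>q. eval1 fls_const xh q = 0 \<longrightarrow> q = 0) \<and> yh ^ p = eval1 fls_const xh F0"

lemma place_shiftI:
  "n > 0 \<Longrightarrow> yh ^ p = eval1 fls_const (fls_const \<gamma> + fls_X ^ n) F0 \<Longrightarrow>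
    place (fls_const \<gamma> + fls_X ^ n) yh"
  unfolding place_def using eval1_shift_subdegree(1) by blast

text \<open>Writing \<open>x\<close> as a p-th power makes the order of \<open>F0\<close> divisible
  by \<open>p\<close>, so a root exists; its order \<open>- (m + 1)\<close> is prime to
  \<open>p\<close>, the sign of total ramification. The same substitution works at 0 and
  \<open>- a\<close>.\<close>

lemma place_infinity:
  obtains yh where "place (fls_X_inv ^ p) yh" "fls_subdegree yh = - int (m + 1)"
proof -
  have "\<exists>w. w ^ p = eval1 fls_const (fls_X_inv ^ p) F0 \<and> fls_subdegree w = - int (m + 1)"
    using eval1_infinity_subdegree[OF F0_nonzero p_gt_0] p_gt_0
    by (intro fls_root_exists) (auto simp: degree_F0 algebra_simps)
  then obtain w where "w ^ p = eval1 fls_const (fls_X_inv ^ p) F0" "fls_subdegree w = - int (m + 1)"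
    by blast
  moreover have "\<forall>q :: 'k alg_closure poly. eval1 fls_const (fls_X_inv ^ p) q = 0 \<longrightarrow> q = 0"
    using eval1_infinity_subdegree p_gt_0 by blast
  ultimately show ?thesis using that by (simp add: place_def)
qed

lemma place_0:
  obtains yh where "place (fls_const 0 + fls_X ^ p) yh" "fls_subdegree yh = int m"
proof -
  have "\<exists>w. w ^ p = eval1 fls_const (fls_const 0 + fls_X ^ p) F0 \<and> fls_subdegree w = int m"
    using eval1_shift_subdegree[OF F0_nonzero p_gt_0, of 0] p_gt_0
    by (intro fls_root_exists) (auto simp: order_0_F0)
  then show ?thesis using that place_shiftI[OF p_gt_0] by blast
qed

lemma place_minus_a:
  obtains yh where "place (fls_const (- a) + fls_X ^ p) yh" "fls_subdegree yh = 1"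
proof -
  have "\<exists>w. w ^ p = eval1 fls_const (fls_const (- a) + fls_X ^ p) F0 \<and> fls_subdegree w = 1"
    using eval1_shift_subdegree[OF F0_nonzero p_gt_0, of "- a"] p_gt_0
    by (intro fls_root_exists) (auto simp: order_minus_a_F0)
  then show ?thesis using that place_shiftI[OF p_gt_0] by blast
qed

text \<open>The i-th summand has order congruent to \<open>- (m + 1) * i\<close> modulo
  \<open>p\<close>. As \<open>m + 1\<close> is prime to \<open>p\<close>, these orders are distinct
  for \<open>i < p\<close> and nothing cancels.\<close>

lemma infinity_nonvanishing:
  assumes yh: "place (fls_X_inv ^ p) yh" "fls_subdegree yh = - int (m + 1)"
    and A: "A \<noteq> 0" "degree A < p"
  shows "eval2 fls_const (fls_X_inv ^ p) yh A \<noteq> 0"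
proof -
  let ?ev = "eval1 fls_const (fls_X_inv ^ p)"
  define g where "g = (\<lambda>i. ?ev (coeff A i) * yh ^ i)"
  define I where "I = {i. i < p \<and> coeff A i \<noteq> 0}"
  have yh0: "yh \<noteq> 0" using yh(2) by auto
  have g: "g i \<noteq> 0" "fls_subdegree (g i) = - int p * int (degree (coeff A i)) - int (m + 1) * int i"
    if "i \<in> I" for i
    using that eval1_infinity_subdegree[of "coeff A i" p] p_gt_0 yh0
    by (simp_all add: g_def I_def fls_subdegree_pow yh(2) right_diff_distrib distrib_right)
  have "eval2 fls_const (fls_X_inv ^ p) yh A = (\<Sum>i<p. g i)"
    unfolding g_def using A by (intro fls_const.eval2_sum)
  also have "\<dots> = (\<Sum>i\<in>I. g i)"
    by (rule sum.mono_neutral_right) (auto simp: I_def g_def fls_const.eval1_0)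
  also have "\<dots> \<noteq> 0"
  proof (rule sum_distinct_subdegrees_nonzero)
    show "I \<noteq> {}" using A by (auto simp: I_def)
    show "inj_on (\<lambda>i. fls_subdegree (g i)) I"
    proof (rule inj_onI)
      fix i j assume ij: "i \<in> I" "j \<in> I" "fls_subdegree (g i) = fls_subdegree (g j)"
      then have "int (m + 1) * (int i - int j) = int p * (int (degree (coeff A j)) - int (degree (coeff A i)))"
        using g by (simp add: algebra_simps)
      then have "int p dvd int (m + 1) * (int i - int j)" by simp
      moreover have "\<not> int p dvd int (m + 1)"
        using m by (metis Suc_eq_plus1 int_dvd_int_iff nat_dvd_not_less zero_less_Suc)
      ultimately have "int p dvd int i - int j"
        using p prime_dvd_mult_iff[of "int p"] by auto
      moreover have "\<bar>int i - int j\<bar> < int p"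
        using ij by (auto simp: I_def)
      ultimately have "int i - int j = 0"
        using dvd_imp_le_int[of "int i - int j" "int p"] by linarith
      then show "i = j" by simp
    qed
  qed (use g in \<open>auto simp: I_def\<close>)
  finally show ?thesis .
qed

section \<open>Irreducibility of the equation of the curve over K(x)\<close>

definition curve_poly :: "'k alg_closure poly poly" where
  "curve_poly = monom 1 p - [:F0:]"

lemma degree_curve_poly: "degree curve_poly = p"
  unfolding curve_poly_def diff_conv_add_uminus using p_gt_0
  by (subst degree_add_eq_left) (simp_all add: degree_monom_eq)

lemma lead_coeff_curve_poly: "lead_coeff curve_poly = 1"
  using p_gt_0 unfolding degree_curve_poly by (simp add: curve_poly_def coeff_pCons split: nat.split)

lemma curve_poly_nonzero: "curve_poly \<noteq> 0"
  using degree_curve_poly p_gt_0 by force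

lemma eval2_curve_poly:
  assumes "ring_morphism f"
  shows "eval2 f x' y' curve_poly = y' ^ p - eval1 f x' F0"
proof -
  interpret f: ring_morphism f by fact
  interpret f2: ring_morphism "eval2 f x' y'" by (rule f.eval2_morphism)
  have "monom (1 :: 'k alg_closure poly) p = [:0, 1:] ^ p"
    by (simp add: monom_altdef)
  then show ?thesis
    unfolding curve_poly_def
    by (simp only: f2.hom_diff f2.hom_power f.eval2_const f.eval2_Y)
qed

lemma eval_xy_curve_poly: "eval_xy y curve_poly = 0"
  by (simp add: eval2_curve_poly const_emb_morphism y_eq)

lemma place_curve_poly: "place xh yh \<Longrightarrow> eval2 fls_const xh yh curve_poly = 0"
  by (simp add: eval2_curve_poly fls_const_morphism place_def)

text \<open>\<open>curve_poly\<close> is irreducible: both factors of a proper factorization would have \<open>y\<close>-degree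
  less than \<open>p\<close>, and such polynomials do not vanish at the totally ramified place at infinity.\<close>

lemma eval_xy_nonvanishing:
  assumes "A \<noteq> 0" "degree A < p"
  shows "eval_xy y A \<noteq> 0"
proof
  assume "eval_xy y A = 0"
  \<comment> \<open>\<open>B\<close> takes the place of the minimal polynomial of \<open>y\<close>
    over K(x), with denominators cleared.\<close>
  define P where "P = (\<lambda>B. B \<noteq> 0 \<and> eval_xy y B = 0)"
  define B where "B = arg_min degree P"
  have "P A" using assms \<open>eval_xy y A = 0\<close> by (simp add: P_def)
  from arg_min_nat_lemma[of P, OF this, of degree]
  have B: "B \<noteq> 0" "eval_xy y B = 0" and min: "P C \<Longrightarrow> degree B \<le> degree C" for C
    unfolding B_def[symmetric] by (simp_all add: P_def)
  have degB: "degree B < p"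
    using min[OF \<open>P A\<close>] assms by simp
  have degB0: "degree B > 0"
  proof (rule ccontr)
    assume "\<not> degree B > 0"
    then obtain q where "B = [:q:]" by (metis degree_eq_zeroE gr0I)
    with B show False by (simp add: const_emb.eval2_const eval_x_eq_0_iff)
  qed
  \<comment> \<open>Pseudo-division, because the coefficients are polynomials in \<open>x\<close>;
    \<open>c\<close> collects the powers of the leading coefficient. Minimality of \<open>B\<close>
    then kills the remainder.\<close>
  obtain Q R where QR: "pseudo_divmod curve_poly B = (Q, R)" by fastforce
  define c where "c = lead_coeff B ^ (Suc (degree curve_poly) - degree B)"
  have c: "c \<noteq> 0" using B by (simp add: c_def)
  have eq: "smult c curve_poly = B * Q + R" and R: "R = 0 \<or> degree R < degree B"
    using pseudo_divmod[OF B(1) QR] by (simp_all add: c_def)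
  have "eval_xy y (B * Q + R) = 0"
    by (simp add: eq[symmetric] const_emb.eval2_smult eval_xy_curve_poly)
  then have "eval_xy y R = 0"
    by (simp add: eval_xy.hom_add eval_xy.hom_mult B)
  then have "R = 0"
    using R min[of R] unfolding P_def by linarith
  then have eq: "smult c curve_poly = B * Q" using eq by simp
  have Q: "Q \<noteq> 0" using eq c curve_poly_nonzero by auto
  have "degree B + degree Q = p"
    using eq c Q B by (metis degree_curve_poly degree_mult_eq degree_smult_eq)
  then have degQ: "degree Q < p" using degB0 by simp
  obtain yh where yh: "place (fls_X_inv ^ p) yh" "fls_subdegree yh = - int (m + 1)"
    by (rule place_infinity)
  interpret h: ring_morphism "eval2 fls_const (fls_X_inv ^ p) yh"
    by (rule fls_const.eval2_morphism)
  have "eval2 fls_const (fls_X_inv ^ p) yh (B * Q) = 0"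
    by (simp add: eq[symmetric] fls_const.eval2_smult place_curve_poly[OF yh(1)])
  then show False
    using infinity_nonvanishing[OF yh B(1) degB] infinity_nonvanishing[OF yh Q degQ]
    by (simp add: h.hom_mult)
qed

lemma reduce_mod_curve_poly:
  obtains B Q where "A = curve_poly * Q + B" "degree B < p"
proof -
  obtain Q R where QR: "pseudo_divmod A curve_poly = (Q, R)" by fastforce
  have "A = curve_poly * Q + R" "R = 0 \<or> degree R < p"
    using pseudo_divmod[OF curve_poly_nonzero QR]
    unfolding lead_coeff_curve_poly by (simp_all add: degree_curve_poly)
  then have "A = curve_poly * Q + R" "degree R < p" using p_gt_0 by auto
  then show ?thesis by (rule that)
qed

text \<open>The remainder of \<open>A\<close> modulo the equation has degree below \<open>p\<close>
  and still vanishes on the curve, so it is 0 and \<open>A\<close> is a multiple of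
  \<open>curve_poly\<close>. This makes the substitution of series well defined on the function
  field.\<close>

lemma place_vanishing:
  assumes "place xh yh" "eval_xy y A = 0"
  shows "eval2 fls_const xh yh A = 0"
proof -
  interpret h: ring_morphism "eval2 fls_const xh yh"
    by (rule fls_const.eval2_morphism)
  obtain B Q where BQ: "A = curve_poly * Q + B" "degree B < p"
    by (rule reduce_mod_curve_poly)
  have "eval_xy y B = 0"
    using assms(2) by (simp add: BQ eval_xy.hom_add eval_xy.hom_mult eval_xy_curve_poly)
  then have "B = 0" using eval_xy_nonvanishing BQ(2) by blast
  then show ?thesis
    by (simp add: BQ h.hom_mult place_curve_poly[OF assms(1)])
qed

text \<open>Substitution into some fraction representing \<open>h\<close>. For a place and
  \<open>h\<close> in the function field all fractions give the same value, as \<open>emb_eq\<close>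
  shows.\<close>

definition emb :: "'k alg_closure fls \<Rightarrow> 'k alg_closure fls \<Rightarrow> 'k ambient \<Rightarrow> 'k alg_closure fls" where
  "emb xh yh h = (SOME z. \<exists>A b. b \<noteq> 0 \<and> h = eval_xy y A / eval_x b \<and>
     z = eval2 fls_const xh yh A / eval1 fls_const xh b)"

context
  fixes xh yh
  assumes pl: "place xh yh"
begin

interpretation h1: ring_morphism "eval1 fls_const xh"
  by (rule fls_const.eval1_morphism)

interpretation h2: ring_morphism "eval2 fls_const xh yh"
  by (rule fls_const.eval2_morphism)

lemma place_eval1_nonzero: "b \<noteq> 0 \<Longrightarrow> eval1 fls_const xh b \<noteq> 0"
  using pl by (auto simp: place_def)

lemma emb_eq:
  assumes "b \<noteq> 0"
  shows "emb xh yh (eval_xy y A / eval_x b) = eval2 fls_const xh yh A / eval1 fls_const xh b"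
  unfolding emb_def
proof (rule some_equality)
  fix z
  assume "\<exists>A' b'. b' \<noteq> 0 \<and> eval_xy y A / eval_x b = eval_xy y A' / eval_x b' \<and>
    z = eval2 fls_const xh yh A' / eval1 fls_const xh b'"
  then obtain A' b' where *: "b' \<noteq> 0" "eval_xy y A / eval_x b = eval_xy y A' / eval_x b'"
    "z = eval2 fls_const xh yh A' / eval1 fls_const xh b'" by blast
  have "eval_x b \<noteq> 0" "eval_x b' \<noteq> 0" using assms * by (simp_all add: eval_x_eq_0_iff)
  then have "eval_xy y (smult b' A - smult b A') = 0"
    using *(2) by (simp add: eval_xy.hom_diff const_emb.eval2_smult field_simps)
  then have "eval2 fls_const xh yh (smult b' A - smult b A') = 0"
    by (rule place_vanishing[OF pl])
  then have "eval1 fls_const xh b' * eval2 fls_const xh yh A =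
      eval1 fls_const xh b * eval2 fls_const xh yh A'"
    by (simp add: h2.hom_diff fls_const.eval2_smult)
  then show "z = eval2 fls_const xh yh A / eval1 fls_const xh b"
    unfolding *(3) using place_eval1_nonzero[OF assms] place_eval1_nonzero[OF *(1)]
    by (subst frac_eq_eq) (simp_all only: mult.commute not_False_eq_True)
qed (use assms in blast)

lemma emb_eval_x: "emb xh yh (eval_x q) = eval1 fls_const xh q"
  using emb_eq[of 1 "[:q:]"]
  by (simp add: eval_x.hom_one h1.hom_one const_emb.eval2_const fls_const.eval2_const)

lemma emb_const: "emb xh yh (const_emb c) = fls_const c"
  using emb_eval_x[of "[:c:]"] by (simp add: const_emb.eval1_const fls_const.eval1_const)

lemma emb_x: "emb xh yh coord_x = xh"
  using emb_eval_x[of "[:0, 1:]"] by (simp add: const_emb.eval1_X fls_const.eval1_X)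

lemma emb_y: "emb xh yh y = yh"
  using emb_eq[of 1 "[:0, 1:]"]
  by (simp add: eval_x.hom_one h1.hom_one const_emb.eval2_Y fls_const.eval2_Y)

lemma emb_0: "emb xh yh 0 = 0"
  using emb_const[of 0] by (simp add: const_emb.hom_zero)

lemma emb_1: "emb xh yh 1 = 1"
  using emb_const[of 1] by (simp add: const_emb.hom_one)

lemma emb_add:
  assumes "g \<in> FF" "h \<in> FF"
  shows "emb xh yh (g + h) = emb xh yh g + emb xh yh h"
proof -
  obtain A b where A: "b \<noteq> 0" "g = eval_xy y A / eval_x b" using ff_repr[OF assms(1)] by blast
  obtain B c where B: "c \<noteq> 0" "h = eval_xy y B / eval_x c" using ff_repr[OF assms(2)] by blast
  have nz: "eval_x b \<noteq> 0" "eval_x c \<noteq> 0" "eval1 fls_const xh b \<noteq> 0" "eval1 fls_const xh c \<noteq> 0"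
    using A B place_eval1_nonzero by (simp_all add: eval_x_eq_0_iff)
  have "g + h = eval_xy y (smult c A + smult b B) / eval_x (b * c)"
    unfolding A(2) B(2) eval_xy.hom_add const_emb.eval2_smult eval_x.hom_mult
    using nz by (intro add_frac_commuted)
  then have "emb xh yh (g + h) = eval2 fls_const xh yh (smult c A + smult b B) / eval1 fls_const xh (b * c)"
    using A B by (simp only: emb_eq no_zero_divisors not_False_eq_True)
  also have "\<dots> = eval2 fls_const xh yh A / eval1 fls_const xh b + eval2 fls_const xh yh B / eval1 fls_const xh c"
    unfolding h2.hom_add fls_const.eval2_smult h1.hom_mult
    using nz by (intro add_frac_commuted[symmetric])
  also have "\<dots> = emb xh yh g + emb xh yh h"
    unfolding A(2) B(2) emb_eq[OF A(1)] emb_eq[OF B(1)] ..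
  finally show ?thesis .
qed

lemma emb_mult:
  assumes "g \<in> FF" "h \<in> FF"
  shows "emb xh yh (g * h) = emb xh yh g * emb xh yh h"
proof -
  obtain A b where A: "b \<noteq> 0" "g = eval_xy y A / eval_x b" using ff_repr[OF assms(1)] by blast
  obtain B c where B: "c \<noteq> 0" "h = eval_xy y B / eval_x c" using ff_repr[OF assms(2)] by blast
  have "g * h = eval_xy y (A * B) / eval_x (b * c)"
    unfolding A(2) B(2) by (simp add: eval_xy.hom_mult eval_x.hom_mult)
  then have "emb xh yh (g * h) = eval2 fls_const xh yh (A * B) / eval1 fls_const xh (b * c)"
    using A B by (simp only: emb_eq no_zero_divisors not_False_eq_True)
  also have "\<dots> = emb xh yh g * emb xh yh h"
    unfolding A(2) B(2) emb_eq[OF A(1)] emb_eq[OF B(1)] by (simp add: h2.hom_mult h1.hom_mult)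
  finally show ?thesis .
qed

lemma emb_eq_0_iff: "g \<in> FF \<Longrightarrow> emb xh yh g = 0 \<longleftrightarrow> g = 0"
  using emb_mult[OF _ ff_inverse, of g g] by (cases "g = 0") (auto simp: emb_0 emb_1)

lemma emb_inverse:
  assumes g: "g \<in> FF"
  shows "emb xh yh (inverse g) = inverse (emb xh yh g)"
proof (cases "g = 0")
  case False
  then have "emb xh yh g * emb xh yh (inverse g) = 1"
    using emb_mult[OF g ff_inverse[OF g]] by (simp add: emb_1)
  then show ?thesis by (rule inverse_unique[symmetric])
qed (simp add: emb_0)

lemma emb_divide: "g \<in> FF \<Longrightarrow> h \<in> FF \<Longrightarrow> emb xh yh (g / h) = emb xh yh g / emb xh yh h"
  using emb_mult[OF _ ff_inverse, of g h] by (simp add: divide_inverse emb_inverse)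

lemma emb_diff:
  assumes "g \<in> FF" "h \<in> FF"
  shows "emb xh yh (g - h) = emb xh yh g - emb xh yh h"
  using emb_add[OF ff_diff[OF assms] assms(2)] by (simp add: algebra_simps)

lemma emb_power: "g \<in> FF \<Longrightarrow> emb xh yh (g ^ n) = emb xh yh g ^ n"
  by (induction n) (simp_all add: emb_1 emb_mult ff_power)

lemma emb_powi: "g \<in> FF \<Longrightarrow> emb xh yh (g powi n) = emb xh yh g powi n"
  by (simp add: power_int_def emb_power emb_inverse ff_inverse)

end

end

section \<open>Logarithmic derivatives and traces\<close>

text \<open>A root of 1 + X + ... + X^(p-1) differs from 1 in characteristic 0, and since
  \<open>p\<close> is prime its order is exactly \<open>p\<close>, by Bezout.\<close>

lemma primitive_root_of_unity:
  assumes "prime p"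
  obtains \<zeta> :: "'a::{alg_closed_field,field_char_0}" where "\<And>k. \<zeta> ^ k = 1 \<longleftrightarrow> p dvd k"
proof -
  have p1: "p > 1" using assms by (rule prime_gt_1_nat)
  obtain \<zeta> :: 'a where "(\<Sum>k\<le>p - 1. 1 * \<zeta> ^ k) = 0"
    using alg_closed[of "p - 1" "\<lambda>_. 1"] p1 by auto
  moreover have "{..p - 1} = {..<p}" using p1 by auto
  ultimately have sum: "(\<Sum>k<p. \<zeta> ^ k) = 0" by simp
  have "\<zeta> ^ p - 1 = (\<zeta> - 1) * (\<Sum>k<p. \<zeta> ^ k)"
    by (rule power_diff_1_eq)
  then have zp: "\<zeta> ^ p = 1" using sum by simp
  have "\<zeta> \<noteq> 1" using sum p1 by auto
  have "\<zeta> ^ k = 1 \<longleftrightarrow> p dvd k" for k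
  proof
    show "\<zeta> ^ k = 1" if "p dvd k"
      using that zp by (auto simp: power_mult)
    show "p dvd k" if k: "\<zeta> ^ k = 1"
    proof (rule ccontr)
      assume "\<not> p dvd k"
      then have "coprime p k" using assms by (simp add: prime_imp_coprime)
      then have gcd: "gcd k p = 1" by (simp add: coprime_iff_gcd_eq_1 gcd.commute)
      have "k \<noteq> 0" using \<open>\<not> p dvd k\<close> by (metis dvd_0_right)
      then obtain u v where "k * u = p * v + 1"
        using bezout_nat[of k p] gcd by auto
      then have "\<zeta> ^ (k * u) = \<zeta> ^ (p * v) * \<zeta>" by simp
      then show False using k zp \<open>\<zeta> \<noteq> 1\<close> by (simp add: power_mult)
    qed
  qed
  then show ?thesis by (rule that)
qed

lemma sum_powers_root_of_unity:
  fixes \<zeta> :: "'a::field_char_0"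
  assumes "\<And>k. \<zeta> ^ k = 1 \<longleftrightarrow> p dvd k"
  shows "(\<Sum>j<p. (\<zeta> ^ j) ^ k) = (if p dvd k then of_nat p else 0)"
proof -
  have eq: "(\<Sum>j<p. (\<zeta> ^ j) ^ k) = (\<Sum>j<p. (\<zeta> ^ k) ^ j)"
    by (simp add: power_mult[symmetric] mult.commute)
  show ?thesis
  proof (cases "p dvd k")
    case True
    then have "\<zeta> ^ k = 1" using assms by blast
    then show ?thesis using True unfolding eq by simp
  next
    case False
    have "(\<zeta> ^ k) ^ p - 1 = (\<zeta> ^ k - 1) * (\<Sum>j<p. (\<zeta> ^ k) ^ j)"
      by (rule power_diff_1_eq)
    moreover have "(\<zeta> ^ k) ^ p = 1"
      using assms[of "k * p"] by (simp add: power_mult)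
    ultimately show ?thesis
      using False assms[of k] eq by simp
  qed
qed

lemma order_linear: "Polynomial.order \<gamma> [:- \<delta>, 1:] = (if \<gamma> = \<delta> then 1 else 0)"
  for \<gamma> \<delta> :: "'a::field"
  using order_power_n_n[of \<delta> 1] by (auto intro: order_0I)

context superelliptic
begin

abbreviation shift :: "'k alg_closure \<Rightarrow> 'k alg_closure fls" where
  "shift \<gamma> \<equiv> fls_const \<gamma> + fls_X"

lemma place_shift: "w ^ p = eval1 fls_const (shift \<gamma>) F0 \<Longrightarrow> place (shift \<gamma>) w"
  using place_shiftI[of 1 w \<gamma>] by simp

lemma shift_ge: "fls_ge 0 (shift \<gamma>)"
  by (auto simp: fls_ge_def)

text \<open>A root of the series is found with its constant term right only up to a p-th root of
  unity; rescaling by that root of unity corrects it.\<close>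

lemma unramified_root:
  assumes "poly F0 \<gamma> \<noteq> 0" "\<beta> ^ p = poly F0 \<gamma>"
  obtains w where "w ^ p = eval1 fls_const (shift \<gamma>) F0" "fls_subdegree w = 0" "w $$ 0 = \<beta>"
proof -
  have "\<beta> \<noteq> 0" using assms p_gt_0 by (auto simp: power_0_left)
  have "\<exists>w. w ^ p = eval1 fls_const (shift \<gamma>) F0 \<and> fls_subdegree w = 0"
    using eval1_shift_subdegree[OF F0_nonzero, of 1 \<gamma>] p_gt_0 assms
    by (intro fls_root_exists) (auto simp: order_0I)
  then obtain v where v: "v ^ p = eval1 fls_const (shift \<gamma>) F0" "fls_subdegree v = 0" by blast
  have v_ge: "fls_ge 0 v" using v(2) by (simp add: fls_ge_0_iff)
  have v0: "(v $$ 0) ^ p = \<beta> ^ p"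
    using fls_ge_power(2)[OF v_ge, of p] eval1_nth_0[OF shift_ge, of \<gamma> F0] assms by (simp add: v(1))
  then have "v $$ 0 \<noteq> 0" using assms p_gt_0 by (auto simp: power_0_left)
  define w where "w = fls_const (\<beta> / v $$ 0) * v"
  have "fls_const (\<beta> / v $$ 0) ^ p = 1"
    using v0 \<open>\<beta> \<noteq> 0\<close> by (simp flip: fls_const.hom_power add: power_divide)
  then have "w ^ p = eval1 fls_const (shift \<gamma>) F0"
    by (simp add: w_def power_mult_distrib v(1))
  moreover have "w $$ 0 = \<beta>"
    using \<open>v $$ 0 \<noteq> 0\<close> by (simp add: w_def)
  moreover have "fls_subdegree w = 0"
  proof (rule fls_subdegree_eqI)
    show "w $$ 0 \<noteq> 0" using \<open>w $$ 0 = \<beta>\<close> \<open>\<beta> \<noteq> 0\<close> by simp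
    show "w $$ k = 0" if "k < 0" for k using v_ge that by (simp add: w_def fls_ge_def)
  qed
  ultimately show ?thesis by (intro that)
qed

text \<open>The trace to \<open>K(x)\<close> of \<open>h y\<close>, where \<open>h\<close> is the rational function \<open>H(x,y)/b(x)\<close>.\<close>

lemma trace_eq:
  assumes pl: "place xh yh" and H: "degree H < p" and b: "b \<noteq> 0"
    and \<zeta>: "\<And>k. \<zeta> ^ k = 1 \<longleftrightarrow> p dvd k"
  defines "N \<equiv> smult (of_nat p) (coeff H (p - 1) * F0)"
  shows "eval1 fls_const xh N / eval1 fls_const xh b =
    (\<Sum>j<p. emb xh (fls_const (\<zeta> ^ j) * yh) (eval_xy y H / eval_x b) * (fls_const (\<zeta> ^ j) * yh))"
    and "place xh (fls_const (\<zeta> ^ j) * yh)"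
proof -
  interpret h1: ring_morphism "eval1 fls_const xh" by (rule fls_const.eval1_morphism)
  let ?B = "eval1 fls_const xh b" and ?c = "\<lambda>j. fls_const (\<zeta> ^ j)"
  have pl_j: "place xh (?c j * yh)" for j
  proof -
    have "(\<zeta> ^ j) ^ p = 1" using \<zeta>[of "j * p"] by (simp add: power_mult)
    then have "?c j ^ p = 1" by (simp only: fls_const.hom_power[symmetric] fls_const_1)
    then show ?thesis
      using pl by (simp add: place_def power_mult_distrib)
  qed
  then show "place xh (fls_const (\<zeta> ^ j) * yh)" .
  have "(\<Sum>j<p. emb xh (?c j * yh) (eval_xy y H / eval_x b) * (?c j * yh)) =
      (\<Sum>j<p. \<Sum>i<p. eval1 fls_const xh (coeff H i) * yh ^ Suc i / ?B * ?c j ^ Suc i)"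
  proof (intro sum.cong refl)
    fix j
    have "emb xh (?c j * yh) (eval_xy y H / eval_x b) =
        (\<Sum>i<p. eval1 fls_const xh (coeff H i) * (?c j * yh) ^ i) / ?B"
      unfolding emb_eq[OF pl_j b] by (simp only: fls_const.eval2_sum[OF H])
    also have "\<dots> * (?c j * yh) =
        (\<Sum>i<p. eval1 fls_const xh (coeff H i) * yh ^ Suc i / ?B * ?c j ^ Suc i)"
      unfolding sum_divide_distrib sum_distrib_right
      by (intro sum.cong refl) (simp add: power_mult_distrib mult_ac)
    finally show "emb xh (?c j * yh) (eval_xy y H / eval_x b) * (?c j * yh) =
        (\<Sum>i<p. eval1 fls_const xh (coeff H i) * yh ^ Suc i / ?B * ?c j ^ Suc i)" .
  qed
  also have "\<dots> = (\<Sum>i<p. eval1 fls_const xh (coeff H i) * yh ^ Suc i / ?B * (\<Sum>j<p. ?c j ^ Suc i))"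
    unfolding sum_distrib_left by (rule sum.swap)
  \<comment> \<open>Summing over the conjugates of \<open>y\<close> keeps only powers with exponent
    divisible by \<open>p\<close>. Because of the extra factor \<open>y\<close> the surviving
    coefficient of \<open>H\<close> is the one of index \<open>p - 1\<close>, and
    \<open>yh ^ p\<close> turns back into \<open>F0\<close>.\<close>
  also have "\<dots> = (\<Sum>i\<in>{p - 1}. eval1 fls_const xh (coeff H i) * yh ^ Suc i / ?B * (\<Sum>j<p. ?c j ^ Suc i))"
  proof (rule sum.mono_neutral_right)
    show "\<forall>i\<in>{..<p} - {p - 1}. eval1 fls_const xh (coeff H i) * yh ^ Suc i / ?B * (\<Sum>j<p. ?c j ^ Suc i) = 0"
    proof
      fix i assume "i \<in> {..<p} - {p - 1}"
      then have "\<not> p dvd Suc i" by (auto dest: dvd_imp_le)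
      then have "(\<Sum>j<p. ?c j ^ Suc i) = 0"
        using sum_powers_root_of_unity[of \<zeta> p "Suc i", OF \<zeta>]
        by (simp only: fls_const.hom_power[symmetric] fls_const.hom_sum[symmetric] if_False fls_const_0)
      then show "eval1 fls_const xh (coeff H i) * yh ^ Suc i / ?B * (\<Sum>j<p. ?c j ^ Suc i) = 0"
        by simp
    qed
  qed (use p_gt_0 in auto)
  also have "\<dots> = eval1 fls_const xh (coeff H (p - 1)) * yh ^ p / ?B * (\<Sum>j<p. ?c j ^ p)"
    using p_gt_0 by simp
  also have "(\<Sum>j<p. ?c j ^ p) = fls_const (of_nat p)"
    using sum_powers_root_of_unity[of \<zeta> p p, OF \<zeta>]
    by (simp only: fls_const.hom_power[symmetric] fls_const.hom_sum[symmetric] dvd_refl if_True)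
  also have "eval1 fls_const xh (coeff H (p - 1)) * yh ^ p / ?B * fls_const (of_nat p) =
      eval1 fls_const xh N / ?B"
    using pl by (simp add: place_def N_def fls_const.eval1_smult h1.hom_mult mult_ac)
  finally show "eval1 fls_const xh N / eval1 fls_const xh b =
    (\<Sum>j<p. emb xh (fls_const (\<zeta> ^ j) * yh) (eval_xy y H / eval_x b) * (fls_const (\<zeta> ^ j) * yh))"
    by simp
qed

section \<open>Derivations of the function field that annihilate x\<close>

context
  fixes d :: "'k ambient \<Rightarrow> 'k ambient" and dK :: "'k alg_closure \<Rightarrow> 'k alg_closure"
  assumes d: "derivation d" and dK: "derivation dK"
    and d_const: "\<And>c. d (const_emb c) = const_emb (dK c)"
    and d_x: "d coord_x = 0" and dK_a: "dK a = 0"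
begin

interpretation d: derivation d by (rule d)
interpretation dK: derivation dK by (rule dK)

text \<open>It suffices to compare the two derivations on constants, \<open>x\<close> and
  \<open>y\<close>. On \<open>x\<close> both vanish by assumption, and on \<open>y\<close> both are
  forced by differentiating the equation \<open>y ^ p = F0\<close>.\<close>

lemma emb_derivation:
  assumes pl: "place xh yh" and xh: "fls_twist dK c xh = 0" and "h \<in> FF"
  shows "d h \<in> FF \<and> emb xh yh (d h) = fls_twist dK c (emb xh yh h)"
proof -
  interpret tw: derivation "fls_twist dK c" by (rule dK.fls_twist_derivation)
  let ?P = "\<lambda>h. d h \<in> FF \<and> emb xh yh (d h) = fls_twist dK c (emb xh yh h)"
  have const: "?P (const_emb u)" for u
    by (simp add: d_const ff_const emb_const[OF pl] dK.fls_twist_const)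
  have x: "?P coord_x"
    by (simp add: d_x ff_0 emb_0[OF pl] emb_x[OF pl] xh)
  have add: "?P (g + h)" if "g \<in> FF" "h \<in> FF" "?P g" "?P h" for g h
    using that by (simp add: d.d_add tw.d_add ff_add emb_add[OF pl])
  have mult: "?P (g * h)" if "g \<in> FF" "h \<in> FF" "?P g" "?P h" for g h
    using that by (simp add: d.d_mult tw.d_mult ff_add ff_mult emb_add[OF pl] emb_mult[OF pl])
  have ex: "?P (eval_x q)" for q
  proof (induction q)
    case 0
    then show ?case using const[of 0] by (simp add: const_emb.eval1_0 const_emb.hom_zero)
  next
    case (pCons u q)
    then show ?case
      unfolding const_emb.eval1_pCons
      by (intro add mult const x ff_const ff_mult ff_x ff_eval_x)
  qed
  show ?thesis
    using assms(3)
  proof (induction rule: ff_induct)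
    case y
    obtain l where l: "p = Suc l" using p_gt_0 gr0_conv_Suc by blast
    have yh: "yh \<noteq> 0"
      using emb_eq_0_iff[OF pl ff_y] y_nonzero by (simp add: emb_y[OF pl])
    let ?q = "of_nat p * y ^ l"
    have q: "?q \<noteq> 0" using y_nonzero p_gt_0 by simp
    have qF: "?q \<in> FF" using ff_const[of "of_nat p" y]
      by (simp add: ff_mult ff_power ff_y const_emb.hom_of_nat)
    have "d (eval_x F0) = ?q * d y"
      unfolding y_eq[symmetric] l by (rule d.d_power)
    then have dy: "d y = d (eval_x F0) / ?q" using q by simp
    have "emb xh yh ?q = of_nat p * yh ^ l"
      using emb_mult[OF pl ff_const[of "of_nat p" y] ff_power[OF ff_y], of l]
        emb_const[OF pl, of "of_nat p"]
      by (simp add: const_emb.hom_of_nat emb_power[OF pl] ff_y emb_y[OF pl] fls_of_nat)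
    then have "emb xh yh (d y) = fls_twist dK c (emb xh yh (eval_x F0)) / (of_nat p * yh ^ l)"
      unfolding dy using ex[of F0] qF by (simp add: emb_divide[OF pl])
    also have "emb xh yh (eval_x F0) = yh ^ p"
      using pl by (simp add: emb_eval_x[OF pl] place_def)
    also have "fls_twist dK c (yh ^ p) = of_nat p * yh ^ l * fls_twist dK c yh"
      unfolding l by (rule tw.d_power)
    finally have "emb xh yh (d y) = fls_twist dK c (emb xh yh y)"
      using yh p_gt_0 by (simp add: emb_y[OF pl])
    moreover have "d y \<in> FF"
      unfolding dy using ex[of F0] qF by (simp add: ff_divide)
    ultimately show ?case by blast
  next
    case (inverse g)
    then show ?case
      by (simp add: d.d_inverse tw.d_inverse ff_mult ff_minus ff_inverse emb_mult[OF pl]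
          emb_inverse[OF pl] emb_diff[OF pl, of 0, simplified] emb_0[OF pl] ff_0)
  qed (use const x add mult in blast)+
qed

lemma log_derivative_in_FF:
  assumes "g \<in> FF"
  shows "d g / g \<in> FF"
proof -
  \<comment> \<open>Some place whose \<open>xh\<close> is annihilated by a twist is required to
    apply \<open>emb_derivation\<close>; at infinity this holds for every \<open>dK\<close>.\<close>
  obtain yh where "place (fls_X_inv ^ p) yh" by (rule place_infinity)
  from emb_derivation[OF this dK.fls_twist_X_inv_power assms] show ?thesis
    using assms by (simp add: ff_divide)
qed

lemma emb_log_derivative:
  assumes pl: "place xh yh" and xh: "fls_twist dK c xh = 0" and g: "g \<in> FF"
  shows "emb xh yh (d g / g) = fls_twist dK c (emb xh yh g) / emb xh yh g"
  using emb_derivation[OF assms] g by (simp add: emb_divide[OF pl])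

text \<open>
  The logarithmic derivative of \<open>g\<close> has only simple poles, at the unramified zeros and poles of
  \<open>g\<close>. The trace of its product with \<open>y\<close> is thus a rational function of \<open>x\<close> without poles in the
  affine line apart from a simple one at \<open>\<alpha>\<close>, it vanishes at \<open>0\<close> and \<open>-a\<close>, and it is regular at
  infinity because \<open>m + 1 < p\<close>; so it is zero. But its residue at \<open>\<alpha>\<close> is not zero.
\<close>

lemma no_function_with_divisor:
  fixes n c :: nat
  assumes \<alpha>: "dK \<alpha> \<noteq> 0" "\<beta> ^ p = poly F0 \<alpha>" "poly F0 \<alpha> \<noteq> 0"
    and g: "g \<in> FF" "g \<noteq> 0" and nc: "n > 0" "c > 0"
    and ord: "\<And>\<gamma> w. poly F0 \<gamma> \<noteq> 0 \<Longrightarrow> w ^ p = eval1 fls_const (shift \<gamma>) F0 \<Longrightarrow>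
      fls_subdegree (emb (shift \<gamma>) w g) =
        (if \<gamma> = \<alpha> then int n * ((if w $$ 0 = \<beta> then int c else 0) - 1) else 0)"
  shows False
proof -
  obtain \<zeta> :: "'k alg_closure" where \<zeta>: "\<And>k. \<zeta> ^ k = 1 \<longleftrightarrow> p dvd k"
    using primitive_root_of_unity[OF p] by blast
  have \<beta>: "\<beta> \<noteq> 0" using \<alpha> p_gt_0 by (auto simp: power_0_left)
  obtain H0 b where b: "b \<noteq> 0" and H0: "d g / g = eval_xy y H0 / eval_x b"
    using ff_repr[OF log_derivative_in_FF[OF g(1)]] by blast
  \<comment> \<open>The trace formula requires a numerator of y-degree below
    \<open>p\<close>.\<close>
  obtain H Q where H: "H0 = curve_poly * Q + H" "degree H < p"
    by (rule reduce_mod_curve_poly)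
  have h: "d g / g = eval_xy y H / eval_x b"
    unfolding H0 H(1) by (simp add: eval_xy.hom_add eval_xy.hom_mult eval_xy_curve_poly)
  define N where "N = smult (of_nat p) (coeff H (p - 1) * F0)"
  define T where "T = (\<lambda>xh. eval1 fls_const xh N / eval1 fls_const xh b)"
  have T: "T xh = (\<Sum>j<p. emb xh (fls_const (\<zeta> ^ j) * yh) (d g / g) * (fls_const (\<zeta> ^ j) * yh))"
    and pl_j: "place xh (fls_const (\<zeta> ^ j) * yh)" if "place xh yh" for xh yh j
    unfolding T_def h N_def
    using trace_eq(1)[OF that H(2) b \<zeta>] trace_eq(2)[OF that H(2) b \<zeta>] by blast+
  have emb_nz: "emb xh yh g \<noteq> 0" if "place xh yh" for xh yh
    using emb_eq_0_iff[OF that g(1)] g(2) by simp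

  \<comment> \<open>The logarithmic derivative is regular here for any order of \<open>g\<close>, so
    the trace is bounded by the order of \<open>y\<close> alone.\<close>
  have ramified: "fls_ge (fls_subdegree yh) (T xh)"
    if pl: "place xh yh" and xh: "fls_twist dK 0 xh = 0" for xh yh
    unfolding T[OF pl]
  proof (rule fls_ge_sum)
    fix j
    have "fls_ge 0 (emb xh (fls_const (\<zeta> ^ j) * yh) (d g / g))"
      unfolding emb_log_derivative[OF pl_j[OF pl] xh g(1)]
      by (rule dK.fls_twist_0_log_derivative[OF emb_nz[OF pl_j[OF pl]]])
    moreover have "fls_ge (fls_subdegree yh) (fls_const (\<zeta> ^ j) * yh)"
      by (simp add: fls_ge_def)
    ultimately have "fls_ge (0 + fls_subdegree yh)
        (emb xh (fls_const (\<zeta> ^ j) * yh) (d g / g) * (fls_const (\<zeta> ^ j) * yh))"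
      by (rule fls_ge_mult)
    then show "fls_ge (fls_subdegree yh)
        (emb xh (fls_const (\<zeta> ^ j) * yh) (d g / g) * (fls_const (\<zeta> ^ j) * yh))"
      by simp
  qed

  \<comment> \<open>The local parameter \<open>x - \<gamma>\<close> has derivative
    \<open>- dK \<gamma>\<close>, so zeros and poles of \<open>g\<close> appear as residues. The
    series \<open>\<zeta> ^ j * w\<close> run through the expansions of \<open>y\<close> over
    \<open>\<gamma>\<close>, and \<open>ord\<close> gives the order of \<open>g\<close> at
    each.\<close>
  have unramified: "fls_ge (- 1) (T (shift \<gamma>))"
    "T (shift \<gamma>) $$ (- 1) = (\<Sum>j<p. - dK \<gamma> *
       of_int (if \<gamma> = \<alpha> then int n * ((if \<zeta> ^ j * w $$ 0 = \<beta> then int c else 0) - 1) else 0) *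
       (\<zeta> ^ j * w $$ 0))"
    if \<gamma>: "poly F0 \<gamma> \<noteq> 0" and w: "w ^ p = eval1 fls_const (shift \<gamma>) F0" "fls_subdegree w = 0"
    for \<gamma> w
  proof -
    interpret tw: derivation "fls_twist dK (dK \<gamma>)" by (rule dK.fls_twist_derivation)
    have pl: "place (shift \<gamma>) w" using w(1) by (rule place_shift)
    have xh: "fls_twist dK (dK \<gamma>) (shift \<gamma>) = 0"
      by (simp add: tw.d_add dK.fls_twist_const dK.fls_twist_X)
    let ?w = "\<lambda>j. fls_const (\<zeta> ^ j) * w"
    let ?z = "\<lambda>j. emb (shift \<gamma>) (?w j) (d g / g)"
    have z: "fls_ge (- 1) (?z j)"
      "?z j $$ (- 1) = - dK \<gamma> * of_int (fls_subdegree (emb (shift \<gamma>) (?w j) g))" for j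
      unfolding emb_log_derivative[OF pl_j[OF pl] xh g(1)]
      by (rule dK.fls_twist_log_derivative[OF emb_nz[OF pl_j[OF pl]]])+
    have wj: "fls_ge 0 (?w j)" for j
      using w(2) by (simp add: fls_ge_def)
    have "?w j ^ p = eval1 fls_const (shift \<gamma>) F0" for j
      using pl_j[OF pl] by (simp add: place_def)
    note ord_j = ord[OF \<gamma> this]
    show "fls_ge (- 1) (T (shift \<gamma>))"
      unfolding T[OF pl] using fls_ge_mult[OF z(1) wj] by (intro fls_ge_sum) simp
    have "T (shift \<gamma>) $$ (- 1) = (\<Sum>j<p. ?z j $$ (- 1) * ?w j $$ 0)"
      unfolding T[OF pl] fls_nth_sum using fls_times_nth_lowest[OF z(1) wj]
      by (intro sum.cong refl) simp
    then show "T (shift \<gamma>) $$ (- 1) = (\<Sum>j<p. - dK \<gamma> *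
       of_int (if \<gamma> = \<alpha> then int n * ((if \<zeta> ^ j * w $$ 0 = \<beta> then int c else 0) - 1) else 0) *
       (\<zeta> ^ j * w $$ 0))"
      by (simp only: z(2) ord_j fls_mult_const_nth)
  qed

  have T_\<alpha>: "T (shift \<alpha>) \<noteq> 0"
  proof -
    obtain w where w: "w ^ p = eval1 fls_const (shift \<alpha>) F0" "fls_subdegree w = 0" "w $$ 0 = \<beta>"
      using unramified_root[OF \<alpha>(3,2)] by blast
    \<comment> \<open>Only \<open>j = 0\<close> is the point P. The coefficient -1 common to the
      whole fibre contributes a multiple of the sum of all \<open>\<zeta> ^ j\<close>, which is
      0.\<close>
    have "(\<Sum>j<p. - dK \<alpha> * of_int (int n * ((if \<zeta> ^ j * \<beta> = \<beta> then int c else 0) - 1)) * (\<zeta> ^ j * \<beta>)) =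
        (\<Sum>j<p. (- dK \<alpha> * of_nat n * \<beta>) * ((if j = 0 then of_nat c else 0) - \<zeta> ^ j))"
    proof (intro sum.cong refl)
      fix j assume j: "j \<in> {..<p}"
      have "\<zeta> ^ j * \<beta> = \<beta> \<longleftrightarrow> j = 0"
        using \<zeta>[of j] \<beta> j by (auto dest: dvd_imp_le)
      then show "- dK \<alpha> * of_int (int n * ((if \<zeta> ^ j * \<beta> = \<beta> then int c else 0) - 1)) * (\<zeta> ^ j * \<beta>) =
          (- dK \<alpha> * of_nat n * \<beta>) * ((if j = 0 then of_nat c else 0) - \<zeta> ^ j)"
        by (auto simp: algebra_simps)
    qed
    also have "\<dots> = (- dK \<alpha> * of_nat n * \<beta>) * of_nat c"
    proof -
      have "(\<Sum>j<p. \<zeta> ^ j) = 0"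
        using sum_powers_root_of_unity[of \<zeta> p 1, OF \<zeta>] m by simp
      then show ?thesis
        unfolding sum_distrib_left[symmetric] sum_subtractf using p_gt_0 by simp
    qed
    finally have "T (shift \<alpha>) $$ (- 1) = (- dK \<alpha> * of_nat n * \<beta>) * of_nat c"
      using unramified(2)[OF \<alpha>(3) w(1,2)] w(3) by simp
    then have "T (shift \<alpha>) $$ (- 1) \<noteq> 0" using \<alpha> \<beta> nc by simp
    then show ?thesis by auto
  qed
  have N: "N \<noteq> 0" using T_\<alpha> by (auto simp: T_def fls_const.eval1_0)

  \<comment> \<open>\<open>k\<close> is the ramification index: orders in \<open>fls_X\<close> are
    \<open>k\<close> times orders in \<open>x - \<gamma>\<close>.\<close>
  have order_shift: "int k * int (Polynomial.order \<gamma> N) \<ge> int k * int (Polynomial.order \<gamma> b) + s"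
    if "fls_ge s (T (fls_const \<gamma> + fls_X ^ k))" "k > 0" for \<gamma> s k
  proof -
    have "T (fls_const \<gamma> + fls_X ^ k) \<noteq> 0"
      and "fls_subdegree (T (fls_const \<gamma> + fls_X ^ k)) =
        int k * int (Polynomial.order \<gamma> N) - int k * int (Polynomial.order \<gamma> b)"
      unfolding T_def using eval1_shift_subdegree[OF N that(2), of \<gamma>] eval1_shift_subdegree[OF b that(2), of \<gamma>]
      by (simp_all add: fls_divide_subdegree)
    then show ?thesis using that(1) by (simp add: fls_ge_iff)
  qed
  have ord_N: "Polynomial.order \<gamma> b \<le> Polynomial.order \<gamma> N + (if \<gamma> = \<alpha> then 1 else 0)"
    if \<gamma>: "poly F0 \<gamma> \<noteq> 0" for \<gamma>
  proof -
    obtain \<beta>' where "\<beta>' ^ p = poly F0 \<gamma>" using nth_root_exists[OF p_gt_0] by blast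
    then obtain w where w: "w ^ p = eval1 fls_const (shift \<gamma>) F0" "fls_subdegree w = 0"
      using unramified_root[OF \<gamma>] by blast
    show ?thesis
    proof (cases "\<gamma> = \<alpha>")
      case True
      then show ?thesis using order_shift[of "- 1" \<gamma> 1] unramified(1)[OF \<gamma> w] by simp
    next
      case False
      then have "T (shift \<gamma>) $$ (- 1) = 0" using unramified(2)[OF \<gamma> w] by simp
      then have "fls_ge 0 (T (shift \<gamma>))"
        using unramified(1)[OF \<gamma> w] unfolding fls_ge_def
        by (metis zless_add1_eq add.left_inverse)
      then show ?thesis using order_shift[of 0 \<gamma> 1] by simp
    qed
  qed
  \<comment> \<open>The trace inherits the positive order of \<open>y\<close>. Its order in
    \<open>fls_X\<close> is a multiple of \<open>p\<close>, so a positive one is at least 1 in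
    \<open>x - \<gamma>\<close>.\<close>
  have ord_ram: "Polynomial.order \<gamma> b + 1 \<le> Polynomial.order \<gamma> N"
    if "place (fls_const \<gamma> + fls_X ^ p) yh" "fls_subdegree yh > 0" "dK \<gamma> = 0" for \<gamma> yh
  proof -
    interpret tw: derivation "fls_twist dK 0" by (rule dK.fls_twist_derivation)
    have "fls_twist dK 0 (fls_const \<gamma> + fls_X ^ p) = 0"
      using that(3) by (simp add: tw.d_add dK.fls_twist_const dK.fls_twist_X_power)
    from order_shift[OF ramified[OF that(1) this] p_gt_0]
    have "int p * int (Polynomial.order \<gamma> N) > int p * int (Polynomial.order \<gamma> b)"
      using that(2) by simp
    then show ?thesis using p_gt_0 by simp
  qed
  have ord_0: "Polynomial.order 0 b + 1 \<le> Polynomial.order 0 N"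
    using place_0 ord_ram[of 0] m dK.d_zero by (metis of_nat_0_less_iff)
  have ord_a: "Polynomial.order (- a) b + 1 \<le> Polynomial.order (- a) N"
    using place_minus_a ord_ram[of "- a"] dK.d_minus[of a] dK_a by (metis neg_0_equal_iff_equal zero_less_one)
  have deg: "degree N \<le> degree b"
  proof -
    obtain yh where yh: "place (fls_X_inv ^ p) yh" "fls_subdegree yh = - int (m + 1)"
      by (rule place_infinity)
    have "T (fls_X_inv ^ p) \<noteq> 0"
      and "fls_subdegree (T (fls_X_inv ^ p)) = - int p * int (degree N) - (- int p * int (degree b))"
      unfolding T_def using eval1_infinity_subdegree[OF N p_gt_0] eval1_infinity_subdegree[OF b p_gt_0]
      by (simp_all add: fls_divide_subdegree)
    then have "- int (m + 1) \<le> - int p * int (degree N) - (- int p * int (degree b))"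
      using ramified[OF yh(1) dK.fls_twist_X_inv_power] yh(2) by (simp add: fls_ge_iff)
    \<comment> \<open>A pole of order at most \<open>m + 1 < p\<close> in the local parameter is no
      pole, since the order of a function of \<open>x\<close> is a multiple of
      \<open>p\<close>.\<close>
    then have "int p * int (degree N) < int p * (int (degree b) + 1)"
      using m by (simp add: distrib_left)
    then show ?thesis using p_gt_0 by simp
  qed

  define l where "l = (\<lambda>\<gamma> :: 'k alg_closure. [:- \<gamma>, 1:])"
  have l: "l \<gamma> \<noteq> 0" "degree (l \<gamma>) = 1" for \<gamma> by (simp_all add: l_def)
  have \<alpha>_neq: "\<alpha> \<noteq> 0" "\<alpha> \<noteq> - a"
    using \<alpha>(3) m by (auto simp: poly_F0 power_0_left)
  \<comment> \<open>\<open>l \<alpha>\<close> allows for the simple pole at \<open>\<alpha>\<close>,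
    while \<open>l 0\<close> and \<open>l (- a)\<close> are the forced zeros. The degrees give
    \<open>degree b + 2 \<le> degree N + 1\<close>, against \<open>deg\<close>.\<close>
  have "degree (b * (l 0 * l (- a))) \<le> degree (l \<alpha> * N)"
  proof (rule degree_le_if_orders_le)
    show nz: "b * (l 0 * l (- a)) \<noteq> 0" "l \<alpha> * N \<noteq> 0"
      using b N l by (simp_all only: mult_eq_0_iff) simp_all
    fix \<gamma>
    have "Polynomial.order \<gamma> (b * (l 0 * l (- a))) =
        Polynomial.order \<gamma> b + ((if \<gamma> = 0 then 1 else 0) + (if \<gamma> = - a then 1 else 0))"
    proof -
      have "Polynomial.order \<gamma> (b * (l 0 * l (- a))) = Polynomial.order \<gamma> b + Polynomial.order \<gamma> (l 0 * l (- a))"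
        using nz(1) by (rule order_mult)
      also have "Polynomial.order \<gamma> (l 0 * l (- a)) = Polynomial.order \<gamma> (l 0) + Polynomial.order \<gamma> (l (- a))"
        using l by (intro order_mult) (simp only: mult_eq_0_iff simp_thms)
      finally show ?thesis unfolding l_def by (simp only: order_linear)
    qed
    moreover have "Polynomial.order \<gamma> (l \<alpha> * N) = (if \<gamma> = \<alpha> then 1 else 0) + Polynomial.order \<gamma> N"
      using order_mult[OF nz(2), of \<gamma>] by (simp only: l_def order_linear)
    moreover have "poly F0 \<gamma> = 0 \<longleftrightarrow> \<gamma> = 0 \<or> \<gamma> = - a"
      using e m by (auto simp: poly_F0 eq_neg_iff_add_eq_0)
    ultimately show "Polynomial.order \<gamma> (b * (l 0 * l (- a))) \<le> Polynomial.order \<gamma> (l \<alpha> * N)"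
      using ord_N[of \<gamma>] ord_0 ord_a \<alpha>_neq a by (auto split: if_splits)
  qed
  moreover have "degree (b * (l 0 * l (- a))) = degree b + 2"
    using b l by (simp add: degree_mult_eq)
  moreover have "degree (l \<alpha> * N) = degree N + 1"
    using N l by (simp add: degree_mult_eq)
  ultimately show False using deg by simp
qed

end

end

section \<open>Divisors and the Picard group\<close>

lemma curve_pointsD:
  assumes "R \<in> curve_points y"
  shows "const_emb c \<in> R" and "R \<subseteq> function_field y"
    and "g \<in> R \<Longrightarrow> h \<in> R \<Longrightarrow> g - h \<in> R" and "g \<in> R \<Longrightarrow> h \<in> R \<Longrightarrow> g * h \<in> R"
    and "\<exists>s. uniformizer (function_field y) R s"
  using assms unfolding curve_points_def by blast+

context
  fixes R :: "'k::field ambient set" and y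
  assumes R: "R \<in> curve_points y"
begin

lemma one_in_R: "1 \<in> R"
  using curve_pointsD(1)[OF R, of 1] by (simp add: const_emb.hom_one)

lemma unit_1: "1 \<in> ring_units R"
  by (simp add: ring_units_def one_in_R)

lemma unit_mult: "u \<in> ring_units R \<Longrightarrow> v \<in> ring_units R \<Longrightarrow> u * v \<in> ring_units R"
  by (auto simp: ring_units_def curve_pointsD(4)[OF R])

lemma unit_inverse: "u \<in> ring_units R \<Longrightarrow> inverse u \<in> ring_units R"
  by (auto simp: ring_units_def)

lemma unit_power: "u \<in> ring_units R \<Longrightarrow> u ^ n \<in> ring_units R"
  by (induction n) (auto simp: unit_1 unit_mult)

lemma unit_powi: "u \<in> ring_units R \<Longrightarrow> u powi n \<in> ring_units R"
  by (simp add: power_int_def unit_power unit_inverse)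

lemma power_in_R: "s \<in> R \<Longrightarrow> s ^ n \<in> R"
  by (induction n) (auto simp: one_in_R curve_pointsD(4)[OF R])

lemma nonunit_powi:
  assumes "s \<in> R" "s \<noteq> 0" "inverse s \<notin> R" "s powi n \<in> ring_units R"
  shows "n = 0"
proof -
  have pos: False if "s ^ Suc k \<in> ring_units R" for k
  proof -
    have "inverse s = s ^ k * inverse (s ^ Suc k)"
      using assms(2) by (simp add: field_simps)
    moreover have "inverse (s ^ Suc k) \<in> R"
      using that unfolding ring_units_def by blast
    ultimately have "inverse s \<in> R"
      using curve_pointsD(4)[OF R power_in_R[OF assms(1)]] by metis
    then show False using assms(3) by blast
  qed
  show ?thesis
  proof (rule ccontr)
    assume "n \<noteq> 0"
    then consider k where "n = int (Suc k)" | k where "n = - int (Suc k)"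
      by (metis int_cases3 gr0_conv_Suc)
    then show False
    proof cases
      case 1
      then show ?thesis using assms(4) pos by (simp only: power_int_of_nat)
    next
      case 2
      then have "inverse (s ^ Suc k) \<in> ring_units R"
        using assms(4) by (simp only: power_int_minus power_int_of_nat)
      then show ?thesis using unit_inverse pos by fastforce
    qed
  qed
qed

lemma uniformizer_powi_unique:
  assumes s: "uniformizer F R s" and "u \<in> ring_units R" "v \<in> ring_units R"
    and eq: "s powi n * u = s powi k * v"
  shows "n = k"
proof -
  have s': "s \<in> R" "s \<noteq> 0" "inverse s \<notin> R" using s by (auto simp: uniformizer_def)
  have nz: "u \<noteq> 0" "v \<noteq> 0" using assms by (auto simp: ring_units_def)
  have "s powi (n - k) = s powi n / s powi k" using s' by (simp add: power_int_diff)
  also have "\<dots> = v * inverse u"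
    using eq nz s' by (simp add: field_simps)
  finally have "s powi (n - k) \<in> ring_units R"
    using assms by (simp add: unit_mult unit_inverse)
  from nonunit_powi[OF s' this] show ?thesis by simp
qed

lemma uniformizer_exponent_pos:
  assumes s: "uniformizer (function_field y) R s" and t: "uniformizer (function_field y) R t"
    and u: "u \<in> ring_units R" and eq: "t = s powi k * u"
  shows "k \<ge> 1"
proof (rule ccontr)
  assume "\<not> k \<ge> 1"
  then have k: "k = - int (nat (- k))" by simp
  have "inverse t = s ^ nat (- k) * inverse u"
    unfolding eq by (subst k) (simp only: power_int_minus power_int_of_nat inverse_mult_distrib inverse_inverse_eq)
  moreover have "s ^ nat (- k) \<in> R" "inverse u \<in> R"
    using s u by (auto simp: uniformizer_def ring_units_def intro: power_in_R)
  ultimately have "inverse t \<in> R" using curve_pointsD(4)[OF R] by simp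
  then show False using t by (simp add: uniformizer_def)
qed

text \<open>The order is defined through an arbitrary uniformizer, so independence is the issue. If
  \<open>s\<close> and \<open>t\<close> are powers of each other up to units, the exponents have
  product 1, and a negative exponent would put \<open>inverse t\<close> into
  \<open>R\<close>.\<close>

lemma ord_at_eqI:
  assumes s: "uniformizer (function_field y) R s" and u: "u \<in> ring_units R"
    and g: "g = s powi n * u"
  shows "ord_at y R g = n"
  unfolding ord_at_def
proof (rule the_equality)
  show "\<exists>s. uniformizer (function_field y) R s \<and> (\<exists>u\<in>ring_units R. g = s powi n * u)"
    using assms by blast
next
  fix n' assume "\<exists>s. uniformizer (function_field y) R s \<and> (\<exists>u\<in>ring_units R. g = s powi n' * u)"
  then obtain t v where t: "uniformizer (function_field y) R t" and v: "v \<in> ring_units R"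
    and g': "g = t powi n' * v" by blast
  have F: "s \<in> function_field y - {0}" "t \<in> function_field y - {0}"
    using s t curve_pointsD(2)[OF R] by (auto simp: uniformizer_def)
  obtain k w where w: "w \<in> ring_units R" "t = s powi k * w"
    using s F(2) unfolding uniformizer_def by blast
  obtain l w' where w': "w' \<in> ring_units R" "s = t powi l * w'"
    using t F(1) unfolding uniformizer_def by blast
  have "s powi 1 * 1 = s powi (k * l) * (w powi l * w')"
    using w'(2) unfolding w(2) by (simp add: power_int_mult_distrib power_int_mult mult.assoc)
  then have "1 = k * l"
    by (rule uniformizer_powi_unique[OF s unit_1 unit_mult[OF unit_powi[OF w(1)] w'(1)]])
  moreover have "k \<ge> 1" by (rule uniformizer_exponent_pos[OF s t w])
  ultimately have "k = 1" by (metis zmult_eq_1_iff not_one_le_zero zero_less_one_class.zero_le_one order_trans neg_0_le_iff_le)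
  then have "s powi n * u = s powi n' * (w powi n' * v)"
    using g g' unfolding w(2) by (simp add: power_int_mult_distrib mult.assoc)
  then show "n' = n"
    using uniformizer_powi_unique[OF s u unit_mult[OF unit_powi[OF w(1)] v]] by blast
qed

lemma ord_at_mult:
  assumes g: "g \<in> function_field y - {0}" and h: "h \<in> function_field y - {0}"
  shows "ord_at y R (g * h) = ord_at y R g + ord_at y R h"
proof -
  obtain s where s: "uniformizer (function_field y) R s"
    using curve_pointsD(5)[OF R] by blast
  then have s0: "s \<noteq> 0" by (simp add: uniformizer_def)
  obtain n u where u: "u \<in> ring_units R" "g = s powi n * u"
    using s g unfolding uniformizer_def by blast
  obtain k v where v: "v \<in> ring_units R" "h = s powi k * v"
    using s h unfolding uniformizer_def by blast
  have "g * h = s powi (n + k) * (u * v)"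
    unfolding u(2) v(2) using s0 by (simp add: power_int_add mult_ac)
  then show ?thesis
    using ord_at_eqI[OF s u] ord_at_eqI[OF s v] ord_at_eqI[OF s unit_mult[OF u(1) v(1)]] by simp
qed

lemma ord_at_1: "ord_at y R 1 = 0"
proof -
  obtain s where s: "uniformizer (function_field y) R s"
    using curve_pointsD(5)[OF R] by blast
  show ?thesis by (rule ord_at_eqI[OF s unit_1]) simp
qed

lemma ord_at_inverse:
  assumes g: "g \<in> function_field y - {0}"
  shows "ord_at y R (inverse g) = - ord_at y R g"
  using ord_at_mult[OF g, of "inverse g"] g ord_at_1 by (simp add: ff_inverse)

end

lemma divisor_degree_eq_sum:
  assumes "finite A" "Poly_Mapping.keys d \<subseteq> A"
  shows "divisor_degree d = (\<Sum>P\<in>A. Poly_Mapping.lookup d P)"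
  unfolding divisor_degree_def using assms
  by (intro sum.mono_neutral_left) (auto simp: in_keys_iff)

lemma divisor_degree_add: "divisor_degree (c + d) = divisor_degree c + divisor_degree d"
proof -
  let ?A = "Poly_Mapping.keys c \<union> Poly_Mapping.keys d"
  show ?thesis
    using Poly_Mapping.keys_add[of c d]
    by (simp add: divisor_degree_eq_sum[of ?A] lookup_add sum.distrib)
qed

lemma divisor_degree_0: "divisor_degree 0 = 0"
  by (simp add: divisor_degree_def)

lemma divisor_degree_minus: "divisor_degree (- d) = - divisor_degree d"
  using divisor_degree_add[of d "- d"] by (simp add: divisor_degree_0)

lemma divisor_degree_diff: "divisor_degree (c - d) = divisor_degree c - divisor_degree d"
  using divisor_degree_add[of c "- d"] by (simp add: divisor_degree_minus)

lemma divisor_degree_sum: "divisor_degree (\<Sum>i\<in>I. f i) = (\<Sum>i\<in>I. divisor_degree (f i))"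
  by (induction I rule: infinite_finite_induct) (simp_all add: divisor_degree_0 divisor_degree_add)

lemma divisor_degree_frag_of: "divisor_degree (frag_of P) = 1"
  by (simp add: divisor_degree_def)

lemma divisor_degree_frag_cmul: "divisor_degree (frag_cmul k d) = k * divisor_degree d"
proof -
  have "Poly_Mapping.keys (frag_cmul k d) \<subseteq> Poly_Mapping.keys d"
    by (auto simp: in_keys_iff)
  then show ?thesis
    by (simp add: divisor_degree_eq_sum[of "Poly_Mapping.keys d"] sum_distrib_left)
qed

section \<open>Divisors of degree 0 modulo principal divisors\<close>

lemma carrier_Div0:
  "d \<in> carrier (Div0 y) \<longleftrightarrow> Poly_Mapping.keys d \<subseteq> curve_points y \<and> divisor_degree d = 0"
  by (simp add: Div0_def)

lemma mult_Div0: "c \<otimes>\<^bsub>Div0 y\<^esub> d = c + d"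
  by (simp add: Div0_def free_Abelian_group_def)

lemma one_Div0: "\<one>\<^bsub>Div0 y\<^esub> = 0"
  by (simp add: Div0_def free_Abelian_group_def)

lemma comm_group_Div0: "comm_group (Div0 y)"
proof (rule comm_groupI)
  fix c d assume "c \<in> carrier (Div0 y)" "d \<in> carrier (Div0 y)"
  then show "c \<otimes>\<^bsub>Div0 y\<^esub> d \<in> carrier (Div0 y)"
    using Poly_Mapping.keys_add[of c d] by (auto simp: carrier_Div0 mult_Div0 divisor_degree_add)
next
  fix d assume "d \<in> carrier (Div0 y)"
  then show "\<exists>c\<in>carrier (Div0 y). c \<otimes>\<^bsub>Div0 y\<^esub> d = \<one>\<^bsub>Div0 y\<^esub>"
    by (intro bexI[of _ "- d"]) (auto simp: carrier_Div0 mult_Div0 one_Div0 divisor_degree_minus)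
qed (auto simp: carrier_Div0 mult_Div0 one_Div0 divisor_degree_0 add.assoc add.commute)

lemma inv_Div0:
  assumes "d \<in> carrier (Div0 y)"
  shows "inv\<^bsub>Div0 y\<^esub> d = - d"
proof -
  interpret comm_group "Div0 y" by (rule comm_group_Div0)
  show ?thesis
    using assms by (intro inv_equality) (auto simp: carrier_Div0 mult_Div0 one_Div0 divisor_degree_minus)
qed

lemma PrincI:
  assumes "d \<in> carrier (Div0 y)" "g \<in> function_field y" "g \<noteq> 0"
    and "\<And>R. R \<in> curve_points y \<Longrightarrow> Poly_Mapping.lookup d R = ord_at y R g"
  shows "d \<in> Princ y"
  unfolding Princ_def using assms by blast

lemma PrincE:
  assumes "d \<in> Princ y"
  obtains g where "d \<in> carrier (Div0 y)" "g \<in> function_field y" "g \<noteq> 0"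
    "\<And>R. R \<in> curve_points y \<Longrightarrow> Poly_Mapping.lookup d R = ord_at y R g"
  using assms unfolding Princ_def by blast

lemma subgroup_Princ: "subgroup (Princ y) (Div0 y)"
proof -
  interpret comm_group "Div0 y" by (rule comm_group_Div0)
  show ?thesis
  proof (rule subgroupI)
    show "Princ y \<subseteq> carrier (Div0 y)" by (auto simp: Princ_def)
    have "0 \<in> Princ y"
      using ff_1 ord_at_1 one_closed by (intro PrincI[of _ _ 1]) (auto simp: one_Div0)
    then show "Princ y \<noteq> {}" by blast
  next
    fix d assume "d \<in> Princ y"
    then obtain g where g: "d \<in> carrier (Div0 y)" "g \<in> function_field y" "g \<noteq> 0"
      "\<And>R. R \<in> curve_points y \<Longrightarrow> Poly_Mapping.lookup d R = ord_at y R g"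
      by (rule PrincE) blast
    have "- d \<in> carrier (Div0 y)" using inv_closed[OF g(1)] inv_Div0[OF g(1)] by simp
    then have "- d \<in> Princ y"
      using g by (intro PrincI[of _ _ "inverse g"]) (auto simp: ff_inverse ord_at_inverse)
    then show "inv\<^bsub>Div0 y\<^esub> d \<in> Princ y" by (simp add: inv_Div0[OF g(1)])
  next
    fix c d assume "c \<in> Princ y"
    then obtain g where g: "c \<in> carrier (Div0 y)" "g \<in> function_field y" "g \<noteq> 0"
      "\<And>R. R \<in> curve_points y \<Longrightarrow> Poly_Mapping.lookup c R = ord_at y R g"
      by (rule PrincE) blast
    assume "d \<in> Princ y"
    then obtain h where h: "d \<in> carrier (Div0 y)" "h \<in> function_field y" "h \<noteq> 0"
      "\<And>R. R \<in> curve_points y \<Longrightarrow> Poly_Mapping.lookup d R = ord_at y R h"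
      by (rule PrincE) blast
    have "c + d \<in> carrier (Div0 y)" using m_closed[OF g(1) h(1)] by (simp add: mult_Div0)
    then have "c + d \<in> Princ y"
      using g h by (intro PrincI[of _ _ "g * h"]) (auto simp: ff_mult ord_at_mult lookup_add)
    then show "c \<otimes>\<^bsub>Div0 y\<^esub> d \<in> Princ y" by (simp add: mult_Div0)
  qed
qed

lemma normal_Princ: "Princ y \<lhd> Div0 y"
  by (intro comm_group.subgroup_imp_normal comm_group_Div0 subgroup_Princ)

lemma Pic0_pow:
  assumes "d \<in> carrier (Div0 y)"
  shows "(Princ y #>\<^bsub>Div0 y\<^esub> d) [^]\<^bsub>Pic0 y\<^esub> (n::nat) = Princ y #>\<^bsub>Div0 y\<^esub> (frag_cmul (int n) d)"
    and "frag_cmul (int n) d \<in> carrier (Div0 y)"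
proof -
  interpret D: comm_group "Div0 y" by (rule comm_group_Div0)
  interpret P: normal "Princ y" "Div0 y" by (rule normal_Princ)
  have car: "frag_cmul (int n) d \<in> carrier (Div0 y)" for n
    using assms unfolding carrier_Div0 divisor_degree_frag_cmul
    by (auto simp: in_keys_iff)
  then show "frag_cmul (int n) d \<in> carrier (Div0 y)" .
  show "(Princ y #>\<^bsub>Div0 y\<^esub> d) [^]\<^bsub>Pic0 y\<^esub> n = Princ y #>\<^bsub>Div0 y\<^esub> (frag_cmul (int n) d)"
  proof (induction n)
    case 0
    have "Princ y #>\<^bsub>Div0 y\<^esub> 0 = Princ y"
      using D.coset_mult_one[OF P.subset] by (simp add: one_Div0)
    then show ?case by (simp add: Pic0_def FactGroup_def)
  next
    case (Suc n)
    have "(Princ y #>\<^bsub>Div0 y\<^esub> frag_cmul (int n) d) <#>\<^bsub>Div0 y\<^esub> (Princ y #>\<^bsub>Div0 y\<^esub> d) =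
        Princ y #>\<^bsub>Div0 y\<^esub> (frag_cmul (int n) d + d)"
      using P.rcos_sum[OF car assms] by (simp add: mult_Div0)
    moreover have "frag_cmul (int n) d + d = frag_cmul (int (Suc n)) d"
      by (simp add: frag_cmul_distrib add.commute)
    ultimately show ?case
      using Suc by (simp add: Pic0_def FactGroup_def nat_pow_def)
  qed
qed

lemma Pic0_pow_neq_one:
  assumes "d \<in> carrier (Div0 y)" "frag_cmul (int n) d \<notin> Princ y"
  shows "(Princ y #>\<^bsub>Div0 y\<^esub> d) [^]\<^bsub>Pic0 y\<^esub> (n::nat) \<noteq> \<one>\<^bsub>Pic0 y\<^esub>"
proof -
  interpret D: comm_group "Div0 y" by (rule comm_group_Div0)
  have "frag_cmul (int n) d \<in> Princ y #>\<^bsub>Div0 y\<^esub> (frag_cmul (int n) d)"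
    by (intro D.rcos_self subgroup_Princ Pic0_pow(2) assms)
  then show ?thesis
    using assms(2) Pic0_pow(1)[OF assms(1), of n] by (auto simp: Pic0_def FactGroup_def)
qed

section \<open>Galois action\<close>

abbreviation finv :: "('a \<Rightarrow> 'b) \<Rightarrow> 'b \<Rightarrow> 'a" where
  "finv \<equiv> inv_into UNIV"

lemma automorphism_morphism: "field_automorphism \<sigma> \<Longrightarrow> ring_morphism \<sigma>"
  by (simp add: field_automorphism_def ring_morphism_def)

lemma automorphism_inj: "field_automorphism \<sigma> \<Longrightarrow> \<sigma> u = \<sigma> v \<longleftrightarrow> u = v"
  by (auto simp: field_automorphism_def bij_def inj_eq)

lemma automorphism_eq_0: "field_automorphism \<sigma> \<Longrightarrow> \<sigma> u = 0 \<longleftrightarrow> u = 0"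
  using automorphism_inj[of \<sigma> u 0] ring_morphism.hom_zero[OF automorphism_morphism] by metis

lemma automorphism_inverse:
  assumes "field_automorphism \<sigma>"
  shows "\<sigma> (inverse u) = inverse (\<sigma> u)"
proof -
  interpret ring_morphism \<sigma> by (rule automorphism_morphism[OF assms])
  show ?thesis
  proof (cases "u = 0")
    case False
    then have "\<sigma> u * \<sigma> (inverse u) = 1" by (simp add: hom_one flip: hom_mult)
    then show ?thesis by (rule inverse_unique[symmetric])
  qed (simp add: hom_zero)
qed

lemma automorphism_powi:
  assumes "field_automorphism \<sigma>"
  shows "\<sigma> (u powi n) = \<sigma> u powi n"
proof -
  interpret ring_morphism \<sigma> by (rule automorphism_morphism[OF assms])
  show ?thesis by (simp add: power_int_def hom_power automorphism_inverse[OF assms])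
qed

lemma automorphism_inv:
  assumes "field_automorphism \<sigma>"
  shows "field_automorphism (finv \<sigma>)"
proof -
  interpret ring_morphism \<sigma> by (rule automorphism_morphism[OF assms])
  have bij: "bij \<sigma>" using assms by (simp add: field_automorphism_def)
  have eqI: "finv \<sigma> u = v" if "\<sigma> v = u" for u v
    using bij that by (simp add: bij_def inv_f_eq)
  have s: "\<sigma> (finv \<sigma> u) = u" for u
    using bij by (simp add: bij_def surj_f_inv_f)
  show ?thesis
    unfolding field_automorphism_def
    by (auto intro!: eqI bij_imp_bij_inv bij simp: hom_one hom_add hom_mult s)
qed

text \<open>Closure under inverses upgrades the inclusion of a conjugated class in itself to an
  equality.\<close>

lemma Galois_lifts_inv:
  assumes "\<tau> \<in> Galois_lifts y"
  shows "finv \<tau> \<in> Galois_lifts y"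
proof -
  obtain \<sigma> where \<tau>: "field_automorphism \<tau>" "\<tau> coord_x = coord_x" "\<tau> y = y"
    and \<sigma>: "\<sigma> \<in> Galois_group" "\<And>c. \<tau> (const_emb c) = const_emb (\<sigma> c)"
    using assms by (auto simp: Galois_lifts_def)
  have \<sigma>': "field_automorphism \<sigma>" "\<And>c. \<sigma> (to_ac c) = to_ac c"
    using \<sigma>(1) by (auto simp: Galois_group_def)
  have inj: "inj \<tau>" "inj \<sigma>" and surj: "surj \<sigma>"
    using \<tau>(1) \<sigma>'(1) by (auto simp: field_automorphism_def bij_def)
  have "finv \<sigma> \<in> Galois_group"
    using \<sigma>' inj by (auto simp: Galois_group_def automorphism_inv intro!: inv_f_eq)
  moreover have "finv \<tau> (const_emb c) = const_emb (finv \<sigma> c)" for c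
    using inj surj by (auto intro!: inv_f_eq simp: \<sigma>(2) surj_f_inv_f)
  ultimately show ?thesis
    using \<tau> inj by (auto simp: Galois_lifts_def automorphism_inv intro!: inv_f_eq)
qed

context
  fixes \<tau> :: "'k::field ambient \<Rightarrow> 'k ambient" and y
  assumes \<tau>: "\<tau> \<in> Galois_lifts y"
begin

lemma lift_automorphism: "field_automorphism \<tau>"
  using \<tau> by (simp add: Galois_lifts_def)

interpretation t: ring_morphism \<tau>
  by (rule automorphism_morphism[OF lift_automorphism])

lemma lift_inv: "\<tau> (finv \<tau> h) = h" "finv \<tau> (\<tau> h) = h"
  using lift_automorphism by (auto simp: field_automorphism_def bij_def surj_f_inv_f)

lemma lift_image_eq_iff: "\<tau> ` R = \<tau> ` S \<longleftrightarrow> R = S"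
  using lift_automorphism by (auto simp: field_automorphism_def bij_def inj_image_eq_iff)

lemma lift_ff: "h \<in> function_field y \<Longrightarrow> \<tau> h \<in> function_field y"
proof (induction rule: ff_induct)
  case (const c)
  obtain \<sigma> where "\<And>c. \<tau> (const_emb c) = const_emb (\<sigma> c)"
    using \<tau> by (auto simp: Galois_lifts_def)
  then show ?case by (simp add: ff_const)
qed (use \<tau> in \<open>auto simp: Galois_lifts_def t.hom_add t.hom_mult ff_x ff_y ff_add ff_mult
      ff_inverse automorphism_inverse\<close>)

end

lemma lift_ff_image:
  assumes "\<tau> \<in> Galois_lifts y"
  shows "\<tau> ` function_field y = function_field y"
proof
  show "\<tau> ` function_field y \<subseteq> function_field y" using lift_ff[OF assms] by blast
  show "function_field y \<subseteq> \<tau> ` function_field y"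
    using lift_ff[OF Galois_lifts_inv[OF assms]] lift_inv(1)[OF assms] by (metis imageI subsetI)
qed

context
  fixes \<tau> :: "'k::field ambient \<Rightarrow> 'k ambient" and y
  assumes \<tau>: "\<tau> \<in> Galois_lifts y"
begin

interpretation t: ring_morphism \<tau>
  by (rule automorphism_morphism[OF lift_automorphism[OF \<tau>]])

lemma lift_in_image_iff: "\<tau> h \<in> \<tau> ` R \<longleftrightarrow> h \<in> R"
  using automorphism_inj[OF lift_automorphism[OF \<tau>]] by (auto simp: image_iff)

lemma lift_unit_iff: "\<tau> u \<in> ring_units (\<tau> ` R) \<longleftrightarrow> u \<in> ring_units R"
  unfolding ring_units_def
  by (simp add: lift_in_image_iff automorphism_eq_0[OF lift_automorphism[OF \<tau>]]
      flip: automorphism_inverse[OF lift_automorphism[OF \<tau>]])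

lemma lift_uniformizer:
  assumes s: "uniformizer (function_field y) R s"
  shows "uniformizer (function_field y) (\<tau> ` R) (\<tau> s)"
  unfolding uniformizer_def
proof (intro conjI ballI)
  note aut = lift_automorphism[OF \<tau>]
  show "\<tau> s \<in> \<tau> ` R" "\<tau> s \<noteq> 0" "inverse (\<tau> s) \<notin> \<tau> ` R"
    using s by (auto simp: uniformizer_def lift_in_image_iff automorphism_eq_0[OF aut]
        simp flip: automorphism_inverse[OF aut])
  fix g assume g: "g \<in> function_field y - {0}"
  then obtain h where h: "g = \<tau> h" "h \<in> function_field y" using lift_ff_image[OF \<tau>] by blast
  have "h \<noteq> 0" using g h automorphism_eq_0[OF aut] by blast
  then obtain n u where u: "u \<in> ring_units R" "h = s powi n * u"
    using s h(2) unfolding uniformizer_def by blast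
  have "g = \<tau> s powi n * \<tau> u"
    unfolding h(1) u(2) t.hom_mult automorphism_powi[OF aut] ..
  then show "\<exists>n. \<exists>u\<in>ring_units (\<tau> ` R). g = \<tau> s powi n * u"
    using u(1) lift_unit_iff by blast
qed

lemma lift_curve_point:
  assumes "R \<in> curve_points y"
  shows "\<tau> ` R \<in> curve_points y"
  unfolding curve_points_def
proof (intro CollectI conjI ballI)
  obtain \<sigma> where \<sigma>: "\<sigma> \<in> Galois_group" "\<And>c. \<tau> (const_emb c) = const_emb (\<sigma> c)"
    using \<tau> by (auto simp: Galois_lifts_def)
  then have "surj \<sigma>" by (auto simp: Galois_group_def field_automorphism_def bij_def)
  then have "const_emb c = \<tau> (const_emb (finv \<sigma> c))" for c
    by (simp add: \<sigma>(2) surj_f_inv_f)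
  then show "range const_emb \<subseteq> \<tau> ` R"
    using curve_pointsD(1)[OF assms] by blast
  show "\<tau> ` R \<subseteq> function_field y"
    using curve_pointsD(2)[OF assms] lift_ff[OF \<tau>] by blast
  show "\<exists>s. uniformizer (function_field y) (\<tau> ` R) s"
    using curve_pointsD(5)[OF assms] lift_uniformizer by blast
  fix g h assume "g \<in> \<tau> ` R" "h \<in> \<tau> ` R"
  then show "g - h \<in> \<tau> ` R" "g * h \<in> \<tau> ` R"
    using curve_pointsD(3,4)[OF assms] by (auto simp flip: t.hom_diff t.hom_mult)
qed

lemma lift_ord_at:
  assumes R: "R \<in> curve_points y" and g: "g \<in> function_field y" "g \<noteq> 0"
  shows "ord_at y (\<tau> ` R) (\<tau> g) = ord_at y R g"
proof -
  obtain s where s: "uniformizer (function_field y) R s"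
    using curve_pointsD(5)[OF R] by blast
  obtain n u where u: "u \<in> ring_units R" "g = s powi n * u"
    using s g unfolding uniformizer_def by blast
  have "\<tau> g = \<tau> s powi n * \<tau> u"
    unfolding u(2) t.hom_mult automorphism_powi[OF lift_automorphism[OF \<tau>]] ..
  then have "ord_at y (\<tau> ` R) (\<tau> g) = n"
    using u(1) lift_unit_iff
    by (intro ord_at_eqI[OF lift_curve_point[OF R] lift_uniformizer[OF s], of "\<tau> u"]) blast+
  then show ?thesis using ord_at_eqI[OF R s u] by simp
qed

lemma lookup_divisor_conj: "Poly_Mapping.lookup (divisor_conj \<tau> d) (\<tau> ` R) = Poly_Mapping.lookup d R"
proof -
  have "Poly_Mapping.lookup (divisor_conj \<tau> d) (\<tau> ` R) =
      (\<Sum>i\<in>Poly_Mapping.keys d. Poly_Mapping.lookup d i * (if \<tau> ` i = \<tau> ` R then 1 else 0))"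
    unfolding divisor_conj_def frag_extend_def lookup_sum
    by (intro sum.cong refl) (simp add: lookup_single when_def)
  also have "\<dots> = (\<Sum>i\<in>Poly_Mapping.keys d. if R = i then Poly_Mapping.lookup d i else 0)"
    by (intro sum.cong refl) (auto simp: lift_image_eq_iff[OF \<tau>])
  also have "\<dots> = Poly_Mapping.lookup d R"
    by (subst sum.delta') (auto simp: in_keys_iff)
  finally show ?thesis .
qed

lemma keys_divisor_conj: "Poly_Mapping.keys (divisor_conj \<tau> d) \<subseteq> (`) \<tau> ` Poly_Mapping.keys d"
  unfolding divisor_conj_def using keys_frag_extend[of "\<lambda>R. frag_of (\<tau> ` R)" d] by auto

lemma divisor_degree_conj: "divisor_degree (divisor_conj \<tau> d) = divisor_degree d"
  unfolding divisor_conj_def frag_extend_def divisor_degree_sum divisor_degree_frag_cmul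
    divisor_degree_frag_of by (simp add: divisor_degree_def)

end

lemma divisor_conj_Princ:
  assumes \<tau>: "\<tau> \<in> Galois_lifts y" and "d \<in> Princ y"
  shows "divisor_conj \<tau> d \<in> Princ y"
proof -
  obtain g where g: "d \<in> carrier (Div0 y)" "g \<in> function_field y" "g \<noteq> 0"
      "\<And>R. R \<in> curve_points y \<Longrightarrow> Poly_Mapping.lookup d R = ord_at y R g"
    using assms(2) by (rule PrincE) blast
  show ?thesis
  proof (rule PrincI)
    show "divisor_conj \<tau> d \<in> carrier (Div0 y)"
      using g(1) keys_divisor_conj[OF \<tau>, of d] lift_curve_point[OF \<tau>]
      unfolding carrier_Div0 divisor_degree_conj[OF \<tau>] by blast
    show "\<tau> g \<in> function_field y" using g lift_ff[OF \<tau>] by blast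
    show "\<tau> g \<noteq> 0" using g automorphism_eq_0[OF lift_automorphism[OF \<tau>]] by blast
  next
    fix R assume "R \<in> curve_points y"
    then have S: "finv \<tau> ` R \<in> curve_points y"
      by (rule lift_curve_point[OF Galois_lifts_inv[OF \<tau>]])
    have "\<tau> ` finv \<tau> ` R = R" by (simp add: image_image lift_inv[OF \<tau>])
    then show "Poly_Mapping.lookup (divisor_conj \<tau> d) R = ord_at y R (\<tau> g)"
      using lookup_divisor_conj[OF \<tau>, of d "finv \<tau> ` R"] lift_ord_at[OF \<tau> S g(2,3)] g(4)[OF S]
      by simp
  qed
qed

lemma divisor_conj_add: "divisor_conj \<tau> (c + d) = divisor_conj \<tau> c + divisor_conj \<tau> d"
  by (simp add: divisor_conj_def frag_extend_add)

lemma divisor_conj_inv: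
  assumes "\<tau> \<in> Galois_lifts y"
  shows "divisor_conj \<tau> (divisor_conj (finv \<tau>) d) = d"
proof -
  have "divisor_conj \<tau> (divisor_conj (finv \<tau>) d) =
      frag_extend ((\<lambda>R. frag_of (\<tau> ` R)) \<circ> (`) (finv \<tau>)) d"
    unfolding divisor_conj_def by (subst frag_extend_compose[symmetric]) (simp add: comp_def)
  also have "(\<lambda>R. frag_of (\<tau> ` R)) \<circ> (`) (finv \<tau>) = frag_of"
    by (simp add: fun_eq_iff image_image lift_inv[OF assms])
  finally show ?thesis by (simp flip: frag_expansion)
qed

text \<open>The class of \<open>d\<close> is the translate of \<open>Princ y\<close> by
  \<open>d\<close>. Conjugation preserves principal divisors and fixes \<open>d\<close>, hence it
  preserves the translate. The invariance is asked of the divisor itself, which is stronger than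
  invariance of its class.\<close>

lemma positive_rank_JacobianI:
  assumes d: "d \<in> carrier (Div0 y)"
    and inv: "\<And>\<tau>. \<tau> \<in> Galois_lifts y \<Longrightarrow> divisor_conj \<tau> d = d"
    and npr: "\<And>n. n > 0 \<Longrightarrow> frag_cmul (int n) d \<notin> Princ y"
  shows "positive_rank (Jacobian_points y)"
proof -
  let ?c = "Princ y #>\<^bsub>Div0 y\<^esub> d"
  have c: "?c = (\<lambda>u. u + d) ` Princ y"
    by (auto simp: r_coset_def mult_Div0)
  have sub: "divisor_conj \<tau> ` ?c \<subseteq> ?c" if "\<tau> \<in> Galois_lifts y" for \<tau>
    using divisor_conj_Princ[OF that] by (auto simp: c divisor_conj_add inv[OF that])
  have "divisor_conj \<tau> ` ?c = ?c" if \<tau>: "\<tau> \<in> Galois_lifts y" for \<tau>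
  proof (intro equalityI sub[OF \<tau>] subsetI)
    fix u assume "u \<in> ?c"
    then have "divisor_conj (finv \<tau>) u \<in> ?c" using sub[OF Galois_lifts_inv[OF \<tau>]] by blast
    then show "u \<in> divisor_conj \<tau> ` ?c" using divisor_conj_inv[OF \<tau>, of u] by (metis imageI)
  qed
  moreover have "?c \<in> carrier (Pic0 y)"
    using d by (auto simp: Pic0_def FactGroup_def RCOSETS_def)
  ultimately have "?c \<in> carrier (Jacobian_points y)"
    by (simp add: Jacobian_points_def)
  moreover have "?c [^]\<^bsub>Jacobian_points y\<^esub> n = ?c [^]\<^bsub>Pic0 y\<^esub> n" for n :: nat
    by (simp add: Jacobian_points_def nat_pow_def)
  moreover have "\<one>\<^bsub>Jacobian_points y\<^esub> = \<one>\<^bsub>Pic0 y\<^esub>"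
    by (simp add: Jacobian_points_def)
  ultimately show ?thesis
    unfolding positive_rank_def using Pic0_pow_neq_one[OF d npr] by (intro bexI[of _ ?c]) simp_all
qed

section \<open>Unramified points\<close>

lemma (in ring_morphism) fls_map_eval1:
  "fls_map f (eval1 fls_const z q) = eval1 fls_const (fls_map f z) (map_poly f q)"
proof -
  interpret M: ring_morphism "fls_map f" by (rule fls_map_morphism)
  show ?thesis
  proof (induction q)
    case (pCons c q)
    then show ?case
      by (simp add: fls_const.eval1_pCons M.hom_add M.hom_mult fls_map_const hom_zero map_poly_pCons)
  qed (simp add: fls_const.eval1_0 M.hom_zero)
qed

lemma fls_map_X: "d 0 = 0 \<Longrightarrow> d 1 = 1 \<Longrightarrow> fls_map d fls_X = fls_X"
  by (intro fls_eqI) (simp add: fls_map_nth)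

context superelliptic
begin

definition unramified_root_at :: "'k alg_closure \<Rightarrow> 'k alg_closure fls \<Rightarrow> bool" where
  "unramified_root_at \<gamma> w \<longleftrightarrow> poly F0 \<gamma> \<noteq> 0 \<and> w ^ p = eval1 fls_const (shift \<gamma>) F0"

lemma unramified_root_atD:
  assumes "unramified_root_at \<gamma> w"
  shows "place (shift \<gamma>) w" "fls_ge 0 w" "(w $$ 0) ^ p = poly F0 \<gamma>" "w $$ 0 \<noteq> 0"
proof -
  have w: "poly F0 \<gamma> \<noteq> 0" "w ^ p = eval1 fls_const (shift \<gamma>) F0"
    using assms by (auto simp: unramified_root_at_def)
  then show "place (shift \<gamma>) w" by (intro place_shift)
  have "fls_subdegree (w ^ p) = 0"
    using eval1_shift_subdegree(2)[OF F0_nonzero, of 1 \<gamma>] w by (simp add: order_0I)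
  then have "int p * fls_subdegree w = 0" by (simp add: fls_subdegree_pow)
  then show ge: "fls_ge 0 w" using p_gt_0 by (simp add: fls_ge_0_iff)
  show "(w $$ 0) ^ p = poly F0 \<gamma>"
    using fls_ge_power(2)[OF ge, of p] eval1_nth_0[OF shift_ge, of \<gamma> F0] by (simp add: w(2))
  then show "w $$ 0 \<noteq> 0" using w(1) p_gt_0 by (auto simp: power_0_left)
qed

lemma unramified_root_at_unique:
  assumes "unramified_root_at \<gamma> v" "unramified_root_at \<gamma> w" "v $$ 0 = w $$ 0"
  shows "v = w"
  using fls_root_unique[of v p w] unramified_root_atD[OF assms(1)] unramified_root_atD[OF assms(2)]
    assms p_gt_0 by (simp add: unramified_root_at_def)

text \<open>The preimage of the ring of power series, that is, the valuation ring of the point over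
  \<open>\<gamma>\<close> whose y-coordinate is \<open>w $$ 0\<close>. It is meant for
  \<open>unramified_root_at \<gamma> w\<close>, where \<open>x - \<gamma>\<close> is a local
  parameter.\<close>

definition point :: "'k alg_closure \<Rightarrow> 'k alg_closure fls \<Rightarrow> 'k ambient set" where
  "point \<gamma> w = {h \<in> FF. fls_ge 0 (emb (shift \<gamma>) w h)}"

lemma y_not_const: "y \<noteq> const_emb c"
proof
  assume y: "y = const_emb c"
  obtain yh where yh: "place (fls_X_inv ^ p) yh" "fls_subdegree yh = - int (m + 1)"
    by (rule place_infinity)
  then have "yh = fls_const c"
    using emb_y[OF yh(1)] emb_const[OF yh(1), of c] y by simp
  then show False using yh(2) by simp
qed

context
  fixes \<gamma> w
  assumes w: "unramified_root_at \<gamma> w"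
begin

abbreviation (input) "E \<equiv> emb (shift \<gamma>) w"

lemma pl: "place (shift \<gamma>) w" by (rule unramified_root_atD[OF w])

lemma emb_local_parameter: "E (coord_x - const_emb \<gamma>) = fls_X"
  by (simp add: emb_diff[OF pl] ff_x ff_const emb_x[OF pl] emb_const[OF pl])

lemma point_unit_iff: "u \<in> ring_units (point \<gamma> w) \<longleftrightarrow> u \<in> FF \<and> u \<noteq> 0 \<and> fls_subdegree (E u) = 0"
proof -
  have "fls_ge 0 (E u) \<and> fls_ge 0 (E (inverse u)) \<longleftrightarrow> fls_subdegree (E u) = 0"
    if "u \<in> FF" "u \<noteq> 0"
    using that by (auto simp: emb_inverse[OF pl] fls_ge_0_iff)
  then show ?thesis
    unfolding ring_units_def point_def by (auto simp: ff_inverse)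
qed

lemma local_parameter_uniformizer:
  "uniformizer FF (point \<gamma> w) (coord_x - const_emb \<gamma>)" (is "uniformizer _ _ ?s")
  and unit_decomposition: "g \<in> FF \<Longrightarrow> g \<noteq> 0 \<Longrightarrow>
    \<exists>u\<in>ring_units (point \<gamma> w). g = (coord_x - const_emb \<gamma>) powi fls_subdegree (E g) * u"
proof -
  have s: "?s \<in> FF" by (simp add: ff_diff ff_x ff_const)
  have s0: "?s \<noteq> 0" using emb_local_parameter emb_0[OF pl] by force
  show dec: "\<exists>u\<in>ring_units (point \<gamma> w). g = ?s powi fls_subdegree (E g) * u"
    if g: "g \<in> FF" "g \<noteq> 0" for g
  proof
    let ?n = "fls_subdegree (E g)"
    let ?u = "g / ?s powi ?n"
    show "g = ?s powi ?n * ?u" using s0 by simp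
    have "E g \<noteq> 0" using g emb_eq_0_iff[OF pl] by simp
    then have "fls_subdegree (E ?u) = 0"
      using s g by (simp add: emb_divide[OF pl] ff_powi emb_powi[OF pl] emb_local_parameter
          fls_divide_subdegree)
    then show "?u \<in> ring_units (point \<gamma> w)"
      using g s s0 by (simp add: point_unit_iff ff_divide ff_powi)
  qed
  have "\<not> fls_ge 0 (E (inverse ?s))"
    using s by (simp add: emb_inverse[OF pl] emb_local_parameter fls_ge_0_iff)
  then show "uniformizer FF (point \<gamma> w) ?s"
    unfolding uniformizer_def using s s0 dec
    by (auto simp: point_def emb_local_parameter fls_ge_0_iff)
qed

lemma point_in_curve_points: "point \<gamma> w \<in> curve_points y"
  unfolding curve_points_def
proof (intro CollectI conjI ballI)
  show "range const_emb \<subseteq> point \<gamma> w"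
    by (auto simp: point_def ff_const emb_const[OF pl])
  show "point \<gamma> w \<subseteq> FF" by (auto simp: point_def)
  show "\<exists>s. uniformizer FF (point \<gamma> w) s" using local_parameter_uniformizer by blast
  fix g h assume gh: "g \<in> point \<gamma> w" "h \<in> point \<gamma> w"
  then show "g - h \<in> point \<gamma> w"
    by (simp add: point_def ff_diff emb_diff[OF pl] fls_ge_def)
  show "g * h \<in> point \<gamma> w"
    using gh fls_ge_mult[of 0 "E g" 0 "E h"] by (simp add: point_def ff_mult emb_mult[OF pl])
qed

lemma ord_at_point:
  assumes "g \<in> FF" "g \<noteq> 0"
  shows "ord_at y (point \<gamma> w) g = fls_subdegree (E g)"
  using unit_decomposition[OF assms] ord_at_eqI[OF point_in_curve_points local_parameter_uniformizer]
  by blast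

end

text \<open>Vanishing of \<open>x - \<gamma>\<close> and of \<open>y\<close> minus its value
  identifies the coordinates, and the coordinates determine the expansion. Coefficients of different
  points thus do not merge in the divisor built from them.\<close>

lemma point_inj:
  assumes v: "unramified_root_at \<gamma> v" and w: "unramified_root_at \<delta> w"
    and eq: "point \<gamma> v = point \<delta> w"
  shows "\<gamma> = \<delta> \<and> v = w"
proof -
  note pv = unramified_root_atD(1)[OF v] and pw = unramified_root_atD(1)[OF w]
  have ords: "fls_subdegree (emb (shift \<gamma>) v g) = fls_subdegree (emb (shift \<delta>) w g)"
    if "g \<in> FF" "g \<noteq> 0" for g
    using ord_at_point[OF v that] ord_at_point[OF w that] eq by simp
  let ?s = "coord_x - const_emb \<gamma>"
  have s: "?s \<in> FF" "?s \<noteq> 0"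
    using emb_local_parameter[OF v] emb_0[OF pv] by (force simp: ff_diff ff_x ff_const)+
  have "fls_subdegree (emb (shift \<delta>) w ?s) = 1"
    using ords[OF s] emb_local_parameter[OF v] by simp
  then have "emb (shift \<delta>) w ?s $$ 0 = 0" by simp
  then have \<gamma>\<delta>: "\<gamma> = \<delta>"
    by (simp add: emb_diff[OF pw] ff_x ff_const emb_x[OF pw] emb_const[OF pw])
  let ?c = "v $$ 0"
  have t: "y - const_emb ?c \<in> FF" "y - const_emb ?c \<noteq> 0"
    using y_not_const by (simp_all add: ff_diff ff_y ff_const)
  have ev: "emb (shift \<gamma>) v (y - const_emb ?c) = v - fls_const ?c"
    and ew: "emb (shift \<delta>) w (y - const_emb ?c) = w - fls_const ?c"
    by (simp_all add: emb_diff[OF pv] emb_diff[OF pw] ff_y ff_const emb_y[OF pv] emb_y[OF pw]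
        emb_const[OF pv] emb_const[OF pw])
  have "fls_ge 1 (v - fls_const ?c)"
    unfolding fls_ge_def using unramified_root_atD(2)[OF v] by (auto simp: fls_ge_def)
  moreover have "v - fls_const ?c \<noteq> 0" using emb_eq_0_iff[OF pv t(1)] t(2) ev by simp
  ultimately have "fls_subdegree (w - fls_const ?c) \<ge> 1"
    using ords[OF t] unfolding ev ew by (simp add: fls_ge_iff)
  then have "(w - fls_const ?c) $$ 0 = 0" by (intro fls_eq0_below_subdegree) simp
  then show ?thesis
    using unramified_root_at_unique[of \<gamma> v w] v w \<gamma>\<delta> by simp
qed

text \<open>As \<open>\<sigma>\<close> fixes \<open>\<gamma>\<close>, its action on coefficients
  fixes the expansion of \<open>x\<close>; both sides then agree on constants, \<open>x\<close> and
  \<open>y\<close>.\<close>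

lemma emb_Galois:
  assumes \<tau>: "\<tau> \<in> Galois_lifts y" and \<sigma>: "field_automorphism \<sigma>"
    and lift: "\<And>c. \<tau> (const_emb c) = const_emb (\<sigma> c)"
    and w: "place (shift \<gamma>) w" and w': "place (shift \<gamma>) (fls_map \<sigma> w)" and "\<sigma> \<gamma> = \<gamma>"
    and "h \<in> FF"
  shows "emb (shift \<gamma>) (fls_map \<sigma> w) (\<tau> h) = fls_map \<sigma> (emb (shift \<gamma>) w h)"
  using \<open>h \<in> FF\<close>
proof (induction rule: ff_induct)
  interpret s: ring_morphism \<sigma> by (rule automorphism_morphism[OF \<sigma>])
  interpret M: ring_morphism "fls_map \<sigma>" by (rule s.fls_map_morphism)
  interpret t: ring_morphism \<tau> by (rule automorphism_morphism[OF lift_automorphism[OF \<tau>]])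
  note ff = lift_ff[OF \<tau>]
  {
    case (const c)
    show ?case
      by (simp add: lift emb_const[OF w] emb_const[OF w'] fls_map_const s.hom_zero)
  next
    case x
    have "fls_map \<sigma> (shift \<gamma>) = shift \<gamma>"
      by (simp add: M.hom_add fls_map_const fls_map_X s.hom_zero s.hom_one \<open>\<sigma> \<gamma> = \<gamma>\<close>)
    then show ?case
      using \<tau> by (simp add: Galois_lifts_def emb_x[OF w] emb_x[OF w'])
  next
    case y
    show ?case using \<tau> by (simp add: Galois_lifts_def emb_y[OF w] emb_y[OF w'])
  next
    case (add g h)
    then show ?case by (simp add: t.hom_add M.hom_add ff emb_add[OF w] emb_add[OF w'])
  next
    case (mult g h)
    then show ?case by (simp add: t.hom_mult M.hom_mult ff emb_mult[OF w] emb_mult[OF w'])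
  next
    case (inverse g)
    have "emb (shift \<gamma>) w g \<noteq> 0" using inverse emb_eq_0_iff[OF w] by simp
    then have "fls_map \<sigma> (emb (shift \<gamma>) w g) * fls_map \<sigma> (inverse (emb (shift \<gamma>) w g)) = 1"
      by (simp add: M.hom_one flip: M.hom_mult)
    then have "inverse (fls_map \<sigma> (emb (shift \<gamma>) w g)) = fls_map \<sigma> (inverse (emb (shift \<gamma>) w g))"
      by (rule inverse_unique)
    then show ?case
      using inverse by (simp add: automorphism_inverse[OF lift_automorphism[OF \<tau>]] ff
          emb_inverse[OF w] emb_inverse[OF w'])
  }
qed

lemma map_poly_F0:
  assumes "ring_morphism \<sigma>" "\<sigma> e = e" "\<sigma> a = a"
  shows "map_poly \<sigma> F0 = F0"
proof -
  interpret s: ring_morphism \<sigma> by fact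
  interpret M: ring_morphism "map_poly \<sigma>" by (rule s.map_poly_morphism)
  have eq: "F0 = [:e:] * (monom 1 m * [:a, 1:])" by (simp add: F0_def)
  show ?thesis
    unfolding eq M.hom_mult
    by (simp only: map_poly_pCons[of \<sigma>, OF s.hom_zero] map_poly_0 map_poly_monom[of \<sigma>, OF s.hom_zero]
        assms s.hom_one)
qed

text \<open>Galois acts on the points over a fixed x-coordinate through the coefficients of the
  expansion of \<open>y\<close>.\<close>

lemma point_Galois:
  assumes \<tau>: "\<tau> \<in> Galois_lifts y" and \<sigma>: "field_automorphism \<sigma>"
    and lift: "\<And>c. \<tau> (const_emb c) = const_emb (\<sigma> c)"
    and w: "unramified_root_at \<gamma> w" and fixed: "\<sigma> \<gamma> = \<gamma>" "\<sigma> e = e" "\<sigma> a = a"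
  shows "unramified_root_at \<gamma> (fls_map \<sigma> w)" and "\<tau> ` point \<gamma> w = point \<gamma> (fls_map \<sigma> w)"
proof -
  interpret s: ring_morphism \<sigma> by (rule automorphism_morphism[OF \<sigma>])
  interpret M: ring_morphism "fls_map \<sigma>" by (rule s.fls_map_morphism)
  have "fls_map \<sigma> (shift \<gamma>) = shift \<gamma>"
    by (simp add: M.hom_add fls_map_const fls_map_X s.hom_zero s.hom_one fixed)
  then have "fls_map \<sigma> w ^ p = eval1 fls_const (shift \<gamma>) F0"
    using w s.fls_map_eval1[of "shift \<gamma>" F0] map_poly_F0[OF s.ring_morphism_axioms fixed(2,3)]
    by (simp add: unramified_root_at_def flip: M.hom_power)
  then show w': "unramified_root_at \<gamma> (fls_map \<sigma> w)"
    using w by (simp add: unramified_root_at_def)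
  have ge: "fls_ge 0 (fls_map \<sigma> z) \<longleftrightarrow> fls_ge 0 z" for z
    by (simp add: fls_ge_def fls_map_nth s.hom_zero automorphism_eq_0[OF \<sigma>])
  have iff: "\<tau> h \<in> point \<gamma> (fls_map \<sigma> w) \<longleftrightarrow> h \<in> point \<gamma> w" if "h \<in> FF" for h
    using emb_Galois[OF \<tau> \<sigma> lift unramified_root_atD(1)[OF w] unramified_root_atD(1)[OF w'] fixed(1) that]
    by (simp add: point_def ge that lift_ff[OF \<tau>])
  have sub: "point \<gamma> v \<subseteq> FF" for v by (auto simp: point_def)
  show "\<tau> ` point \<gamma> w = point \<gamma> (fls_map \<sigma> w)"
  proof (intro equalityI subsetI)
    fix k assume "k \<in> \<tau> ` point \<gamma> w"
    then obtain h where "k = \<tau> h" "h \<in> point \<gamma> w" by blast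
    then show "k \<in> point \<gamma> (fls_map \<sigma> w)" using iff[of h] sub by blast
  next
    fix k assume k: "k \<in> point \<gamma> (fls_map \<sigma> w)"
    then have "k \<in> \<tau> ` FF" using sub lift_ff_image[OF \<tau>] by blast
    then obtain h where "k = \<tau> h" "h \<in> FF" by blast
    then show "k \<in> \<tau> ` point \<gamma> w" using iff[of h] k by blast
  qed
qed

end

section \<open>Points with transcendental coordinates\<close>

lemma of_int_morphism: "ring_morphism (of_int :: int \<Rightarrow> 'a::comm_ring_1)"
  by standard simp_all

text \<open>Transcendence makes the formal derivative on the ring generated by
  \<open>\<alpha>\<close> well defined; \<open>derivation_extend\<close> does the rest.\<close>

lemma derivation_at_transcendental:
  fixes \<alpha> :: "'a::field_char_0"
  assumes "\<And>q :: int poly. eval1 of_int \<alpha> q = 0 \<Longrightarrow> q = 0"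
  shows "\<exists>d. derivation d \<and> d \<alpha> = 1"
proof -
  interpret i: ring_morphism "of_int :: int \<Rightarrow> 'a" by (rule of_int_morphism)
  interpret ev: ring_morphism "eval1 of_int \<alpha>" by (rule i.eval1_morphism)
  define S where "S = {(eval1 of_int \<alpha> q, eval1 of_int \<alpha> (pderiv q)) |q. True}"
  have S: "(eval1 of_int \<alpha> q, eval1 of_int \<alpha> (pderiv q)) \<in> S" for q
    by (auto simp: S_def)
  have "derivation_graph S"
    unfolding derivation_graph_def
  proof (intro conjI allI impI)
    show "(1, 0) \<in> S" using S[of 1] by (simp add: ev.hom_one ev.hom_zero)
    show "c = 0" if c: "(0, c) \<in> S" for c
    proof -
      obtain q where q: "eval1 of_int \<alpha> q = 0" "c = eval1 of_int \<alpha> (pderiv q)"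
        using c by (auto simp: S_def)
      from q(2) assms[OF q(1)] show ?thesis by (simp add: ev.hom_zero)
    qed
  next
    fix a a' b b' assume "(a, a') \<in> S" "(b, b') \<in> S"
    then obtain q r where "a = eval1 of_int \<alpha> q" "a' = eval1 of_int \<alpha> (pderiv q)"
      "b = eval1 of_int \<alpha> r" "b' = eval1 of_int \<alpha> (pderiv r)" by (auto simp: S_def)
    then show "(a - b, a' - b') \<in> S" "(a * b, a * b' + a' * b) \<in> S"
      using S[of "q - r"] S[of "q * r"]
      by (simp_all add: pderiv_diff pderiv_mult ev.hom_diff ev.hom_mult ev.hom_add mult.commute)
  qed
  then obtain d where d: "derivation d" "\<forall>(a, b)\<in>S. d a = b"
    using derivation_extend by blast
  have "(\<alpha>, 1) \<in> S"
    using S[of "[:0, 1:]"] by (simp add: i.eval1_X i.eval1_const pderiv_pCons)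
  from bspec[OF d(2) this] d(1) show ?thesis by auto
qed

text \<open>Differentiation of coefficients is well defined on K[x] because \<open>x\<close> is
  transcendental over K, and it extends from there.\<close>

lemma derivation_extend_to_ambient:
  fixes dK :: "'k::field_char_0 alg_closure \<Rightarrow> 'k alg_closure"
  assumes "derivation dK"
  shows "\<exists>d. derivation d \<and> (\<forall>c. d (const_emb c) = const_emb (dK c)) \<and> d coord_x = 0"
proof -
  interpret dK: derivation dK by fact
  define S where "S = {(eval_x q, eval_x (map_poly dK q)) |q. True}"
  have S: "(eval_x q, eval_x (map_poly dK q)) \<in> S" for q
    by (auto simp: S_def)
  have "derivation_graph S"
    unfolding derivation_graph_def
  proof (intro conjI allI impI)
    have "map_poly dK 1 = 0" by (intro poly_eqI) (simp add: coeff_map_poly dK.d_zero dK.d_one)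
    then show "(1, 0) \<in> S" using S[of 1] by (simp add: eval_x.hom_one eval_x.hom_zero)
    show "c = 0" if "(0, c) \<in> S" for c
      using that by (auto simp: S_def eval_x_eq_0_iff)
  next
    fix a a' b b' assume "(a, a') \<in> S" "(b, b') \<in> S"
    then obtain q r where *: "a = eval_x q" "a' = eval_x (map_poly dK q)"
      "b = eval_x r" "b' = eval_x (map_poly dK r)" by (auto simp: S_def)
    have "map_poly dK (q - r) = map_poly dK q - map_poly dK r"
      using dK.d_add[of _ "- _"]
      by (intro poly_eqI) (simp add: coeff_map_poly dK.d_zero dK.d_minus)
    then show "(a - b, a' - b') \<in> S"
      using S[of "q - r"] * by (simp add: eval_x.hom_diff)
    have "map_poly dK (q * r) = q * map_poly dK r + map_poly dK q * r"
      by (intro poly_eqI)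
        (simp add: coeff_map_poly dK.d_zero coeff_mult dK.d_sum dK.d_mult sum.distrib)
    then show "(a * b, a * b' + a' * b) \<in> S"
      using S[of "q * r"] * by (simp add: eval_x.hom_add eval_x.hom_mult)
  qed
  then obtain d where d: "derivation d" "\<forall>(a, b)\<in>S. d a = b"
    using derivation_extend by blast
  have "(const_emb c, const_emb (dK c)) \<in> S" for c
    using S[of "[:c:]"] by (simp add: map_poly_pCons dK.d_zero const_emb.eval1_const)
  moreover have "(coord_x, 0) \<in> S"
    using S[of "[:0, 1:]"]
    by (simp add: map_poly_pCons dK.d_zero dK.d_one const_emb.eval1_X eval_x.hom_zero)
  moreover have "d a = b" if "(a, b) \<in> S" for a b
    using bspec[OF d(2) that] by simp
  ultimately show ?thesis using d(1) by blast
qed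

section \<open>A divisor class of infinite order\<close>

context superelliptic
begin

lemma positive_rank_Jacobian_points:
  fixes \<alpha> \<beta> :: 'k
  assumes e_rat: "e \<in> range to_ac" and a_int: "a \<in> range of_int"
    and \<beta>: "to_ac \<beta> ^ p = poly F0 (to_ac \<alpha>)" "\<beta> \<noteq> 0"
    and transc: "\<And>q :: int poly. eval1 of_int \<alpha> q = 0 \<Longrightarrow> q = 0"
  shows "positive_rank (Jacobian_points y)"
proof -
  let ?\<alpha> = "to_ac \<alpha>" and ?\<beta> = "to_ac \<beta>"
  have F\<alpha>: "poly F0 ?\<alpha> \<noteq> 0" using \<beta> by (metis power_not_zero to_ac_eq_0_iff)

  define B where "B = {b. b ^ p = poly F0 ?\<alpha>}"
  have \<beta>B: "?\<beta> \<in> B" using \<beta> by (simp add: B_def)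
  have finB: "finite B"
  proof -
    have "B = {b. poly (monom 1 p - [:poly F0 ?\<alpha>:]) b = 0}"
      by (simp add: B_def poly_monom)
    moreover have "degree (monom 1 p - [:poly F0 ?\<alpha>:]) = p"
      unfolding diff_conv_add_uminus using p_gt_0
      by (subst degree_add_eq_left) (simp_all add: degree_monom_eq)
    then have "monom 1 p - [:poly F0 ?\<alpha>:] \<noteq> 0" using p_gt_0 by force
    ultimately show ?thesis using poly_roots_finite by metis
  qed
  have "\<exists>w. unramified_root_at ?\<alpha> w \<and> w $$ 0 = b" if "b \<in> B" for b
    using unramified_root[OF F\<alpha>, of b] that F\<alpha> unfolding B_def unramified_root_at_def by blast
  then obtain W where W: "unramified_root_at ?\<alpha> (W b)" "W b $$ 0 = b" if "b \<in> B" for b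
    by metis
  define P where "P = (\<lambda>b. point ?\<alpha> (W b))"
  \<comment> \<open>The fibre is the Galois-stable divisor through P that brings the degree to
    0.\<close>
  define d0 where "d0 = frag_cmul (int (card B)) (frag_of (P ?\<beta>)) - (\<Sum>b\<in>B. frag_of (P b))"

  have "d0 \<in> carrier (Div0 y)"
    unfolding carrier_Div0
  proof
    have "Poly_Mapping.lookup d0 Q = 0" if "Q \<notin> curve_points y" for Q
    proof -
      have "Q \<noteq> P b" if "b \<in> B" for b
        using point_in_curve_points[OF W(1)[OF that]] \<open>Q \<notin> curve_points y\<close> by (auto simp: P_def)
      then show ?thesis
        using \<beta>B by (simp add: d0_def lookup_minus lookup_sum lookup_single when_def)
    qed
    then show "Poly_Mapping.keys d0 \<subseteq> curve_points y" by (auto simp: in_keys_iff)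
    show "divisor_degree d0 = 0"
      by (simp add: d0_def divisor_degree_diff divisor_degree_frag_cmul divisor_degree_sum
          divisor_degree_frag_of)
  qed
  moreover have "divisor_conj \<tau> d0 = d0" if \<tau>: "\<tau> \<in> Galois_lifts y" for \<tau>
  proof -
    obtain \<sigma> where \<sigma>: "\<sigma> \<in> Galois_group" and lift: "\<And>c. \<tau> (const_emb c) = const_emb (\<sigma> c)"
      using \<tau> by (auto simp: Galois_lifts_def)
    have aut: "field_automorphism \<sigma>" and fixed: "\<And>c. \<sigma> (to_ac c) = to_ac c"
      using \<sigma> by (auto simp: Galois_group_def)
    interpret s: ring_morphism \<sigma> by (rule automorphism_morphism[OF aut])
    have ea: "\<sigma> e = e" "\<sigma> a = a"
      using e_rat a_int fixed by (auto simp: s.hom_of_int)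
    have "poly F0 ?\<alpha> = to_ac (\<beta> ^ p)" using \<beta> by simp
    then have \<sigma>F: "\<sigma> (poly F0 ?\<alpha>) = poly F0 ?\<alpha>" using fixed by metis
    have \<sigma>B: "\<sigma> b \<in> B" if "b \<in> B" for b
      using that \<sigma>F s.hom_power[of b p] by (simp add: B_def)
    have \<tau>P: "\<tau> ` P b = P (\<sigma> b)" if b: "b \<in> B" for b
    proof -
      note g = point_Galois[OF \<tau> aut lift W(1)[OF b] fixed ea]
      \<comment> \<open>Both are roots of the same series with constant term
        \<open>\<sigma> b\<close>.\<close>
      have "fls_map \<sigma> (W b) = W (\<sigma> b)"
        using unramified_root_at_unique[OF g(1) W(1)[OF \<sigma>B[OF b]]] W(2)[OF b] W(2)[OF \<sigma>B[OF b]]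
        by (simp add: fls_map_nth s.hom_zero)
      then show ?thesis using g(2) by (simp add: P_def)
    qed
    have "inj_on \<sigma> B" using automorphism_inj[OF aut] by (auto simp: inj_on_def)
    moreover have "\<sigma> ` B = B"
      using \<sigma>B calculation finB by (intro endo_inj_surj) auto
    ultimately have bij: "bij_betw \<sigma> B B" by (simp add: bij_betw_def)
    have "divisor_conj \<tau> (\<Sum>b\<in>B. frag_of (P b)) = (\<Sum>b\<in>B. frag_of (P (\<sigma> b)))"
      unfolding divisor_conj_def
      using finB \<tau>P by (simp add: frag_extend_sum)
    also have "\<dots> = (\<Sum>b\<in>B. frag_of (P b))"
      by (rule sum.reindex_bij_betw[OF bij])
    finally have "divisor_conj \<tau> (\<Sum>b\<in>B. frag_of (P b)) = (\<Sum>b\<in>B. frag_of (P b))" .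
    moreover have "divisor_conj \<tau> (frag_cmul (int (card B)) (frag_of (P ?\<beta>))) =
        frag_cmul (int (card B)) (frag_of (P ?\<beta>))"
      unfolding divisor_conj_def using \<tau>P[OF \<beta>B] fixed by (simp add: frag_extend_cmul)
    ultimately show ?thesis
      unfolding d0_def by (simp only: divisor_conj_def frag_extend_diff)
  qed
  moreover have "frag_cmul (int n) d0 \<notin> Princ y" if n: "n > 0" for n
  proof
    assume "frag_cmul (int n) d0 \<in> Princ y"
    then obtain g where g: "g \<in> FF" "g \<noteq> 0"
      "\<And>R. R \<in> curve_points y \<Longrightarrow> Poly_Mapping.lookup (frag_cmul (int n) d0) R = ord_at y R g"
      by (rule PrincE) blast
    \<comment> \<open>Transcendence is given in \<open>'k\<close>, but the derivation has to live on
      its algebraic closure.\<close>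
    have "eval1 of_int ?\<alpha> q = to_ac (eval1 of_int \<alpha> q)" for q :: "int poly"
    proof -
      interpret i: ring_morphism "of_int :: int \<Rightarrow> 'k" by (rule of_int_morphism)
      interpret j: ring_morphism "of_int :: int \<Rightarrow> 'k alg_closure" by (rule of_int_morphism)
      show ?thesis
        by (induction q) (simp_all add: i.eval1_0 j.eval1_0 i.eval1_pCons j.eval1_pCons)
    qed
    then obtain dK where dK: "derivation dK" "dK ?\<alpha> = 1"
      using derivation_at_transcendental[of ?\<alpha>] transc by auto
    then obtain d where d: "derivation d" "\<And>c. d (const_emb c) = const_emb (dK c)" "d coord_x = 0"
      using derivation_extend_to_ambient by blast
    have dKa: "dK a = 0" using a_int derivation.d_of_int[OF dK(1)] by auto
    have "card B > 0" using \<beta>B finB by (auto simp: card_gt_0_iff)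
    show False
    proof (rule no_function_with_divisor[OF d(1) dK(1) d(2,3) dKa])
      show "dK ?\<alpha> \<noteq> 0" using dK by simp
      show "?\<beta> ^ p = poly F0 ?\<alpha>" by (fact \<beta>)
      fix \<gamma> w assume "poly F0 \<gamma> \<noteq> 0" "w ^ p = eval1 fls_const (shift \<gamma>) F0"
      then have w: "unramified_root_at \<gamma> w" by (simp add: unramified_root_at_def)
      have P_eq: "P b = point \<gamma> w \<longleftrightarrow> \<gamma> = ?\<alpha> \<and> b = w $$ 0" if b: "b \<in> B" for b
      proof
        assume "P b = point \<gamma> w"
        then have "?\<alpha> = \<gamma> \<and> W b = w"
          unfolding P_def by (rule point_inj[OF W(1)[OF b] w])
        then show "\<gamma> = ?\<alpha> \<and> b = w $$ 0" using W(2)[OF b] by auto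
      next
        assume eq: "\<gamma> = ?\<alpha> \<and> b = w $$ 0"
        then have "W b = w"
          using unramified_root_at_unique[of ?\<alpha> "W b" w] W[OF b] w by simp
        then show "P b = point \<gamma> w" using eq by (simp add: P_def)
      qed
      have "w $$ 0 \<in> B" if "\<gamma> = ?\<alpha>"
        using unramified_root_atD(3)[OF w] that by (simp add: B_def)
      then have "(\<Sum>b\<in>B. if P b = point \<gamma> w then 1 else 0 :: int) = (if \<gamma> = ?\<alpha> then 1 else 0)"
        using finB by (simp add: P_eq cong: sum.cong)
      moreover have "Poly_Mapping.lookup d0 (point \<gamma> w) =
          int (card B) * (if P ?\<beta> = point \<gamma> w then 1 else 0) -
          (\<Sum>b\<in>B. if P b = point \<gamma> w then 1 else 0)"
        by (simp add: d0_def lookup_minus lookup_sum lookup_single when_def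
            eq_commute[of "point \<gamma> w"])
      ultimately have "Poly_Mapping.lookup d0 (point \<gamma> w) =
          (if \<gamma> = ?\<alpha> then (if w $$ 0 = ?\<beta> then int (card B) else 0) - 1 else 0)"
        unfolding P_eq[OF \<beta>B] by (cases "\<gamma> = ?\<alpha>"; cases "w $$ 0 = ?\<beta>") simp_all
      moreover have "fls_subdegree (emb (shift \<gamma>) w g) =
          int n * Poly_Mapping.lookup d0 (point \<gamma> w)"
        using g(3)[OF point_in_curve_points[OF w]] ord_at_point[OF w g(1,2)] by simp
      ultimately show "fls_subdegree (emb (shift \<gamma>) w g) =
          (if \<gamma> = ?\<alpha> then int n * ((if w $$ 0 = ?\<beta> then int (card B) else 0) - 1) else 0)"
        by (simp only: if_distrib[of "(*) (int n)"] mult_zero_right)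
    qed fact+
  qed
  ultimately show ?thesis by (rule positive_rank_JacobianI)
qed

end

text \<open>Dividing by \<open>D\<close> puts the twist into the form of the locale with
  \<open>e = inverse D\<close>, and \<open>(\<alpha>, \<beta>)\<close> becomes a rational point of
  it.\<close>

theorem positive_rank_superelliptic_Jacobian:
  fixes D \<alpha> \<beta> :: "'k::field_char_0" and a :: int
  assumes "prime p" "0 < m" "m + 1 < p" "a \<noteq> 0"
    and D: "D \<noteq> 0" "D * \<beta> ^ p = \<alpha> ^ m * (\<alpha> + of_int a)"
    and \<beta>: "\<beta> \<noteq> 0"
    and transc: "\<And>q :: int poly. eval1 of_int \<alpha> q = 0 \<Longrightarrow> q = 0"
  shows "positive_rank (superelliptic_Jacobian D p (monom 1 m * [:of_int a, 1:]))"
proof -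
  let ?f = "monom 1 m * [:of_int a, 1:] :: 'k poly"
  define y where "y = coord_y D p ?f"
  define e :: "'k alg_closure" where "e = to_ac (inverse D)"
  interpret b: ring_morphism "base_emb :: 'k \<Rightarrow> _"
    by standard (simp_all add: base_emb_def const_emb.hom_one const_emb.hom_add const_emb.hom_mult)
  interpret ev: ring_morphism "eval1 (base_emb :: 'k \<Rightarrow> _) coord_x"
    by (rule b.eval1_morphism)
  have monom: "monom 1 m = ([:0, 1:] :: 'c::comm_ring_1 poly) ^ m"
    by (simp add: monom_altdef)
  have p0: "p > 0" using assms by simp
  have f: "eval1 base_emb coord_x ?f = coord_x ^ m * (of_int a + coord_x)"
    unfolding monom ev.hom_mult ev.hom_power b.eval1_X
    by (simp add: b.eval1_pCons b.eval1_0 b.hom_of_int b.hom_one)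
  have "base_emb D * y ^ p = coord_x ^ m * (of_int a + coord_x)"
    using coord_y_equation[OF D(1) p0, of ?f] f by (simp add: y_def eval1_def)
  moreover have "const_emb e * base_emb D = 1"
    using D(1) by (simp add: e_def base_emb_def flip: const_emb.hom_mult to_ac_mult)
      (simp add: const_emb.hom_one)
  ultimately have "y ^ p = const_emb e * (coord_x ^ m * (of_int a + coord_x))"
    by (metis mult.assoc mult_1)
  also have "\<dots> = eval_x (smult e (monom 1 m * [:of_int a, 1:]))"
    unfolding monom const_emb.eval1_smult eval_x.hom_mult eval_x.hom_power const_emb.eval1_X
    by (simp add: const_emb.eval1_pCons const_emb.eval1_0 const_emb.hom_of_int const_emb.hom_one)
  finally interpret superelliptic y p m e "of_int a" "smult e (monom 1 m * [:of_int a, 1:])"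
    by unfold_locales (use assms in \<open>simp_all add: e_def\<close>)
  have "\<beta> ^ p = inverse D * (\<alpha> ^ m * (\<alpha> + of_int a))"
    using D by (simp add: field_simps)
  then have "to_ac \<beta> ^ p = poly (smult e (monom 1 m * [:of_int a, 1:])) (to_ac \<alpha>)"
    by (simp add: e_def poly_monom algebra_simps flip: to_ac_power)
  then have "positive_rank (Jacobian_points y)"
    by (intro positive_rank_Jacobian_points[OF _ _ _ \<beta> transc])
      (auto simp: e_def simp del: to_ac_inverse)
  then show ?thesis by (simp add: superelliptic_Jacobian_def y_def)
qed

text \<open>Multiplying a relation of degree \<open>n\<close> by \<open>B ^ n\<close> and evaluating
  at \<open>\<theta>\<close> leaves only the leading coefficient times
  \<open>poly A \<theta> ^ n\<close>, which is nonzero.\<close>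

lemma transcendental_if_pole:
  fixes A B :: "'r::field_char_0 poly"
  assumes B: "B \<noteq> 0" "poly B \<theta> = 0" and A: "poly A \<theta> \<noteq> 0"
    and q: "eval1 of_int (to_fract A / to_fract B) q = 0"
  shows "q = (0 :: int poly)"
proof (rule ccontr)
  assume "q \<noteq> 0"
  interpret i: ring_morphism "of_int :: int \<Rightarrow> 'r poly fract" by (rule of_int_morphism)
  define n where "n = degree q"
  let ?A = "to_fract A" and ?B = "to_fract B"
  have hom: "ring_morphism (to_fract :: 'r poly \<Rightarrow> _)" by standard simp_all
  interpret t: ring_morphism "to_fract :: 'r poly \<Rightarrow> _" by (rule hom)
  have "0 = ?B ^ n * (\<Sum>i<Suc n. of_int (coeff q i) * (?A / ?B) ^ i)"
    using q i.eval1_sum[of q "Suc n" "?A / ?B"] by (simp add: n_def)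
  also have "\<dots> = (\<Sum>i<Suc n. of_int (coeff q i) * ?A ^ i * ?B ^ (n - i))"
    unfolding sum_distrib_left
  proof (intro sum.cong refl)
    fix i assume "i \<in> {..<Suc n}"
    then have "?B ^ n = ?B ^ i * ?B ^ (n - i)" by (simp flip: power_add)
    then show "?B ^ n * (of_int (coeff q i) * (?A / ?B) ^ i) = of_int (coeff q i) * ?A ^ i * ?B ^ (n - i)"
      using B(1) by (simp add: power_divide)
  qed
  also have "\<dots> = to_fract (\<Sum>i<Suc n. of_int (coeff q i) * A ^ i * B ^ (n - i))"
    by (simp only: t.hom_sum t.hom_mult t.hom_power t.hom_of_int)
  finally have "(\<Sum>i<Suc n. of_int (coeff q i) * A ^ i * B ^ (n - i)) = 0"
    by (metis to_fract_eq_0_iff)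
  then have "poly (\<Sum>i<Suc n. of_int (coeff q i) * A ^ i * B ^ (n - i)) \<theta> = 0" by simp
  then have "(\<Sum>i<Suc n. of_int (coeff q i) * poly A \<theta> ^ i * poly B \<theta> ^ (n - i)) = 0"
    by (simp add: poly_sum del: sum.lessThan_Suc)
  moreover have "(\<Sum>i<n. of_int (coeff q i) * poly A \<theta> ^ i * poly B \<theta> ^ (n - i)) = 0"
    using B(2) by (intro sum.neutral) (simp add: power_0_left)
  ultimately have "of_int (coeff q n) * poly A \<theta> ^ n = 0" by simp
  then show False using A \<open>q \<noteq> 0\<close> by (simp add: n_def)
qed

theorem common_twist_positive_rank:
  fixes a b :: int and p m :: nat
  assumes "odd b" "a \<noteq> 0" "b \<noteq> 0" "prime p" "0 < m" "m < p - 1"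
  shows "\<exists>D :: 'r::field_char_0 poly fract. D \<noteq> 0 \<and>
    positive_rank (superelliptic_Jacobian D p (monom 1 m * [:of_int a, 1:])) \<and>
    positive_rank (superelliptic_Jacobian D p (monom 1 m * [:of_int b, 1:]))"
proof -
  \<comment> \<open>Numerator and denominator of X, as polynomials in \<open>t\<close>.\<close>
  define A B :: "'r poly" where "A = [:- of_int a:] + monom ((2 ^ p) ^ m * of_int b) p"
    and "B = 1 - monom ((2 ^ p) ^ (m + 1)) p"
  define t s x :: "'r poly fract" where "t = to_fract [:0, 1:]" and "s = 2 ^ p" and "x = to_fract A / to_fract B"
  define D where "D = x ^ m * (x + of_int a)"
  have p: "p > 0" using \<open>prime p\<close> prime_gt_0_nat by blast

  interpret tf: ring_morphism "to_fract :: 'r poly \<Rightarrow> 'r poly fract"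
    by standard simp_all
  have tf_monom: "to_fract (monom c p) = to_fract [:c:] * t ^ p" for c :: 'r
  proof -
    have "monom c p = [:c:] * [:0, 1:] ^ p" by (simp add: monom_altdef)
    then show ?thesis by (simp only: tf.hom_mult tf.hom_power t_def)
  qed
  have two_eq: "to_fract [:2:] = (2 :: 'r poly fract)"
    using tf.hom_of_nat[of 2] by (simp add: numeral_poly)
  have int_eq: "to_fract [:of_int k:] = (of_int k :: 'r poly fract)" for k
  proof -
    have "[:of_int k:] = (of_int k :: 'r poly)" by (rule of_int_poly[symmetric])
    then show ?thesis by (simp only: tf.hom_of_int)
  qed
  have A_eq: "to_fract A = - of_int a + s ^ m * of_int b * t ^ p"
  proof -
    have "to_fract [:(2 ^ p) ^ m * of_int b:] = s ^ m * of_int b"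
      by (simp only: mult_to_poly[symmetric] poly_const_pow[symmetric] tf.hom_mult tf.hom_power two_eq s_def int_eq)
    then show ?thesis
      unfolding A_def tf.hom_add tf_monom using int_eq[of "- a"] by simp
  qed
  have B_eq: "to_fract B = 1 - s ^ (m + 1) * t ^ p"
    unfolding B_def tf.hom_diff tf_monom
    by (simp only: poly_const_pow[symmetric] tf.hom_power two_eq s_def tf.hom_one)

  \<comment> \<open>As \<open>s\<close> is a p-th power, \<open>s ^ (m + 1) * t ^ p = 1\<close> has
    this root already in the prime field.\<close>
  define \<theta> :: 'r where "\<theta> = inverse (2 ^ (m + 1))"
  have \<theta>: "\<theta> ^ p = inverse ((2 ^ p) ^ (m + 1))"
  proof -
    have "((2 :: 'r) ^ (m + 1)) ^ p = (2 ^ p) ^ (m + 1)"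
      by (simp only: power_mult[symmetric] mult.commute)
    then show ?thesis by (simp only: \<theta>_def power_inverse)
  qed
  have B\<theta>: "poly B \<theta> = 0"
    by (simp add: B_def poly_monom \<theta> del: power_Suc)
  have A\<theta>: "poly A \<theta> \<noteq> 0"
  proof
    assume "poly A \<theta> = 0"
    \<comment> \<open>At \<open>\<theta>\<close> the powers of 2 cancel down to
      \<open>b = s * a\<close>, which is even.\<close>
    then have "(of_int b :: 'r) = of_int (2 ^ p * a)"
      by (simp add: A_def poly_monom \<theta> field_simps)
    then have "b = 2 ^ p * a" by (simp only: of_int_eq_iff)
    then show False using \<open>odd b\<close> p by simp
  qed
  have B0: "B \<noteq> 0"
  proof
    assume "B = 0"
    then have "poly B 0 = 0" by simp
    then show False using p by (simp add: B_def poly_monom power_0_left)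
  qed
  have transc: "q = 0" if "eval1 of_int x q = 0" for q :: "int poly"
    using transcendental_if_pole[OF B0 B\<theta> A\<theta>] that by (simp add: x_def)
  have sx: "s * x = to_fract (smult (2 ^ p) A) / to_fract B"
  proof -
    have "smult (2 ^ p) A = [:2 ^ p:] * A" by simp
    then show ?thesis
      by (simp only: poly_const_pow[symmetric] tf.hom_mult tf.hom_power two_eq s_def x_def
          times_divide_eq_right)
  qed
  have transc': "q = 0" if "eval1 of_int (s * x) q = 0" for q :: "int poly"
    using transcendental_if_pole[OF B0 B\<theta>, of "smult (2 ^ p) A"] A\<theta> that by (simp add: sx)

  interpret i: ring_morphism "of_int :: int \<Rightarrow> 'r poly fract" by (rule of_int_morphism)
  \<comment> \<open>A linear integer polynomial cannot vanish at a transcendental element;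
    \<open>k = 0\<close> and \<open>k = a\<close> are the factors of \<open>D\<close>.\<close>
  have "x + of_int k \<noteq> 0" for k
    using transc[of "[:k, 1:]"] by (auto simp: i.eval1_pCons i.eval1_0 add.commute)
  from this[of 0] this[of a] have D0: "D \<noteq> 0" by (simp add: D_def)
  have "to_fract B \<noteq> 0" using B0 by simp
  then have "x * to_fract B = to_fract A" by (simp add: x_def)
  then have "x + of_int a = t ^ p * (s ^ m * (s * x + of_int b))"
    unfolding A_eq B_eq by (simp add: algebra_simps)
  then have D_eq: "D = t ^ p * ((s * x) ^ m * (s * x + of_int b))"
    by (simp add: D_def power_mult_distrib mult_ac)
  have t0: "t \<noteq> 0" by (simp add: t_def)

  have pm: "m + 1 < p" using \<open>m < p - 1\<close> by simp
  have "D * 1 ^ p = x ^ m * (x + of_int a)" by (simp add: D_def)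
  then have "positive_rank (superelliptic_Jacobian D p (monom 1 m * [:of_int a, 1:]))"
    using positive_rank_superelliptic_Jacobian[of p m a D 1 x] assms pm D0 transc by simp
  moreover have "D * inverse t ^ p = (s * x) ^ m * (s * x + of_int b)"
    using t0 by (simp add: D_eq power_inverse)
  then have "positive_rank (superelliptic_Jacobian D p (monom 1 m * [:of_int b, 1:]))"
    using positive_rank_superelliptic_Jacobian[of p m b D "inverse t" "s * x"] assms pm D0 t0 transc'
    by simp
  ultimately show ?thesis using D0 by blast
qed

theorem theorem5p9:
  fixes a b :: int and p m :: nat
  assumes "odd a" and "a \<noteq> 0" and "odd b" and "b \<noteq> 0"
    and "prime p" and "odd p" and "p \<noteq> 7"
    and "0 < m" and "m < p - 1"
  shows "\<exists>D :: Quvwt. D \<noteq> 0 \<and>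
    positive_rank (superelliptic_Jacobian D p (monom 1 m * [:of_int a, 1:])) \<and>
    positive_rank (superelliptic_Jacobian D p (monom 1 m * [:of_int b, 1:]))"
  \<comment> \<open>Here \<open>'r\<close> is Q(u,v,w), and \<open>t\<close> is the outermost
    variable of \<open>Quvwt\<close>.\<close>
  using assms by (intro common_twist_positive_rank)

end
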